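(* Let $\mathbf E$ be a categorical idempotent in a triangulated monoidal category $\mathcal A$. Then $\mathrm{end}_{\mathcal A}(\mathbf E)$ is a graded commutative $\mathrm{end}_{\mathcal A}(\mathbb 1)$-algebra. The unit map $\mathrm{end}_{\mathcal A}(\mathbb 1)\to\mathrm{end}_{\mathcal A}(\mathbf E)$ can be defined in one of two ways, which coincide: $$a\mapsto a\otimes\mathrm{Id}_{\mathbf E}=\mathrm{Id}_{\mathbf E}\otimes a.$$ That is, $R_a=L_a$ in $\mathrm{end}_{\mathcal A}(\mathbf E)$ for every homogeneous $a\in\mathrm{end}_{\mathcal A}(\mathbb 1)$.
   Context: A triangulated monoidal category is an additive category $\mathcal A$ equipped with: a triangulated structure (an invertible suspension endofunctor $[1]$ and a class of distinguished triangles satisfying the usual axioms, including Verdier's octahedral axiom); a monoidal structure $(\otimes,\mathbb 1)$ with left unitor $\lambda$; and natural isomorphisms $\alpha_A:A\otimes\mathbb 1[1]\to A[1]$ and $\beta_A:\mathbb 1[1]\otimes A\to A\otimes\mathbb 1[1]$ such that (suppressing associators) $\alpha_{\mathbb 1}=\lambda_{\mathbb 1[1]}$, $\alpha_{A[1]}\circ(\alpha_A\otimes\mathrm{Id}_{\mathbb 1[1]})=\alpha_A[1]\circ\alpha_{A\otimes\mathbb 1[1]}$, $\beta_{\mathbb 1[1]}=-\mathrm{Id}$, and $\beta_{A\otimes B}=(\mathrm{Id}_A\otimes\beta_B)\circ(\beta_A\otimes\mathrm{Id}_B)$. Further, for each distinguished triangle $A\to B\to C\to A[1]$ and each object $D$,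 the triangles $D\otimes A\to D\otimes B\to D\otimes C\to (D\otimes A)[1]$ and $A\otimes D\to B\otimes D\to C\otimes D\to (A\otimes D)[1]$ are distinguished, where the identifications $D\otimes A[1]\cong(D\otimes A)[1]$ and $A[1]\otimes D\cong(A\otimes D)[1]$ are built from $\alpha,\beta$ and the associator. From $\alpha,\beta$ one obtains natural isomorphisms $A[k]\cong A\otimes\mathbb 1[k]$ and $\mathbb 1[k]\otimes A\cong A\otimes\mathbb 1[k]$ for $k\in\mathbb Z$. $\mathrm{end}_{\mathcal A}(A):=\bigoplus_{k\in\mathbb Z}\mathrm{Hom}_{\mathcal A}(A,A[k])$, a graded ring under composition $g\circ f:=g[k]\circ f$ for $f$ of degree $k$. For $a\in\mathrm{end}_{\mathcal A}(\mathbb 1)$ of degree $k$ and $A\in\mathcal A$, $L_a=a\otimes \mathrm{Id}_A$ is the composition $A\cong\mathbb 1\otimes A\xrightarrow{a\otimes\mathrm{Id}_A}\mathbb 1[k]\otimes A\cong A\otimes\mathbb 1[k]\cong A[k]$ and $R_a=\mathrm{Id}_A\otimes a$ is the composition $A\cong A\otimes\mathbb 1\xrightarrow{\mathrm{Id}_A\otimes a}A\otimes\mathbb 1[k]\cong A[k]$. A graded ring is graded commutative if $ab=(-1)^{|a||b|}ba$ for homogeneous $a,b$; a graded algebra over a graded commutative ring $\Bbbk$ is a graded ring $R$ with a homogeneous ring map from $\Bbbk$ to the graded center of $R$. A weak idempotent is an object $\mathbf E$ with $\mathbf E\otimes\mathbf E\cong\mathbf E$; for such $\mathbf E$, $\mathbf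 E\mathcal A\mathbf E$ is the full subcategory of objects $A$ with $\mathbf E\otimes A\cong A\cong A\otimes\mathbf E$. A unital idempotent relative to $\mathbf E$ is an object $\mathbf U\in\mathbf E\mathcal A\mathbf E$ with a map $\eta:\mathbf E\to\mathbf U$ such that $\eta\otimes\mathrm{Id}_{\mathbf U}:\mathbf E\otimes\mathbf U\to\mathbf U\otimes\mathbf U$ and $\mathrm{Id}_{\mathbf U}\otimes\eta:\mathbf U\otimes\mathbf E\to\mathbf U\otimes\mathbf U$ are isomorphisms. A counital idempotent relative to $\mathbf E$ is an object $\mathbf C\in\mathbf E\mathcal A\mathbf E$ with a map $\varepsilon:\mathbf C\to\mathbf E$ such that $\varepsilon\otimes\mathrm{Id}_{\mathbf C}$ and $\mathrm{Id}_{\mathbf C}\otimes\varepsilon$ are isomorphisms. $\mathbf E$ is a categorical idempotent if there is a chain $\mathbb 1=\mathbf E_0,\dots,\mathbf E_r=\mathbf E$ such that $\mathbf E_i$ has the structure of a unital or counital idempotent relative to $\mathbf E_{i-1}$ for $1\le i\le r$. *)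

theory Defs
  imports "HOL-Algebra.Ring" "HOL-Algebra.Generated_Groups"
begin

section \<open>Categories\<close>

text \<open>
  A category is given by its objects (the elements of a type \<open>'o\<close>), its arrows (the elements
  of a type \<open>'m\<close>), sources, targets, identities and composition.  The value of
  \<open>g \<cdot> f\<close> is meaningful only if the target of \<open>f\<close> is the source of \<open>g\<close>; likewise the
  sum of two arrows (below) is meaningful only for parallel arrows.
\<close>

record ('o, 'm) category =
  src :: "'m \<Rightarrow> 'o"
  tgt :: "'m \<Rightarrow> 'o"
  ident :: "'o \<Rightarrow> 'm"
  cmp :: "'m \<Rightarrow> 'm \<Rightarrow> 'm"  (infixr "\<cdot>\<index>" 60)

definition Hom :: "('o, 'm, 'z) category_scheme \<Rightarrow> 'o \<Rightarrow> 'o \<Rightarrow> 'm set" where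
  "Hom C A B = {f. src C f = A \<and> tgt C f = B}"

locale category =
  fixes C :: "('o, 'm, 'z) category_scheme" (structure)
  assumes ident_in_Hom: "ident C A \<in> Hom C A A"
    and cmp_in_Hom: "\<lbrakk>f \<in> Hom C X Y; g \<in> Hom C Y Z\<rbrakk> \<Longrightarrow> g \<cdot> f \<in> Hom C X Z"
    and cmp_ident: "f \<in> Hom C X Y \<Longrightarrow> f \<cdot> ident C X = f"
    and ident_cmp: "f \<in> Hom C X Y \<Longrightarrow> ident C Y \<cdot> f = f"
    and cmp_assoc: "\<lbrakk>f \<in> Hom C W X; g \<in> Hom C X Y; h \<in> Hom C Y Z\<rbrakk>
          \<Longrightarrow> (h \<cdot> g) \<cdot> f = h \<cdot> (g \<cdot> f)"

definition inverse_arrows :: "('o, 'm, 'z) category_scheme \<Rightarrow> 'm \<Rightarrow> 'm \<Rightarrow> bool" where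
  "inverse_arrows C f g \<longleftrightarrow> src C g = tgt C f \<and> tgt C g = src C f \<and>
     g \<cdot>\<^bsub>C\<^esub> f = ident C (src C f) \<and> f \<cdot>\<^bsub>C\<^esub> g = ident C (tgt C f)"

definition is_iso :: "('o, 'm, 'z) category_scheme \<Rightarrow> 'm \<Rightarrow> bool" where
  "is_iso C f \<longleftrightarrow> (\<exists>g. inverse_arrows C f g)"

definition inverse_arrow :: "('o, 'm, 'z) category_scheme \<Rightarrow> 'm \<Rightarrow> 'm" where
  "inverse_arrow C f = (THE g. inverse_arrows C f g)"

definition isomorphic :: "('o, 'm, 'z) category_scheme \<Rightarrow> 'o \<Rightarrow> 'o \<Rightarrow> bool" where
  "isomorphic C A B \<longleftrightarrow> (\<exists>f \<in> Hom C A B. is_iso C f)"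


section \<open>Additive categories\<close>

record ('o, 'm) additive_category = "('o, 'm) category" +
  mor_add :: "'m \<Rightarrow> 'm \<Rightarrow> 'm"  (infixl "+\<^sub>m\<index>" 58)
  mor_zero :: "'o \<Rightarrow> 'o \<Rightarrow> 'm"

text \<open>The group of arrows from \<open>A\<close> to \<open>B\<close>; addition of arrows is its \<open>mult\<close>.\<close>

definition Hom_group :: "('o, 'm, 'z) additive_category_scheme \<Rightarrow> 'o \<Rightarrow> 'o \<Rightarrow> 'm monoid" where
  "Hom_group C A B = \<lparr>carrier = Hom C A B, mult = mor_add C, one = mor_zero C A B\<rparr>"

definition mor_neg :: "('o, 'm, 'z) additive_category_scheme \<Rightarrow> 'm \<Rightarrow> 'm" where
  "mor_neg C f = inv\<^bsub>Hom_group C (src C f) (tgt C f)\<^esub> f"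

definition is_zero_obj :: "('o, 'm, 'z) additive_category_scheme \<Rightarrow> 'o \<Rightarrow> bool" where
  "is_zero_obj C Z \<longleftrightarrow> ident C Z = mor_zero C Z Z"

locale additive_category = category C
  for C :: "('o, 'm, 'z) additive_category_scheme" (structure) +
  assumes Hom_group: "comm_group (Hom_group C A B)"
    and cmp_add_left: "\<lbrakk>f \<in> Hom C X Y; g \<in> Hom C Y Z; g' \<in> Hom C Y Z\<rbrakk>
          \<Longrightarrow> (g +\<^sub>m g') \<cdot> f = (g \<cdot> f) +\<^sub>m (g' \<cdot> f)"
    and cmp_add_right: "\<lbrakk>f \<in> Hom C X Y; f' \<in> Hom C X Y; g \<in> Hom C Y Z\<rbrakk>
          \<Longrightarrow> g \<cdot> (f +\<^sub>m f') = (g \<cdot> f) +\<^sub>m (g \<cdot> f')"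
    and zero_obj: "\<exists>Z. is_zero_obj C Z"
    and biproduct: "\<exists>P. \<exists>i\<^sub>1 \<in> Hom C A P. \<exists>i\<^sub>2 \<in> Hom C B P. \<exists>p\<^sub>1 \<in> Hom C P A. \<exists>p\<^sub>2 \<in> Hom C P B.
          p\<^sub>1 \<cdot> i\<^sub>1 = ident C A \<and> p\<^sub>2 \<cdot> i\<^sub>2 = ident C B \<and>
          p\<^sub>1 \<cdot> i\<^sub>2 = mor_zero C B A \<and> p\<^sub>2 \<cdot> i\<^sub>1 = mor_zero C A B \<and>
          (i\<^sub>1 \<cdot> p\<^sub>1) +\<^sub>m (i\<^sub>2 \<cdot> p\<^sub>2) = ident C P"


section \<open>Triangulated categories\<close>

text \<open>\<open>\<Sigma>\<^sub>o\<close> and \<open>\<Sigma>\<^sub>m\<close> are the action of the suspension \<open>[1]\<close> on objects and on arrows.\<close>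

record ('o, 'm) triangulated_category = "('o, 'm) additive_category" +
  sus_obj :: "'o \<Rightarrow> 'o"  ("\<Sigma>\<^sub>o\<index> _" [90] 90)
  sus_mor :: "'m \<Rightarrow> 'm"  ("\<Sigma>\<^sub>m\<index> _" [90] 90)
  distinguished :: "'m \<Rightarrow> 'm \<Rightarrow> 'm \<Rightarrow> bool"

definition triangle ::
  "('o, 'm, 'z) triangulated_category_scheme \<Rightarrow> 'o \<Rightarrow> 'o \<Rightarrow> 'o \<Rightarrow> 'm \<Rightarrow> 'm \<Rightarrow> 'm \<Rightarrow> bool" where
  "triangle C X Y Z f g h \<longleftrightarrow> f \<in> Hom C X Y \<and> g \<in> Hom C Y Z \<and> h \<in> Hom C Z (\<Sigma>\<^sub>o\<^bsub>C\<^esub> X)"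

definition dist_triangle ::
  "('o, 'm, 'z) triangulated_category_scheme \<Rightarrow> 'o \<Rightarrow> 'o \<Rightarrow> 'o \<Rightarrow> 'm \<Rightarrow> 'm \<Rightarrow> 'm \<Rightarrow> bool" where
  "dist_triangle C X Y Z f g h \<longleftrightarrow> triangle C X Y Z f g h \<and> distinguished C f g h"

locale triangulated_category = additive_category C
  for C :: "('o, 'm, 'z) triangulated_category_scheme" (structure) +
  assumes sus_obj_bij: "bij (sus_obj C)"
    and sus_mor_bij: "bij (sus_mor C)"
    and sus_mor_in_Hom: "f \<in> Hom C A B \<Longrightarrow> \<Sigma>\<^sub>m f \<in> Hom C (\<Sigma>\<^sub>o A) (\<Sigma>\<^sub>o B)"
    and sus_ident: "\<Sigma>\<^sub>m (ident C A) = ident C (\<Sigma>\<^sub>o A)"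
    and sus_cmp: "\<lbrakk>f \<in> Hom C X Y; g \<in> Hom C Y Z\<rbrakk> \<Longrightarrow> \<Sigma>\<^sub>m (g \<cdot> f) = \<Sigma>\<^sub>m g \<cdot> \<Sigma>\<^sub>m f"
    and sus_add: "\<lbrakk>f \<in> Hom C X Y; g \<in> Hom C X Y\<rbrakk> \<Longrightarrow> \<Sigma>\<^sub>m (f +\<^sub>m g) = \<Sigma>\<^sub>m f +\<^sub>m \<Sigma>\<^sub>m g"
    and TR1_iso: "\<lbrakk>dist_triangle C X Y Z f g h; triangle C X' Y' Z' f' g' h';
            u \<in> Hom C X X'; v \<in> Hom C Y Y'; w \<in> Hom C Z Z';
            is_iso C u; is_iso C v; is_iso C w;
            f' \<cdot> u = v \<cdot> f; g' \<cdot> v = w \<cdot> g; h' \<cdot> w = \<Sigma>\<^sub>m u \<cdot> h\<rbrakk>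
          \<Longrightarrow> dist_triangle C X' Y' Z' f' g' h'"
    and TR1_ident: "is_zero_obj C Z
          \<Longrightarrow> dist_triangle C X X Z (ident C X) (mor_zero C X Z) (mor_zero C Z (\<Sigma>\<^sub>o X))"
    and TR1_cone: "f \<in> Hom C X Y \<Longrightarrow> \<exists>Z g h. dist_triangle C X Y Z f g h"
    and TR2: "triangle C X Y Z f g h \<Longrightarrow>
          dist_triangle C X Y Z f g h \<longleftrightarrow> dist_triangle C Y Z (\<Sigma>\<^sub>o X) g h (mor_neg C (\<Sigma>\<^sub>m f))"
    and TR3: "\<lbrakk>dist_triangle C X Y Z f g h; dist_triangle C X' Y' Z' f' g' h';
            u \<in> Hom C X X'; v \<in> Hom C Y Y'; f' \<cdot> u = v \<cdot> f\<rbrakk>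
          \<Longrightarrow> \<exists>w \<in> Hom C Z Z'. g' \<cdot> v = w \<cdot> g \<and> h' \<cdot> w = \<Sigma>\<^sub>m u \<cdot> h"
    and TR4_octahedral: "\<lbrakk>dist_triangle C X Y Z' f a b; dist_triangle C Y Z X' g c d;
            dist_triangle C X Z Y' (g \<cdot> f) e k\<rbrakk>
          \<Longrightarrow> \<exists>u v. dist_triangle C Z' Y' X' u v (\<Sigma>\<^sub>m a \<cdot> d) \<and>
                u \<cdot> a = e \<cdot> g \<and> k \<cdot> u = b \<and> v \<cdot> e = c \<and> d \<cdot> v = \<Sigma>\<^sub>m f \<cdot> k"

definition int_iterate :: "('a \<Rightarrow> 'a) \<Rightarrow> int \<Rightarrow> 'a \<Rightarrow> 'a" where
  "int_iterate f k = (if 0 \<le> k then f ^^ nat k else (inv_into UNIV f) ^^ nat (- k))"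

text \<open>\<open>A[k]\<close> and \<open>f[k]\<close> for an integer \<open>k\<close>.\<close>

definition shift_obj :: "('o, 'm, 'z) triangulated_category_scheme \<Rightarrow> int \<Rightarrow> 'o \<Rightarrow> 'o" where
  "shift_obj C = int_iterate (sus_obj C)"

definition shift_mor :: "('o, 'm, 'z) triangulated_category_scheme \<Rightarrow> int \<Rightarrow> 'm \<Rightarrow> 'm" where
  "shift_mor C = int_iterate (sus_mor C)"


section \<open>Triangulated monoidal categories\<close>

text \<open>
  The fields \<open>alpha\<close> and \<open>beta\<close> are the structure maps \<open>\<alpha>\<^sub>A : A \<otimes> \<one>[1] \<rightarrow> A[1]\<close> and
  \<open>\<beta>\<^sub>A : \<one>[1] \<otimes> A \<rightarrow> A \<otimes> \<one>[1]\<close>.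
\<close>

record ('o, 'm) tm_category = "('o, 'm) triangulated_category" +
  tensor_obj :: "'o \<Rightarrow> 'o \<Rightarrow> 'o"  (infixr "\<otimes>\<^sub>o\<index>" 70)
  tensor_mor :: "'m \<Rightarrow> 'm \<Rightarrow> 'm"  (infixr "\<otimes>\<^sub>m\<index>" 70)
  unit_obj :: "'o"
  associator :: "'o \<Rightarrow> 'o \<Rightarrow> 'o \<Rightarrow> 'm"
  left_unitor :: "'o \<Rightarrow> 'm"
  right_unitor :: "'o \<Rightarrow> 'm"
  alpha :: "'o \<Rightarrow> 'm"
  beta :: "'o \<Rightarrow> 'm"

locale monoidal_category = category C
  for C :: "('o, 'm, 'z) tm_category_scheme" (structure) +
  assumes tensor_in_Hom: "\<lbrakk>f \<in> Hom C A A'; g \<in> Hom C B B'\<rbrakk>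
          \<Longrightarrow> f \<otimes>\<^sub>m g \<in> Hom C (A \<otimes>\<^sub>o B) (A' \<otimes>\<^sub>o B')"
    and tensor_ident: "ident C A \<otimes>\<^sub>m ident C B = ident C (A \<otimes>\<^sub>o B)"
    and tensor_cmp: "\<lbrakk>f \<in> Hom C X Y; f' \<in> Hom C Y Z; g \<in> Hom C X' Y'; g' \<in> Hom C Y' Z'\<rbrakk>
          \<Longrightarrow> (f' \<cdot> f) \<otimes>\<^sub>m (g' \<cdot> g) = (f' \<otimes>\<^sub>m g') \<cdot> (f \<otimes>\<^sub>m g)"
    and associator_in_Hom:
          "associator C X Y Z \<in> Hom C ((X \<otimes>\<^sub>o Y) \<otimes>\<^sub>o Z) (X \<otimes>\<^sub>o (Y \<otimes>\<^sub>o Z))"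
    and associator_iso: "is_iso C (associator C X Y Z)"
    and associator_natural: "\<lbrakk>f \<in> Hom C X X'; g \<in> Hom C Y Y'; h \<in> Hom C Z Z'\<rbrakk>
          \<Longrightarrow> associator C X' Y' Z' \<cdot> ((f \<otimes>\<^sub>m g) \<otimes>\<^sub>m h)
            = (f \<otimes>\<^sub>m (g \<otimes>\<^sub>m h)) \<cdot> associator C X Y Z"
    and left_unitor_in_Hom: "left_unitor C A \<in> Hom C (unit_obj C \<otimes>\<^sub>o A) A"
    and left_unitor_iso: "is_iso C (left_unitor C A)"
    and left_unitor_natural: "f \<in> Hom C A B
          \<Longrightarrow> left_unitor C B \<cdot> (ident C (unit_obj C) \<otimes>\<^sub>m f) = f \<cdot> left_unitor C A"
    and right_unitor_in_Hom: "right_unitor C A \<in> Hom C (A \<otimes>\<^sub>o unit_obj C) A"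
    and right_unitor_iso: "is_iso C (right_unitor C A)"
    and right_unitor_natural: "f \<in> Hom C A B
          \<Longrightarrow> right_unitor C B \<cdot> (f \<otimes>\<^sub>m ident C (unit_obj C)) = f \<cdot> right_unitor C A"
    and triangle_identity:
          "(ident C A \<otimes>\<^sub>m left_unitor C B) \<cdot> associator C A (unit_obj C) B
            = right_unitor C A \<otimes>\<^sub>m ident C B"
    and pentagon_identity:
          "associator C W X (Y \<otimes>\<^sub>o Z) \<cdot> associator C (W \<otimes>\<^sub>o X) Y Z
            = (ident C W \<otimes>\<^sub>m associator C X Y Z) \<cdot> associator C W (X \<otimes>\<^sub>o Y) Z
                \<cdot> (associator C W X Y \<otimes>\<^sub>m ident C Z)"

abbreviation sus_unit :: "('o, 'm, 'z) tm_category_scheme \<Rightarrow> 'o" where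
  "sus_unit C \<equiv> \<Sigma>\<^sub>o\<^bsub>C\<^esub> (unit_obj C)"

text \<open>
  The identification \<open>D \<otimes> A[1] \<cong> (D \<otimes> A)[1]\<close>, namely
  \<open>D \<otimes> A[1] \<cong> D \<otimes> (A \<otimes> \<one>[1]) \<cong> (D \<otimes> A) \<otimes> \<one>[1] \<cong> (D \<otimes> A)[1]\<close>.
\<close>

definition sus_out_right :: "('o, 'm, 'z) tm_category_scheme \<Rightarrow> 'o \<Rightarrow> 'o \<Rightarrow> 'm" where
  "sus_out_right C D A =
     alpha C (D \<otimes>\<^sub>o\<^bsub>C\<^esub> A)
       \<cdot>\<^bsub>C\<^esub> inverse_arrow C (associator C D A (sus_unit C))
       \<cdot>\<^bsub>C\<^esub> (ident C D \<otimes>\<^sub>m\<^bsub>C\<^esub> inverse_arrow C (alpha C A))"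

text \<open>
  The identification \<open>A[1] \<otimes> D \<cong> (A \<otimes> D)[1]\<close>, namely
  \<open>A[1] \<otimes> D \<cong> (A \<otimes> \<one>[1]) \<otimes> D \<cong> A \<otimes> (\<one>[1] \<otimes> D) \<cong> A \<otimes> (D \<otimes> \<one>[1]) \<cong> (A \<otimes> D) \<otimes> \<one>[1] \<cong> (A \<otimes> D)[1]\<close>.
\<close>

definition sus_out_left :: "('o, 'm, 'z) tm_category_scheme \<Rightarrow> 'o \<Rightarrow> 'o \<Rightarrow> 'm" where
  "sus_out_left C A D =
     alpha C (A \<otimes>\<^sub>o\<^bsub>C\<^esub> D)
       \<cdot>\<^bsub>C\<^esub> inverse_arrow C (associator C A D (sus_unit C))
       \<cdot>\<^bsub>C\<^esub> (ident C A \<otimes>\<^sub>m\<^bsub>C\<^esub> beta C D)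
       \<cdot>\<^bsub>C\<^esub> associator C A (sus_unit C) D
       \<cdot>\<^bsub>C\<^esub> (inverse_arrow C (alpha C A) \<otimes>\<^sub>m\<^bsub>C\<^esub> ident C D)"

text \<open>
  Biadditivity of the tensor product is not an axiom: it follows from exactness.
\<close>

locale triangulated_monoidal_category = triangulated_category C + monoidal_category C
  for C :: "('o, 'm, 'z) tm_category_scheme" (structure) +
  assumes alpha_in_Hom: "alpha C A \<in> Hom C (A \<otimes>\<^sub>o sus_unit C) (\<Sigma>\<^sub>o A)"
    and alpha_iso: "is_iso C (alpha C A)"
    and alpha_natural: "f \<in> Hom C A B
          \<Longrightarrow> alpha C B \<cdot> (f \<otimes>\<^sub>m ident C (sus_unit C)) = \<Sigma>\<^sub>m f \<cdot> alpha C A"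
    and beta_in_Hom: "beta C A \<in> Hom C (sus_unit C \<otimes>\<^sub>o A) (A \<otimes>\<^sub>o sus_unit C)"
    and beta_iso: "is_iso C (beta C A)"
    and beta_natural: "f \<in> Hom C A B
          \<Longrightarrow> beta C B \<cdot> (ident C (sus_unit C) \<otimes>\<^sub>m f)
            = (f \<otimes>\<^sub>m ident C (sus_unit C)) \<cdot> beta C A"
    and alpha_unit: "alpha C (unit_obj C) = left_unitor C (sus_unit C)"
    and alpha_sus: "alpha C (\<Sigma>\<^sub>o A) \<cdot> (alpha C A \<otimes>\<^sub>m ident C (sus_unit C))
          = \<Sigma>\<^sub>m (alpha C A) \<cdot> alpha C (A \<otimes>\<^sub>o sus_unit C)"
    and beta_sus_unit:
          "beta C (sus_unit C) = mor_neg C (ident C (sus_unit C \<otimes>\<^sub>o sus_unit C))"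
    and beta_tensor:
          "associator C A B (sus_unit C) \<cdot> beta C (A \<otimes>\<^sub>o B) \<cdot> associator C (sus_unit C) A B
            = (ident C A \<otimes>\<^sub>m beta C B) \<cdot> associator C A (sus_unit C) B
                \<cdot> (beta C A \<otimes>\<^sub>m ident C B)"
    and tensor_left_exact: "dist_triangle C X Y Z f g h
          \<Longrightarrow> dist_triangle C (D \<otimes>\<^sub>o X) (D \<otimes>\<^sub>o Y) (D \<otimes>\<^sub>o Z)
                (ident C D \<otimes>\<^sub>m f) (ident C D \<otimes>\<^sub>m g)
                (sus_out_right C D X \<cdot> (ident C D \<otimes>\<^sub>m h))"
    and tensor_right_exact: "dist_triangle C X Y Z f g h
          \<Longrightarrow> dist_triangle C (X \<otimes>\<^sub>o D) (Y \<otimes>\<^sub>o D) (Z \<otimes>\<^sub>o D)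
                (f \<otimes>\<^sub>m ident C D) (g \<otimes>\<^sub>m ident C D)
                (sus_out_left C X D \<cdot> (h \<otimes>\<^sub>m ident C D))"

text \<open>
  The isomorphisms \<open>\<alpha>\<^bsup>(k)\<^esup>\<^sub>A : A \<otimes> \<one>[k] \<rightarrow> A[k]\<close>.  They are determined by \<open>\<alpha>\<^bsup>(0)\<^esup>\<^sub>A = \<rho>\<^sub>A\<close> and, for
  every integer \<open>k\<close>,
  \<open>\<alpha>\<^bsup>(k+1)\<^esup>\<^sub>A : A \<otimes> \<one>[k][1] \<cong> (A \<otimes> \<one>[k])[1] \<rightarrow> A[k][1]\<close>, where the last map is \<open>\<alpha>\<^bsup>(k)\<^esup>\<^sub>A[1]\<close>;
  for negative degrees this relation is solved for \<open>\<alpha>\<^bsup>(k)\<^esup>\<^sub>A\<close>.  In particular \<open>\<alpha>\<^bsup>(1)\<^esup> = \<alpha>\<close>.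
\<close>

primrec alpha_pos :: "('o, 'm, 'z) tm_category_scheme \<Rightarrow> nat \<Rightarrow> 'o \<Rightarrow> 'm" where
  "alpha_pos C 0 A = right_unitor C A"
| "alpha_pos C (Suc n) A =
     \<Sigma>\<^sub>m\<^bsub>C\<^esub> (alpha_pos C n A)
       \<cdot>\<^bsub>C\<^esub> sus_out_right C A (shift_obj C (int n) (unit_obj C))"

primrec alpha_neg :: "('o, 'm, 'z) tm_category_scheme \<Rightarrow> nat \<Rightarrow> 'o \<Rightarrow> 'm" where
  "alpha_neg C 0 A = right_unitor C A"
| "alpha_neg C (Suc n) A =
     shift_mor C (- 1) (alpha_neg C n A
       \<cdot>\<^bsub>C\<^esub> inverse_arrow C (sus_out_right C A (shift_obj C (- int (Suc n)) (unit_obj C))))"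

definition alpha_shift :: "('o, 'm, 'z) tm_category_scheme \<Rightarrow> int \<Rightarrow> 'o \<Rightarrow> 'm" where
  "alpha_shift C k A = (if 0 \<le> k then alpha_pos C (nat k) A else alpha_neg C (nat (- k)) A)"

text \<open>
  The isomorphisms \<open>\<beta>\<^bsup>(k)\<^esup>\<^sub>A : \<one>[k] \<otimes> A \<rightarrow> A \<otimes> \<one>[k]\<close>.  They are determined by
  \<open>\<beta>\<^bsup>(0)\<^esup>\<^sub>A = \<rho>\<^sub>A\<^sup>-\<^sup>1 \<lambda>\<^sub>A\<close> and, for every integer \<open>k\<close>,
  \<open>\<beta>\<^bsup>(k+1)\<^esup>\<^sub>A : \<one>[k][1] \<otimes> A \<cong> (\<one>[k] \<otimes> A)[1] \<rightarrow> (A \<otimes> \<one>[k])[1] \<cong> A \<otimes> \<one>[k][1]\<close>, where the middle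
  map is \<open>\<beta>\<^bsup>(k)\<^esup>\<^sub>A[1]\<close>; for negative degrees this relation is solved for \<open>\<beta>\<^bsup>(k)\<^esup>\<^sub>A\<close>.
\<close>

primrec beta_pos :: "('o, 'm, 'z) tm_category_scheme \<Rightarrow> nat \<Rightarrow> 'o \<Rightarrow> 'm" where
  "beta_pos C 0 A = inverse_arrow C (right_unitor C A) \<cdot>\<^bsub>C\<^esub> left_unitor C A"
| "beta_pos C (Suc n) A =
     inverse_arrow C (sus_out_right C A (shift_obj C (int n) (unit_obj C)))
       \<cdot>\<^bsub>C\<^esub> \<Sigma>\<^sub>m\<^bsub>C\<^esub> (beta_pos C n A)
       \<cdot>\<^bsub>C\<^esub> sus_out_left C (shift_obj C (int n) (unit_obj C)) A"

primrec beta_neg :: "('o, 'm, 'z) tm_category_scheme \<Rightarrow> nat \<Rightarrow> 'o \<Rightarrow> 'm" where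
  "beta_neg C 0 A = inverse_arrow C (right_unitor C A) \<cdot>\<^bsub>C\<^esub> left_unitor C A"
| "beta_neg C (Suc n) A =
     shift_mor C (- 1)
       (sus_out_right C A (shift_obj C (- int (Suc n)) (unit_obj C))
         \<cdot>\<^bsub>C\<^esub> beta_neg C n A
         \<cdot>\<^bsub>C\<^esub> inverse_arrow C (sus_out_left C (shift_obj C (- int (Suc n)) (unit_obj C)) A))"

definition beta_shift :: "('o, 'm, 'z) tm_category_scheme \<Rightarrow> int \<Rightarrow> 'o \<Rightarrow> 'm" where
  "beta_shift C k A = (if 0 \<le> k then beta_pos C (nat k) A else beta_neg C (nat (- k)) A)"

text \<open>\<open>L\<^sub>a = a \<otimes> Id\<^sub>A\<close> and \<open>R\<^sub>a = Id\<^sub>A \<otimes> a\<close> for \<open>a : \<one> \<rightarrow> \<one>[k]\<close>, as arrows \<open>A \<rightarrow> A[k]\<close>.\<close>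

definition left_mult :: "('o, 'm, 'z) tm_category_scheme \<Rightarrow> 'o \<Rightarrow> int \<Rightarrow> 'm \<Rightarrow> 'm" where
  "left_mult C A k a =
     alpha_shift C k A \<cdot>\<^bsub>C\<^esub> beta_shift C k A
       \<cdot>\<^bsub>C\<^esub> (a \<otimes>\<^sub>m\<^bsub>C\<^esub> ident C A) \<cdot>\<^bsub>C\<^esub> inverse_arrow C (left_unitor C A)"

definition right_mult :: "('o, 'm, 'z) tm_category_scheme \<Rightarrow> 'o \<Rightarrow> int \<Rightarrow> 'm \<Rightarrow> 'm" where
  "right_mult C A k a =
     alpha_shift C k A
       \<cdot>\<^bsub>C\<^esub> (ident C A \<otimes>\<^sub>m\<^bsub>C\<^esub> a) \<cdot>\<^bsub>C\<^esub> inverse_arrow C (right_unitor C A)"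


section \<open>Graded rings and graded algebras\<close>

text \<open>\<open>H k\<close> is the homogeneous component of degree \<open>k\<close> of the ring \<open>R\<close>.\<close>

definition graded_ring :: "('a, 'b) ring_scheme \<Rightarrow> (int \<Rightarrow> 'a set) \<Rightarrow> bool" where
  "graded_ring R H \<longleftrightarrow>
     ring R \<and>
     (\<forall>k. subgroup (H k) (add_monoid R)) \<and>
     \<one>\<^bsub>R\<^esub> \<in> H 0 \<and>
     (\<forall>k l. \<forall>a \<in> H k. \<forall>b \<in> H l. a \<otimes>\<^bsub>R\<^esub> b \<in> H (k + l)) \<and>
     (\<forall>x \<in> carrier R. \<exists>!c. (\<forall>k. c k \<in> H k) \<and> finite {k. c k \<noteq> \<zero>\<^bsub>R\<^esub>} \<and>
        x = (\<Oplus>\<^bsub>R\<^esub>k \<in> {k. c k \<noteq> \<zero>\<^bsub>R\<^esub>}. c k))"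

definition koszul_sign :: "('a, 'b) ring_scheme \<Rightarrow> int \<Rightarrow> 'a \<Rightarrow> 'a" where
  "koszul_sign R n x = (if even n then x else \<ominus>\<^bsub>R\<^esub> x)"

definition graded_commutative :: "('a, 'b) ring_scheme \<Rightarrow> (int \<Rightarrow> 'a set) \<Rightarrow> bool" where
  "graded_commutative R H \<longleftrightarrow>
     (\<forall>k l. \<forall>a \<in> H k. \<forall>b \<in> H l. a \<otimes>\<^bsub>R\<^esub> b = koszul_sign R (k * l) (b \<otimes>\<^bsub>R\<^esub> a))"

text \<open>The graded center is spanned additively by the homogeneous graded-central elements.\<close>

definition graded_center :: "('a, 'b) ring_scheme \<Rightarrow> (int \<Rightarrow> 'a set) \<Rightarrow> 'a set" where
  "graded_center R H = generate (add_monoid R)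
     (\<Union>k. {z \<in> H k. \<forall>l. \<forall>x \<in> H l. z \<otimes>\<^bsub>R\<^esub> x = koszul_sign R (k * l) (x \<otimes>\<^bsub>R\<^esub> z)})"

definition graded_algebra ::
  "('a, 'b) ring_scheme \<Rightarrow> (int \<Rightarrow> 'a set) \<Rightarrow> ('c, 'd) ring_scheme \<Rightarrow> (int \<Rightarrow> 'c set)
     \<Rightarrow> ('a \<Rightarrow> 'c) \<Rightarrow> bool" where
  "graded_algebra K HK R HR \<phi> \<longleftrightarrow>
     graded_ring K HK \<and> graded_commutative K HK \<and> graded_ring R HR \<and>
     \<phi> \<in> ring_hom K R \<and> (\<forall>k. \<phi> ` HK k \<subseteq> HR k) \<and> \<phi> ` carrier K \<subseteq> graded_center R HR"


section \<open>The graded endomorphism ring\<close>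

text \<open>
  Elements of \<open>\<Oplus>\<^sub>k Hom(A, A[k])\<close> are finitely supported families \<open>x\<close> with
  \<open>x k : A \<rightarrow> A[k]\<close>; the product extends \<open>g \<circ> f = g[k] \<circ> f\<close> (for \<open>f\<close> of degree \<open>k\<close>) biadditively.
\<close>

definition end_supp :: "('o, 'm, 'z) tm_category_scheme \<Rightarrow> 'o \<Rightarrow> (int \<Rightarrow> 'm) \<Rightarrow> int set" where
  "end_supp C A x = {k. x k \<noteq> mor_zero C A (shift_obj C k A)}"

definition end_ring :: "('o, 'm, 'z) tm_category_scheme \<Rightarrow> 'o \<Rightarrow> (int \<Rightarrow> 'm) ring" where
  "end_ring C A =
     \<lparr>carrier = {x. (\<forall>k. x k \<in> Hom C A (shift_obj C k A)) \<and> finite (end_supp C A x)},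
      mult = (\<lambda>y x n. \<Otimes>\<^bsub>Hom_group C A (shift_obj C n A)\<^esub>k \<in> end_supp C A x.
                        shift_mor C k (y (n - k)) \<cdot>\<^bsub>C\<^esub> x k),
      one = (\<lambda>k. if k = 0 then ident C A else mor_zero C A (shift_obj C k A)),
      zero = (\<lambda>k. mor_zero C A (shift_obj C k A)),
      add = (\<lambda>x y k. x k +\<^sub>m\<^bsub>C\<^esub> y k)\<rparr>"

definition end_comp :: "('o, 'm, 'z) tm_category_scheme \<Rightarrow> 'o \<Rightarrow> int \<Rightarrow> (int \<Rightarrow> 'm) set" where
  "end_comp C A k = {x \<in> carrier (end_ring C A). end_supp C A x \<subseteq> {k}}"

text \<open>The additive extensions of \<open>a \<mapsto> L\<^sub>a\<close> and \<open>a \<mapsto> R\<^sub>a\<close> to all of \<open>end(\<one>)\<close>.\<close>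

definition left_unit_map :: "('o, 'm, 'z) tm_category_scheme \<Rightarrow> 'o \<Rightarrow> (int \<Rightarrow> 'm) \<Rightarrow> (int \<Rightarrow> 'm)" where
  "left_unit_map C A x = (\<lambda>k. left_mult C A k (x k))"

definition right_unit_map :: "('o, 'm, 'z) tm_category_scheme \<Rightarrow> 'o \<Rightarrow> (int \<Rightarrow> 'm) \<Rightarrow> (int \<Rightarrow> 'm)" where
  "right_unit_map C A x = (\<lambda>k. right_mult C A k (x k))"


section \<open>Categorical idempotents\<close>

definition weak_idempotent :: "('o, 'm, 'z) tm_category_scheme \<Rightarrow> 'o \<Rightarrow> bool" where
  "weak_idempotent C E \<longleftrightarrow> isomorphic C (E \<otimes>\<^sub>o\<^bsub>C\<^esub> E) E"

text \<open>The objects of the full subcategory \<open>E\<A>E\<close>.\<close>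

definition corner :: "('o, 'm, 'z) tm_category_scheme \<Rightarrow> 'o \<Rightarrow> 'o set" where
  "corner C E = {A. isomorphic C (E \<otimes>\<^sub>o\<^bsub>C\<^esub> A) A \<and> isomorphic C A (A \<otimes>\<^sub>o\<^bsub>C\<^esub> E)}"

definition unital_idempotent ::
  "('o, 'm, 'z) tm_category_scheme \<Rightarrow> 'o \<Rightarrow> 'o \<Rightarrow> 'm \<Rightarrow> bool" where
  "unital_idempotent C E U \<eta> \<longleftrightarrow>
     weak_idempotent C E \<and> U \<in> corner C E \<and> \<eta> \<in> Hom C E U \<and>
     is_iso C (\<eta> \<otimes>\<^sub>m\<^bsub>C\<^esub> ident C U) \<and> is_iso C (ident C U \<otimes>\<^sub>m\<^bsub>C\<^esub> \<eta>)"

definition counital_idempotent ::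
  "('o, 'm, 'z) tm_category_scheme \<Rightarrow> 'o \<Rightarrow> 'o \<Rightarrow> 'm \<Rightarrow> bool" where
  "counital_idempotent C E D \<epsilon> \<longleftrightarrow>
     weak_idempotent C E \<and> D \<in> corner C E \<and> \<epsilon> \<in> Hom C D E \<and>
     is_iso C (\<epsilon> \<otimes>\<^sub>m\<^bsub>C\<^esub> ident C D) \<and> is_iso C (ident C D \<otimes>\<^sub>m\<^bsub>C\<^esub> \<epsilon>)"

definition categorical_idempotent :: "('o, 'm, 'z) tm_category_scheme \<Rightarrow> 'o \<Rightarrow> bool" where
  "categorical_idempotent C E \<longleftrightarrow>
     (\<exists>(r::nat) F. F 0 = unit_obj C \<and> F r = E \<and>
        (\<forall>i \<in> {1..r}. (\<exists>\<eta>. unital_idempotent C (F (i - 1)) (F i) \<eta>) \<or>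
                       (\<exists>\<epsilon>. counital_idempotent C (F (i - 1)) (F i) \<epsilon>)))"

end

theory Submission
  imports Defs
begin

text \<open>
  Shifts can be moved out of either factor of a tensor product, and moving \<open>[k]\<close> out of the left and
  \<open>[l]\<close> out of the right factor in the two possible orders differs by \<open>(-1)\<^sup>k\<^sup>l\<close>, because \<open>\<beta>\<close> is \<open>-Id\<close>
  at \<open>\<one>[1]\<close>.  Hence \<open>f \<otimes> Id\<close> and \<open>Id \<otimes> g\<close> supercommute.

  Going up the chain of unital and counital idempotents, the functors \<open>E \<otimes> -\<close> and \<open>- \<otimes> E\<close> stay naturally
  isomorphic to the identity on the objects \<open>A\<close> with \<open>E \<otimes> A \<cong> A\<close>, respectively \<open>A \<otimes> E \<cong> A\<close>: on these
  objects the structure map \<open>\<eta>\<close> or \<open>\<epsilon>\<close> becomes invertible after tensoring.  So every graded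
  endomorphism of \<open>E \<otimes> E \<cong> E\<close> has both the form \<open>f \<otimes> Id\<close> and the form \<open>Id \<otimes> g\<close>, which makes \<open>end(E)\<close>
  graded commutative, whether or not the two identifications \<open>E \<otimes> E \<cong> E\<close> agree.

  The equation \<open>L\<^sub>a = R\<^sub>a\<close> holds on \<open>\<one>\<close> and is transported along \<open>\<eta>\<close> and \<open>\<epsilon>\<close>, because \<open>L\<^sub>a\<close> and \<open>R\<^sub>a\<close> are
  natural and \<open>E \<otimes> -\<close> is faithful.
\<close>

section \<open>Categories\<close>

text \<open>Three obstacles shape the proof. The axioms do not state that \<otimes> is additive in
  either factor, so the sign in \<beta> cannot be pulled out of a tensor product until exact
  functors are known to be additive. Isomorphisms in negative degrees are given only by solving a
  recursion backwards; since the suspension is a bijection on objects and on arrows, each inductive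
  step is an equivalence between degrees \<open>k\<close> and \<open>k + 1\<close>, and one argument
  serves all integers. Finally, the isomorphisms in \<open>corner\<close> and
  \<open>weak_idempotent\<close> merely exist; naturality has to be produced from \<eta> and
  \<epsilon> and traced back to the unitors of the unit object.

  The operators \<open>left_mult\<close> and \<open>right_mult\<close> turn out to be, up to
  unitors, the graded extensions of the exact functors \<open>- \<otimes> A\<close> and
  \<open>A \<otimes> -\<close> along the shift isomorphisms \<open>tw\<close>. Their
  multiplicativity is then functoriality, and the only sign left to compute is that of exchanging
  two single suspensions.\<close>

lemma Hom_iff: "f \<in> Hom C A B \<longleftrightarrow> src C f = A \<and> tgt C f = B"
  by (simp add: Hom_def)

text \<open>A step that is an equivalence can be read upwards and downwards, so degree 0 reaches
  every integer. In the applications the converse direction comes from injectivity of the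
  suspension.\<close>

lemma int_iff_induct:
  fixes P :: "int \<Rightarrow> bool"
  assumes "P 0" and step: "\<And>k. P k \<longleftrightarrow> P (k + 1)"
  shows "P k"
proof (induct k rule: int_induct[where k = 0])
  case base
  show ?case by fact
next
  case (step1 i)
  then show ?case using step by blast
next
  case (step2 i)
  then show ?case using step[of "i - 1"] by simp
qed

context category
begin

text \<open>Typing by equations for sources and targets, rather than by \<open>Hom\<close>
  membership, lets the simplifier discharge the side conditions of all later rewriting.\<close>

lemma src_ident [simp]: "src C (ident C A) = A"
  and tgt_ident [simp]: "tgt C (ident C A) = A"
  using ident_in_Hom[of A] by (simp_all add: Hom_iff)

lemma src_cmp [simp]: "src C g = tgt C f \<Longrightarrow> src C (g \<cdot> f) = src C f"
  and tgt_cmp [simp]: "src C g = tgt C f \<Longrightarrow> tgt C (g \<cdot> f) = tgt C g"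
  using cmp_in_Hom[of f "src C f" "tgt C f" g "tgt C g"] by (simp_all add: Hom_iff)

lemma cmp_ident_right [simp]: "src C f = X \<Longrightarrow> f \<cdot> ident C X = f"
  using cmp_ident[of f "src C f" "tgt C f"] by (simp add: Hom_iff)

lemma cmp_ident_left [simp]: "tgt C f = X \<Longrightarrow> ident C X \<cdot> f = f"
  using ident_cmp[of f "src C f" "tgt C f"] by (simp add: Hom_iff)

lemma cmp_assoc' [simp]:
  "\<lbrakk>src C g = tgt C f; src C h = tgt C g\<rbrakk> \<Longrightarrow> (h \<cdot> g) \<cdot> f = h \<cdot> (g \<cdot> f)"
  using cmp_assoc[of f "src C f" "tgt C f" g "tgt C g" h "tgt C h"] by (simp add: Hom_iff)

text \<open>Composites are nested to the right by \<open>cmp_assoc'\<close>, so an equation for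
  \<open>g \<cdot> f\<close> does not match in the middle of a longer chain. This form makes it
  applicable there.\<close>

lemma cmp_reassoc:
  "\<lbrakk>g \<cdot> f = h; src C g = tgt C f; src C f = tgt C x\<rbrakk> \<Longrightarrow> g \<cdot> (f \<cdot> x) = h \<cdot> x"
  by (metis cmp_assoc')

lemma is_isoI:
  "\<lbrakk>src C g = tgt C f; tgt C g = src C f; g \<cdot> f = ident C (src C f); f \<cdot> g = ident C (tgt C f)\<rbrakk>
    \<Longrightarrow> is_iso C f"
  unfolding is_iso_def inverse_arrows_def by blast

lemma inverse_arrow_unique:
  assumes "src C g = tgt C f" "tgt C g = src C f"
    "g \<cdot> f = ident C (src C f)" "f \<cdot> g = ident C (tgt C f)"
  shows "inverse_arrow C f = g"
  unfolding inverse_arrow_def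
proof (rule the_equality)
  show "inverse_arrows C f g" using assms by (simp add: inverse_arrows_def)
  fix h assume h: "inverse_arrows C f h"
  have "h \<cdot> (f \<cdot> g) = (h \<cdot> f) \<cdot> g" by (rule cmp_assoc'[symmetric])
    (use assms h in \<open>simp_all add: inverse_arrows_def\<close>)
  then show "h = g" using assms h by (simp add: inverse_arrows_def)
qed

lemma inverse_arrows_inverse_arrow: "is_iso C f \<Longrightarrow> inverse_arrows C f (inverse_arrow C f)"
  using inverse_arrow_unique unfolding is_iso_def inverse_arrows_def by metis

lemma
  assumes "is_iso C f"
  shows src_inverse [simp]: "src C (inverse_arrow C f) = tgt C f"
    and tgt_inverse [simp]: "tgt C (inverse_arrow C f) = src C f"
    and inverse_cmp [simp]: "inverse_arrow C f \<cdot> f = ident C (src C f)"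
    and cmp_inverse [simp]: "f \<cdot> inverse_arrow C f = ident C (tgt C f)"
  using inverse_arrows_inverse_arrow[OF assms] by (simp_all add: inverse_arrows_def)

lemma inverse_cmp_cancel [simp]:
  "\<lbrakk>is_iso C f; src C f = tgt C x\<rbrakk> \<Longrightarrow> inverse_arrow C f \<cdot> (f \<cdot> x) = x"
  by (simp add: cmp_reassoc[OF inverse_cmp])

lemma cmp_inverse_cancel [simp]:
  "\<lbrakk>is_iso C f; tgt C f = tgt C x\<rbrakk> \<Longrightarrow> f \<cdot> (inverse_arrow C f \<cdot> x) = x"
  by (simp add: cmp_reassoc[OF cmp_inverse])

lemma is_iso_ident [simp]: "is_iso C (ident C A)"
  by (rule is_isoI[of "ident C A"]) simp_all

lemma is_iso_inverse [simp]: "is_iso C f \<Longrightarrow> is_iso C (inverse_arrow C f)"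
  by (rule is_isoI[of f]) simp_all

lemma is_iso_cmp [simp]:
  "\<lbrakk>is_iso C f; is_iso C g; src C g = tgt C f\<rbrakk> \<Longrightarrow> is_iso C (g \<cdot> f)"
  by (rule is_isoI[of "inverse_arrow C f \<cdot> inverse_arrow C g"]) simp_all

lemma iso_cancel_right:
  assumes "is_iso C f" "g \<cdot> f = h \<cdot> f" "src C g = tgt C f" "src C h = tgt C f"
  shows "g = h"
proof -
  have "(g \<cdot> f) \<cdot> inverse_arrow C f = (h \<cdot> f) \<cdot> inverse_arrow C f" using assms by simp
  then show ?thesis using assms(1,3,4) by simp
qed

lemma iso_cancel_left:
  assumes "is_iso C f" "f \<cdot> g = f \<cdot> h" "src C f = tgt C g" "src C f = tgt C h"
  shows "g = h"
proof -
  have "inverse_arrow C f \<cdot> f \<cdot> g = inverse_arrow C f \<cdot> f \<cdot> h" using assms by simp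
  then show ?thesis using assms(1,3,4) by simp
qed

lemma isomorphic_sym: "isomorphic C A B \<Longrightarrow> isomorphic C B A"
  unfolding isomorphic_def Hom_iff Bex_def
  by (elim exE conjE, rule_tac x = "inverse_arrow C x" in exI) (simp add: Hom_iff)

lemma isomorphic_trans:
  assumes "isomorphic C A B" "isomorphic C B D"
  shows "isomorphic C A D"
proof -
  from assms obtain f g where "src C f = A" "tgt C f = B" "is_iso C f"
      "src C g = B" "tgt C g = D" "is_iso C g"
    by (auto simp: isomorphic_def Hom_iff)
  then show ?thesis by (auto simp: isomorphic_def Hom_iff intro!: bexI[of _ "g \<cdot> f"])
qed

lemma isomorphicI: "\<lbrakk>is_iso C f; src C f = A; tgt C f = B\<rbrakk> \<Longrightarrow> isomorphic C A B"
  by (auto simp: isomorphic_def Hom_iff)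

end


section \<open>Additive categories\<close>

context additive_category
begin

lemma Hom_group_sel [simp]:
  "carrier (Hom_group C A B) = Hom C A B"
  "mult (Hom_group C A B) = mor_add C"
  "one (Hom_group C A B) = mor_zero C A B"
  by (simp_all add: Hom_group_def)

lemma src_zero [simp]: "src C (mor_zero C A B) = A"
  and tgt_zero [simp]: "tgt C (mor_zero C A B) = B"
proof -
  interpret comm_group "Hom_group C A B" by (rule Hom_group)
  show "src C (mor_zero C A B) = A" "tgt C (mor_zero C A B) = B"
    using one_closed by (simp_all add: Hom_iff)
qed

lemma
  assumes "src C f = src C g" "tgt C f = tgt C g"
  shows src_add [simp]: "src C (f +\<^sub>m g) = src C f"
    and tgt_add [simp]: "tgt C (f +\<^sub>m g) = tgt C f"
    and add_comm: "f +\<^sub>m g = g +\<^sub>m f"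
proof -
  interpret comm_group "Hom_group C (src C f) (tgt C f)" by (rule Hom_group)
  show "src C (f +\<^sub>m g) = src C f" "tgt C (f +\<^sub>m g) = tgt C f"
    using m_closed[of f g] assms by (simp_all add: Hom_iff)
  show "f +\<^sub>m g = g +\<^sub>m f"
    using m_comm[of f g] assms by (simp add: Hom_iff)
qed

lemma add_assoc:
  "\<lbrakk>src C f = src C g; tgt C f = tgt C g; src C g = src C h; tgt C g = tgt C h\<rbrakk>
    \<Longrightarrow> (f +\<^sub>m g) +\<^sub>m h = f +\<^sub>m (g +\<^sub>m h)"
proof -
  assume *: "src C f = src C g" "tgt C f = tgt C g" "src C g = src C h" "tgt C g = tgt C h"
  interpret comm_group "Hom_group C (src C f) (tgt C f)" by (rule Hom_group)
  show ?thesis using m_assoc[of f g h] * by (simp add: Hom_iff)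
qed

lemma
  shows src_neg [simp]: "src C (mor_neg C f) = src C f"
    and tgt_neg [simp]: "tgt C (mor_neg C f) = tgt C f"
    and add_neg [simp]: "f +\<^sub>m mor_neg C f = mor_zero C (src C f) (tgt C f)"
    and neg_add [simp]: "mor_neg C f +\<^sub>m f = mor_zero C (src C f) (tgt C f)"
    and neg_neg [simp]: "mor_neg C (mor_neg C f) = f"
proof -
  interpret comm_group "Hom_group C (src C f) (tgt C f)" by (rule Hom_group)
  have n: "mor_neg C f \<in> Hom C (src C f) (tgt C f)"
    using inv_closed[of f] by (simp add: mor_neg_def Hom_iff)
  then show 1: "src C (mor_neg C f) = src C f" "tgt C (mor_neg C f) = tgt C f"
    by (simp_all add: Hom_iff)
  show "f +\<^sub>m mor_neg C f = mor_zero C (src C f) (tgt C f)"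
    "mor_neg C f +\<^sub>m f = mor_zero C (src C f) (tgt C f)"
    using r_inv[of f] l_inv[of f] by (simp_all add: mor_neg_def Hom_iff)
  show "mor_neg C (mor_neg C f) = f"
    unfolding mor_neg_def[of C "mor_neg C f"] 1 using inv_inv[of f]
    by (simp add: mor_neg_def Hom_iff)
qed

lemma
  assumes "src C f = A" "tgt C f = B"
  shows add_zero [simp]: "f +\<^sub>m mor_zero C A B = f"
    and zero_add [simp]: "mor_zero C A B +\<^sub>m f = f"
proof -
  interpret comm_group "Hom_group C A B" by (rule Hom_group)
  show "f +\<^sub>m mor_zero C A B = f" "mor_zero C A B +\<^sub>m f = f"
    using r_one[of f] l_one[of f] assms by (simp_all add: Hom_iff)
qed

lemma neg_unique:
  assumes "f +\<^sub>m g = mor_zero C (src C f) (tgt C f)" "src C f = src C g" "tgt C f = tgt C g"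
  shows "mor_neg C f = g"
proof -
  have "mor_neg C f = mor_neg C f +\<^sub>m (f +\<^sub>m g)" using assms(1) by simp
  also have "\<dots> = (mor_neg C f +\<^sub>m f) +\<^sub>m g"
    by (rule add_assoc[symmetric]) (use assms(2,3) in simp_all)
  finally show ?thesis using assms(2,3) by simp
qed

text \<open>Applied to the image of a zero arrow, this shows that every additive operation on arrows
  preserves zero.\<close>

lemma add_idem_zero:
  assumes "f +\<^sub>m f = f"
  shows "f = mor_zero C (src C f) (tgt C f)"
proof -
  have "(f +\<^sub>m f) +\<^sub>m mor_neg C f = f +\<^sub>m mor_neg C f" using assms by simp
  then show ?thesis by (subst (asm) add_assoc) simp_all
qed

lemma neg_zero [simp]: "mor_neg C (mor_zero C A B) = mor_zero C A B"
  by (rule neg_unique) simp_all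

lemma cmp_add_left':
  "\<lbrakk>src C g = tgt C f; src C g' = tgt C f; tgt C g = tgt C g'\<rbrakk>
    \<Longrightarrow> (g +\<^sub>m g') \<cdot> f = (g \<cdot> f) +\<^sub>m (g' \<cdot> f)"
  using cmp_add_left[of f "src C f" "tgt C f" g "tgt C g" g'] by (simp add: Hom_iff)

lemma cmp_add_right':
  "\<lbrakk>src C g = tgt C f; src C g = tgt C f'; src C f = src C f'\<rbrakk>
    \<Longrightarrow> g \<cdot> (f +\<^sub>m f') = (g \<cdot> f) +\<^sub>m (g \<cdot> f')"
  using cmp_add_right[of f "src C f" "tgt C f" f' g "tgt C g"] by (simp add: Hom_iff)

lemma zero_cmp [simp]:
  assumes "tgt C f = Y"
  shows "mor_zero C Y Z \<cdot> f = mor_zero C (src C f) Z"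
  using cmp_add_left'[of "mor_zero C Y Z" f "mor_zero C Y Z"]
    add_idem_zero[of "mor_zero C Y Z \<cdot> f"] assms by simp

lemma cmp_zero [simp]:
  assumes "src C g = Y"
  shows "g \<cdot> mor_zero C X Y = mor_zero C X (tgt C g)"
  using cmp_add_right'[of g "mor_zero C X Y" "mor_zero C X Y"]
    add_idem_zero[of "g \<cdot> mor_zero C X Y"] assms by simp

lemma neg_cmp [simp]: "src C g = tgt C f \<Longrightarrow> mor_neg C g \<cdot> f = mor_neg C (g \<cdot> f)"
  by (rule neg_unique[symmetric]) (simp_all add: cmp_add_left'[symmetric])

lemma cmp_neg [simp]: "src C g = tgt C f \<Longrightarrow> g \<cdot> mor_neg C f = mor_neg C (g \<cdot> f)"
  by (rule neg_unique[symmetric]) (simp_all add: cmp_add_right'[symmetric])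

lemma zero_obj_hom:
  assumes "is_zero_obj C Z"
  shows "tgt C f = Z \<Longrightarrow> f = mor_zero C (src C f) Z" "src C f = Z \<Longrightarrow> f = mor_zero C Z (tgt C f)"
  using assms cmp_ident_left[of f Z] cmp_ident_right[of f Z]
  by (metis is_zero_obj_def zero_cmp, metis is_zero_obj_def cmp_zero)

end


section \<open>Shifts\<close>

lemma int_iterate_0 [simp]: "int_iterate f 0 x = x"
  by (simp add: int_iterate_def)

text \<open>Bijectivity matters for negative \<open>k\<close>, where \<open>f\<close> has to undo
  the outermost \<open>inv_into UNIV f\<close>.\<close>

lemma int_iterate_step:
  assumes "bij f"
  shows "int_iterate f (k + 1) x = f (int_iterate f k x)"
proof (cases "0 \<le> k")
  case True
  then show ?thesis by (simp add: int_iterate_def nat_add_distrib)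
next
  case False
  then obtain n where k: "k = - int (Suc n)"
    using negD by force
  have "f ((inv_into UNIV f ^^ Suc n) x) = (inv_into UNIV f ^^ n) x"
    using assms by (simp add: bij_is_surj surj_f_inv_f)
  moreover have neg: "int_iterate f (- int m) = inv_into UNIV f ^^ m" for m
    by (cases m) (simp_all add: int_iterate_def fun_eq_iff flip: of_nat_Suc)
  have "k + 1 = - int n" using k by simp
  ultimately show ?thesis unfolding k using neg[of n] neg[of "Suc n"] by simp
qed

context triangulated_category
begin

lemma src_sus [simp]: "src C (\<Sigma>\<^sub>m f) = \<Sigma>\<^sub>o (src C f)"
  and tgt_sus [simp]: "tgt C (\<Sigma>\<^sub>m f) = \<Sigma>\<^sub>o (tgt C f)"
  using sus_mor_in_Hom[of f "src C f" "tgt C f"] by (simp_all add: Hom_iff)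

lemma sus_obj_inject [simp]: "\<Sigma>\<^sub>o A = \<Sigma>\<^sub>o B \<longleftrightarrow> A = B"
  using sus_obj_bij by (auto simp: bij_def inj_def)

lemma sus_mor_inject [simp]: "\<Sigma>\<^sub>m f = \<Sigma>\<^sub>m g \<longleftrightarrow> f = g"
  using sus_mor_bij by (auto simp: bij_def inj_def)

declare sus_ident [simp]

lemma sus_cmp' [simp]: "src C g = tgt C f \<Longrightarrow> \<Sigma>\<^sub>m (g \<cdot> f) = \<Sigma>\<^sub>m g \<cdot> \<Sigma>\<^sub>m f"
  using sus_cmp[of f "src C f" "tgt C f" g "tgt C g"] by (simp add: Hom_iff)

lemma sus_add' [simp]:
  "\<lbrakk>src C f = src C g; tgt C f = tgt C g\<rbrakk> \<Longrightarrow> \<Sigma>\<^sub>m (f +\<^sub>m g) = \<Sigma>\<^sub>m f +\<^sub>m \<Sigma>\<^sub>m g"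
  using sus_add[of f "src C f" "tgt C f" g] by (simp add: Hom_iff)

lemma sus_zero [simp]: "\<Sigma>\<^sub>m (mor_zero C A B) = mor_zero C (\<Sigma>\<^sub>o A) (\<Sigma>\<^sub>o B)"
  using sus_add'[of "mor_zero C A B" "mor_zero C A B"] add_idem_zero[of "\<Sigma>\<^sub>m (mor_zero C A B)"]
  by simp

lemma sus_neg [simp]: "\<Sigma>\<^sub>m (mor_neg C f) = mor_neg C (\<Sigma>\<^sub>m f)"
  by (rule neg_unique[symmetric]) (simp_all flip: sus_add')

lemma shift_obj_0 [simp]: "shift_obj C 0 A = A"
  and shift_mor_0 [simp]: "shift_mor C 0 f = f"
  by (simp_all add: shift_obj_def shift_mor_def)

lemma shift_obj_Suc: "shift_obj C (k + 1) A = \<Sigma>\<^sub>o (shift_obj C k A)"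
  and shift_mor_Suc: "shift_mor C (k + 1) f = \<Sigma>\<^sub>m (shift_mor C k f)"
  by (simp_all add: shift_obj_def shift_mor_def int_iterate_step sus_obj_bij sus_mor_bij)

lemma shift_obj_1 [simp]: "shift_obj C 1 A = \<Sigma>\<^sub>o A"
  and shift_mor_1 [simp]: "shift_mor C 1 f = \<Sigma>\<^sub>m f"
  using shift_obj_Suc[of 0] shift_mor_Suc[of 0] by simp_all

lemma shift_obj_shift: "shift_obj C k (shift_obj C l A) = shift_obj C (k + l) A"
proof (induct k rule: int_iff_induct)
  fix k
  show "shift_obj C k (shift_obj C l A) = shift_obj C (k + l) A
    \<longleftrightarrow> shift_obj C (k + 1) (shift_obj C l A) = shift_obj C (k + 1 + l) A"
    using shift_obj_Suc[of "k + l" A] shift_obj_Suc[of k] by (simp add: ac_simps)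
qed simp

lemma shift_mor_shift: "shift_mor C k (shift_mor C l f) = shift_mor C (k + l) f"
proof (induct k rule: int_iff_induct)
  fix k
  show "shift_mor C k (shift_mor C l f) = shift_mor C (k + l) f
    \<longleftrightarrow> shift_mor C (k + 1) (shift_mor C l f) = shift_mor C (k + 1 + l) f"
    using shift_mor_Suc[of "k + l" f] shift_mor_Suc[of k] by (simp add: ac_simps)
qed simp

lemma sus_shift_obj: "\<Sigma>\<^sub>o (shift_obj C k A) = shift_obj C k (\<Sigma>\<^sub>o A)"
  using shift_obj_shift[of 1 k A] shift_obj_shift[of k 1 A] by (simp add: add.commute)

lemma sus_shift_mor: "\<Sigma>\<^sub>m (shift_mor C k f) = shift_mor C k (\<Sigma>\<^sub>m f)"
  using shift_mor_shift[of 1 k f] shift_mor_shift[of k 1 f] by (simp add: add.commute)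

lemma src_shift [simp]: "src C (shift_mor C k f) = shift_obj C k (src C f)"
  and tgt_shift [simp]: "tgt C (shift_mor C k f) = shift_obj C k (tgt C f)"
  by (induct k rule: int_iff_induct, simp_all add: shift_obj_Suc shift_mor_Suc)

lemma shift_ident [simp]: "shift_mor C k (ident C A) = ident C (shift_obj C k A)"
proof (induct k rule: int_iff_induct)
  fix k
  show "shift_mor C k (ident C A) = ident C (shift_obj C k A)
    \<longleftrightarrow> shift_mor C (k + 1) (ident C A) = ident C (shift_obj C (k + 1) A)"
    by (simp add: shift_obj_Suc shift_mor_Suc flip: sus_ident)
qed simp

lemma shift_cmp [simp]:
  assumes "src C g = tgt C f"
  shows "shift_mor C k (g \<cdot> f) = shift_mor C k g \<cdot> shift_mor C k f"
proof (induct k rule: int_iff_induct)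
  fix k
  \<comment> \<open>Suspending both sides turns the claim for \<open>k\<close> into the claim for
    \<open>k + 1\<close>; injectivity of the suspension makes the passage reversible.\<close>
  have "shift_mor C k (g \<cdot> f) = shift_mor C k g \<cdot> shift_mor C k f
    \<longleftrightarrow> \<Sigma>\<^sub>m (shift_mor C k (g \<cdot> f)) = \<Sigma>\<^sub>m (shift_mor C k g \<cdot> shift_mor C k f)"
    unfolding sus_mor_inject ..
  then show "shift_mor C k (g \<cdot> f) = shift_mor C k g \<cdot> shift_mor C k f
    \<longleftrightarrow> shift_mor C (k + 1) (g \<cdot> f) = shift_mor C (k + 1) g \<cdot> shift_mor C (k + 1) f"
    using assms by (simp add: shift_mor_Suc)
qed simp

lemma shift_add [simp]:
  assumes "src C f = src C g" "tgt C f = tgt C g"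
  shows "shift_mor C k (f +\<^sub>m g) = shift_mor C k f +\<^sub>m shift_mor C k g"
proof (induct k rule: int_iff_induct)
  fix k
  have "shift_mor C k (f +\<^sub>m g) = shift_mor C k f +\<^sub>m shift_mor C k g
    \<longleftrightarrow> \<Sigma>\<^sub>m (shift_mor C k (f +\<^sub>m g)) = \<Sigma>\<^sub>m (shift_mor C k f +\<^sub>m shift_mor C k g)"
    unfolding sus_mor_inject ..
  then show "shift_mor C k (f +\<^sub>m g) = shift_mor C k f +\<^sub>m shift_mor C k g
    \<longleftrightarrow> shift_mor C (k + 1) (f +\<^sub>m g) = shift_mor C (k + 1) f +\<^sub>m shift_mor C (k + 1) g"
    using assms by (simp add: shift_mor_Suc)
qed simp

lemma shift_zero [simp]:
  "shift_mor C k (mor_zero C A B) = mor_zero C (shift_obj C k A) (shift_obj C k B)"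
  using shift_add[of "mor_zero C A B" "mor_zero C A B" k]
    add_idem_zero[of "shift_mor C k (mor_zero C A B)"] by simp

lemma shift_neg [simp]: "shift_mor C k (mor_neg C f) = mor_neg C (shift_mor C k f)"
  by (rule neg_unique[symmetric]) (simp_all flip: shift_add)

lemma is_iso_shift [simp]: "is_iso C f \<Longrightarrow> is_iso C (shift_mor C k f)"
  using shift_cmp[of "inverse_arrow C f" f k] shift_cmp[of f "inverse_arrow C f" k]
  by (intro is_isoI[of "shift_mor C k (inverse_arrow C f)"]) (simp_all del: shift_cmp)

lemma is_iso_sus [simp]: "is_iso C f \<Longrightarrow> is_iso C (\<Sigma>\<^sub>m f)"
  using is_iso_shift[of f 1] by simp

lemma shift_pred_sus [simp]: "shift_obj C (- 1) (\<Sigma>\<^sub>o A) = A"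
  using shift_obj_shift[of "- 1" 1 A] by simp

lemma sus_shift_pred [simp]: "\<Sigma>\<^sub>o (shift_obj C (- 1 - int n) A) = shift_obj C (- int n) A"
  using shift_obj_Suc[of "- 1 - int n" A] by simp

end


section \<open>Exact functors\<close>

text \<open>Glues a sequence built upwards from 0 to one built downwards from 0. The relation
  \<open>R\<close> always leads from degree \<open>k\<close> to \<open>k + 1\<close>, so the
  downward definition enters in solved form and one recursion results for all integers.\<close>

lemma int_rec_step:
  fixes P N :: "nat \<Rightarrow> 'a" and R :: "int \<Rightarrow> 'a \<Rightarrow> 'a \<Rightarrow> bool"
  assumes "P 0 = N 0" "\<And>n. R (int n) (P n) (P (Suc n))" "\<And>n. R (- int (Suc n)) (N (Suc n)) (N n)"
  shows "R k (if 0 \<le> k then P (nat k) else N (nat (- k)))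
    (if 0 \<le> k + 1 then P (nat (k + 1)) else N (nat (- (k + 1))))"
proof (cases "0 \<le> k")
  case True
  then show ?thesis using assms(2)[of "nat k"] by (simp add: nat_add_distrib)
next
  case False
  define n where "n = nat (- k - 1)"
  have k: "k = - int (Suc n)" using False by (simp add: n_def)
  have "nat (- k) = Suc n" "nat (- (k + 1)) = n" "0 \<le> k + 1 \<longleftrightarrow> n = 0"
    using k by auto
  then show ?thesis using assms(3)[of n] assms(1) False k by (cases n) simp_all
qed

section \<open>Vanishing composites and weak cokernels in distinguished triangles\<close>

context triangulated_category
begin

lemma is_zero_obj_sus: "is_zero_obj C Z \<Longrightarrow> is_zero_obj C (\<Sigma>\<^sub>o Z)"
  by (metis is_zero_obj_def sus_ident sus_zero)

text \<open>TR3 maps the identity triangle on \<open>X\<close>, whose third vertex is a zero object,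
  to the given triangle; its filler factors \<open>g \<cdot> f\<close> through that object.\<close>

lemma dist_cmp_zero:
  assumes "dist_triangle C X Y Z f g h"
  shows "g \<cdot> f = mor_zero C X Z"
proof -
  obtain Z0 where "is_zero_obj C Z0" using zero_obj by blast
  moreover have "f \<in> Hom C X Y" using assms by (simp add: dist_triangle_def triangle_def)
  ultimately obtain w where "w \<in> Hom C Z0 Z" "g \<cdot> f = w \<cdot> mor_zero C X Z0"
    using TR3[OF TR1_ident assms ident_in_Hom, of Z0 f] by blast
  then show ?thesis by (simp add: Hom_iff)
qed

text \<open>The factorization is the TR3 filler into the triangle \<open>Z0\<close>,
  \<open>W\<close>, \<open>W\<close> with \<open>Z0\<close> a zero object and \<open>W\<close> the
  target of \<open>e\<close>.\<close>

lemma dist_weak_cokernel: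
  assumes dt: "dist_triangle C X Y Z f g h"
    and e: "src C e = Y" "e \<cdot> f = mor_zero C X (tgt C e)"
  obtains e' where "src C e' = Z" "tgt C e' = tgt C e" "e = e' \<cdot> g"
proof -
  obtain Z0 where Z0: "is_zero_obj C Z0" using zero_obj by blast
  let ?W = "tgt C e"
  \<comment> \<open>The triangle needed has the identity as its second arrow. It is the identity
    triangle rotated backwards by TR2, which is why the zero object is taken in the form of a
    suspension.\<close>
  have "dist_triangle C ?W ?W (\<Sigma>\<^sub>o Z0) (ident C ?W) (mor_zero C ?W (\<Sigma>\<^sub>o Z0))
      (mor_zero C (\<Sigma>\<^sub>o Z0) (\<Sigma>\<^sub>o ?W))"
    by (rule TR1_ident) (rule is_zero_obj_sus[OF Z0])
  then have *: "dist_triangle C Z0 ?W ?W (mor_zero C Z0 ?W) (ident C ?W) (mor_zero C ?W (\<Sigma>\<^sub>o Z0))"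
    by (subst TR2) (simp_all add: triangle_def Hom_iff)
  have "f \<in> Hom C X Y" using dt by (simp add: dist_triangle_def triangle_def)
  then obtain w where "w \<in> Hom C Z ?W" "ident C ?W \<cdot> e = w \<cdot> g"
    using TR3[OF dt *, where u = "mor_zero C X Z0" and v = e] e by (auto simp: Hom_iff)
  then show ?thesis using that[of w] by (simp add: Hom_iff)
qed

section \<open>Signs and ladders over the integers\<close>

definition mor_sign :: "int \<Rightarrow> 'm \<Rightarrow> 'm" where
  "mor_sign n f = (if even n then f else mor_neg C f)"

lemma mor_sign_0 [simp]: "mor_sign 0 f = f"
  by (simp add: mor_sign_def)

lemma src_mor_sign [simp]: "src C (mor_sign n f) = src C f"
  and tgt_mor_sign [simp]: "tgt C (mor_sign n f) = tgt C f"
  and sus_mor_sign [simp]: "\<Sigma>\<^sub>m (mor_sign n f) = mor_sign n (\<Sigma>\<^sub>m f)"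
  and shift_mor_sign [simp]: "shift_mor C k (mor_sign n f) = mor_sign n (shift_mor C k f)"
  and mor_sign_mor_sign [simp]: "mor_sign m (mor_sign n f) = mor_sign (m + n) f"
  by (auto simp: mor_sign_def)

lemma mor_sign_cmp [simp]: "src C g = tgt C f \<Longrightarrow> mor_sign n g \<cdot> f = mor_sign n (g \<cdot> f)"
  and cmp_mor_sign [simp]: "src C g = tgt C f \<Longrightarrow> g \<cdot> mor_sign n f = mor_sign n (g \<cdot> f)"
  by (auto simp: mor_sign_def)

text \<open>
  Sequences with \<open>u (k + 1) = \<Sigma> (u k) \<cdot> p k\<close> arise by iterating isomorphisms such as \<open>\<alpha>\<close>, in positive
  and negative degrees alike.  All compatibilities in degree \<open>k\<close> follow from those in degree \<open>1\<close>
  by this lemma.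
\<close>

lemma shift_ladder:
  fixes u v p q t :: "int \<Rightarrow> 'm"
  assumes u: "\<And>k. u (k + 1) = \<Sigma>\<^sub>m (u k) \<cdot> p k" and v: "\<And>k. v (k + 1) = \<Sigma>\<^sub>m (v k) \<cdot> q k"
    and step: "\<And>k. \<Sigma>\<^sub>m (t k) \<cdot> p k = mor_sign e (q k \<cdot> t (k + 1))"
    and base: "t' \<cdot> u 0 = v 0 \<cdot> t 0"
    and p: "\<And>k. is_iso C (p k)" "\<And>k. tgt C (p k) = \<Sigma>\<^sub>o (src C (u k))"
    and q: "\<And>k. tgt C (q k) = \<Sigma>\<^sub>o (src C (v k))" "\<And>k. src C (q k) = src C (v (k + 1))"
    and t: "\<And>k. tgt C (t k) = src C (v k)" "\<And>k. src C (t k) = src C (u k)"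
    and ty: "\<And>k. tgt C (u k) = shift_obj C k (src C t')"
  shows "shift_mor C k t' \<cdot> u k = mor_sign (e * k) (v k \<cdot> t k)"
proof (induct k rule: int_iff_induct)
  show "shift_mor C 0 t' \<cdot> u 0 = mor_sign (e * 0) (v 0 \<cdot> t 0)" using base by simp
next
  fix k
  have "v (k + 1) \<cdot> t (k + 1) = \<Sigma>\<^sub>m (v k) \<cdot> (q k \<cdot> t (k + 1))"
    using v[of k] q[of k] t(1)[of "k + 1"] by simp
  \<comment> \<open>Each rung contributes the fixed sign exponent \<open>e\<close>, so
    \<open>e * k\<close> accumulates after \<open>k\<close> rungs.\<close>
  then have "mor_sign (e * (k + 1)) (v (k + 1) \<cdot> t (k + 1))
      = mor_sign (e * k) (\<Sigma>\<^sub>m (v k) \<cdot> mor_sign e (q k \<cdot> t (k + 1)))"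
    using q[of k] t(1)[of "k + 1"] by (simp add: algebra_simps)
  also have "\<dots> = mor_sign (e * k) (\<Sigma>\<^sub>m (v k) \<cdot> (\<Sigma>\<^sub>m (t k) \<cdot> p k))"
    using step[of k] by simp
  also have "\<dots> = \<Sigma>\<^sub>m (mor_sign (e * k) (v k \<cdot> t k)) \<cdot> p k"
    using p t by simp
  finally have 2: "mor_sign (e * (k + 1)) (v (k + 1) \<cdot> t (k + 1))
      = \<Sigma>\<^sub>m (mor_sign (e * k) (v k \<cdot> t k)) \<cdot> p k" .
  have 1: "shift_mor C (k + 1) t' \<cdot> u (k + 1) = \<Sigma>\<^sub>m (shift_mor C k t' \<cdot> u k) \<cdot> p k"
    using u[of k] p[of k] ty[of k] by (simp add: shift_mor_Suc)
  \<comment> \<open>Cancelling first the isomorphism \<open>p k\<close> and then the suspension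
    makes the step an equivalence, which is what covers negative degrees.\<close>
  have "\<Sigma>\<^sub>m (shift_mor C k t' \<cdot> u k) \<cdot> p k = \<Sigma>\<^sub>m (mor_sign (e * k) (v k \<cdot> t k)) \<cdot> p k
    \<longleftrightarrow> shift_mor C k t' \<cdot> u k = mor_sign (e * k) (v k \<cdot> t k)"
    using iso_cancel_right[OF p(1)[of k], of "\<Sigma>\<^sub>m (shift_mor C k t' \<cdot> u k)"
      "\<Sigma>\<^sub>m (mor_sign (e * k) (v k \<cdot> t k))"] p[of k] t ty[of k] by (auto simp del: sus_cmp' sus_mor_sign)
  then show "shift_mor C k t' \<cdot> u k = mor_sign (e * k) (v k \<cdot> t k)
    \<longleftrightarrow> shift_mor C (k + 1) t' \<cdot> u (k + 1) = mor_sign (e * (k + 1)) (v (k + 1) \<cdot> t (k + 1))"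
    unfolding 1 2 by simp
qed

end

text \<open>The common abstraction of \<open>A \<otimes> -\<close> and \<open>- \<otimes> B\<close>,
  with \<open>s\<close> in the role of \<open>F(A[1]) \<cong> F(A)[1]\<close>. Additivity is derived
  from exactness here, once for both.\<close>

locale exact_functor = triangulated_category C
  for C :: "('o, 'm, 'z) triangulated_category_scheme" (structure) +
  fixes Fo :: "'o \<Rightarrow> 'o" and Fm :: "'m \<Rightarrow> 'm" and s :: "'o \<Rightarrow> 'm"
  assumes src_F [simp]: "src C (Fm f) = Fo (src C f)"
    and tgt_F [simp]: "tgt C (Fm f) = Fo (tgt C f)"
    and F_ident [simp]: "Fm (ident C A) = ident C (Fo A)"
    and F_cmp [simp]: "src C g = tgt C f \<Longrightarrow> Fm (g \<cdot> f) = Fm g \<cdot> Fm f"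
    and src_s [simp]: "src C (s A) = Fo (\<Sigma>\<^sub>o A)"
    and tgt_s [simp]: "tgt C (s A) = \<Sigma>\<^sub>o (Fo A)"
    and is_iso_s [simp]: "is_iso C (s A)"
    and s_natural: "s (tgt C f) \<cdot> Fm (\<Sigma>\<^sub>m f) = \<Sigma>\<^sub>m (Fm f) \<cdot> s (src C f)"
    and exact: "dist_triangle C X Y Z f g h
      \<Longrightarrow> dist_triangle C (Fo X) (Fo Y) (Fo Z) (Fm f) (Fm g) (s X \<cdot> Fm h)"
begin

text \<open>In the identity triangle on a zero object the identity is also the zero arrow. Its image
  is distinguished, and vanishing of consecutive composites makes the image of a zero object a zero
  object; every zero arrow factors through one.\<close>

lemma F_zero [simp]: "Fm (mor_zero C A B) = mor_zero C (Fo A) (Fo B)"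
proof -
  obtain Z where Z: "is_zero_obj C Z" using zero_obj by blast
  have id: "mor_zero C Z Z = ident C Z" using Z by (simp add: is_zero_obj_def)
  from dist_cmp_zero[OF exact[OF TR1_ident[OF Z, of Z]]]
  have FZ: "is_zero_obj C (Fo Z)" by (simp add: is_zero_obj_def id)
  have "Fm (mor_zero C A B) = Fm (mor_zero C Z B \<cdot> mor_zero C A Z)" by simp
  also have "\<dots> = Fm (mor_zero C Z B) \<cdot> Fm (mor_zero C A Z)" by (rule F_cmp) simp
  also have "\<dots> = mor_zero C (Fo A) (Fo B)"
    using zero_obj_hom(1)[OF FZ, of "Fm (mor_zero C A Z)"] by simp
  finally show ?thesis .
qed

text \<open>
  The complement \<open>e\<close> of \<open>F(i\<^sub>1) F(p\<^sub>1) + F(i\<^sub>2) F(p\<^sub>2)\<close> kills \<open>F(i\<^sub>1)\<close>, hence factors through the image of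
  the cone of \<open>i\<^sub>1\<close>, and therefore through \<open>F(p\<^sub>2)\<close>; since it also kills \<open>F(i\<^sub>2)\<close>, it is zero.
\<close>

lemma F_biproduct:
  assumes i1: "src C i1 = A" "tgt C i1 = P" and i2: "src C i2 = B" "tgt C i2 = P"
    and p1: "src C p1 = P" "tgt C p1 = A" and p2: "src C p2 = P" "tgt C p2 = B"
    and pi: "p1 \<cdot> i1 = ident C A" "p2 \<cdot> i2 = ident C B"
      "p1 \<cdot> i2 = mor_zero C B A" "p2 \<cdot> i1 = mor_zero C A B"
    and sum: "(i1 \<cdot> p1) +\<^sub>m (i2 \<cdot> p2) = ident C P"
  shows "(Fm i1 \<cdot> Fm p1) +\<^sub>m (Fm i2 \<cdot> Fm p2) = ident C (Fo P)"
proof -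
  note ty [simp] = i1 i2 p1 p2
  let ?q = "(Fm i1 \<cdot> Fm p1) +\<^sub>m (Fm i2 \<cdot> Fm p2)"
  define e where "e = ident C (Fo P) +\<^sub>m mor_neg C ?q"
  have e [simp]: "src C e = Fo P" "tgt C e = Fo P" by (simp_all add: e_def)
  have Fpi [simp]: "Fm p1 \<cdot> Fm i1 = ident C (Fo A)" "Fm p2 \<cdot> Fm i2 = ident C (Fo B)"
      "Fm p1 \<cdot> Fm i2 = mor_zero C (Fo B) (Fo A)" "Fm p2 \<cdot> Fm i1 = mor_zero C (Fo A) (Fo B)"
    using pi by (simp_all flip: F_cmp)
  have ei1: "e \<cdot> Fm i1 = mor_zero C (Fo A) (Fo P)"
    and ei2: "e \<cdot> Fm i2 = mor_zero C (Fo B) (Fo P)"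
    by (simp_all add: e_def cmp_add_left')
  obtain Z g h where dt: "dist_triangle C A P Z i1 g h"
    using TR1_cone[of i1 A P] by (auto simp: Hom_iff)
  then have g [simp]: "src C g = P" "tgt C g = Z" and gi1: "g \<cdot> i1 = mor_zero C A Z"
    using dist_cmp_zero by (auto simp: dist_triangle_def triangle_def Hom_iff)
  obtain e' where e' [simp]: "src C e' = Fo Z" "tgt C e' = Fo P" and ee': "e = e' \<cdot> Fm g"
    using dist_weak_cokernel[OF exact[OF dt], of e] ei1 by (metis e)
  have "g = g \<cdot> ((i1 \<cdot> p1) +\<^sub>m (i2 \<cdot> p2))" using sum by simp
  also have "\<dots> = (g \<cdot> i2) \<cdot> p2"
    using cmp_reassoc[OF gi1, of p1] by (simp add: cmp_add_right')
  finally have "Fm g = Fm (g \<cdot> i2) \<cdot> Fm p2" by (metis F_cmp g(1) i2 p2(2) src_cmp)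
  then have e2: "e = (e' \<cdot> Fm (g \<cdot> i2)) \<cdot> Fm p2" using ee' by simp
  then have "(e' \<cdot> Fm (g \<cdot> i2)) \<cdot> (Fm p2 \<cdot> Fm i2) = mor_zero C (Fo B) (Fo P)"
    using ei2 by simp
  then have "e' \<cdot> Fm (g \<cdot> i2) = mor_zero C (Fo B) (Fo P)" by simp
  then have "e = mor_zero C (Fo P) (Fo P)" using e2 by simp
  then have "e +\<^sub>m ?q = ?q" by simp
  then show ?thesis unfolding e_def by (subst (asm) add_assoc) simp_all
qed

text \<open>The sum \<open>f + g\<close> is the diagonal \<open>d\<close> into a biproduct of
  \<open>A\<close> with itself followed by the arrow \<open>t\<close> with components
  \<open>f\<close> and \<open>g\<close>. Inserting the decomposition of the identity that
  \<open>F\<close> preserves splits the image into two summands.\<close>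

lemma F_add [simp]:
  assumes "src C f = src C g" "tgt C f = tgt C g"
  shows "Fm (f +\<^sub>m g) = Fm f +\<^sub>m Fm g"
proof -
  let ?A = "src C f"
  obtain P i1 i2 p1 p2 where
    hom: "i1 \<in> Hom C ?A P" "i2 \<in> Hom C ?A P" "p1 \<in> Hom C P ?A" "p2 \<in> Hom C P ?A"
    and pi: "p1 \<cdot> i1 = ident C ?A" "p2 \<cdot> i2 = ident C ?A"
      "p1 \<cdot> i2 = mor_zero C ?A ?A" "p2 \<cdot> i1 = mor_zero C ?A ?A"
    and sum: "(i1 \<cdot> p1) +\<^sub>m (i2 \<cdot> p2) = ident C P"
    using biproduct[of ?A ?A] by blast
  have ty [simp]: "src C i1 = ?A" "tgt C i1 = P" "src C i2 = ?A" "tgt C i2 = P"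
      "src C p1 = P" "tgt C p1 = ?A" "src C p2 = P" "tgt C p2 = ?A"
    using hom by (simp_all add: Hom_iff)
  note [simp] = assms
  note r = cmp_reassoc[OF pi(1)] cmp_reassoc[OF pi(2)] cmp_reassoc[OF pi(3)] cmp_reassoc[OF pi(4)]
  define t where "t = (f \<cdot> p1) +\<^sub>m (g \<cdot> p2)"
  define d where "d = i1 +\<^sub>m i2"
  have ty' [simp]: "src C t = P" "tgt C t = tgt C f" "src C d = ?A" "tgt C d = P"
    by (simp_all add: t_def d_def)
  have t: "t \<cdot> i1 = f" "t \<cdot> i2 = g" and d: "p1 \<cdot> d = ident C ?A" "p2 \<cdot> d = ident C ?A"
    by (simp_all add: t_def d_def cmp_add_left' cmp_add_right' pi r)
  have "t \<cdot> d = f +\<^sub>m g" by (simp add: d_def cmp_add_right' t)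
  then have "Fm (f +\<^sub>m g) = Fm t \<cdot> (((Fm i1 \<cdot> Fm p1) +\<^sub>m (Fm i2 \<cdot> Fm p2)) \<cdot> Fm d)"
    using F_biproduct[OF ty pi sum] by (simp flip: F_cmp)
  also have "\<dots> = Fm (t \<cdot> i1) \<cdot> Fm (p1 \<cdot> d) +\<^sub>m Fm (t \<cdot> i2) \<cdot> Fm (p2 \<cdot> d)"
    by (simp add: cmp_add_left' cmp_add_right' del: assms)
  also have "\<dots> = Fm f +\<^sub>m Fm g" unfolding t d by simp
  finally show ?thesis .
qed

lemma F_neg [simp]: "Fm (mor_neg C f) = mor_neg C (Fm f)"
  by (rule neg_unique[symmetric]) (simp_all flip: F_add)

text \<open>\<open>tw k A\<close> is the isomorphism \<open>F(A[k]) \<rightarrow> F(A)[k]\<close> induced by \<open>s\<close>.\<close>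

primrec tw_pos :: "nat \<Rightarrow> 'o \<Rightarrow> 'm" where
  "tw_pos 0 A = ident C (Fo A)"
| "tw_pos (Suc n) A = \<Sigma>\<^sub>m (tw_pos n A) \<cdot> s (shift_obj C (int n) A)"

primrec tw_neg :: "nat \<Rightarrow> 'o \<Rightarrow> 'm" where
  "tw_neg 0 A = ident C (Fo A)"
| "tw_neg (Suc n) A =
     shift_mor C (- 1) (tw_neg n A \<cdot> inverse_arrow C (s (shift_obj C (- int (Suc n)) A)))"

definition tw :: "int \<Rightarrow> 'o \<Rightarrow> 'm" where
  "tw k A = (if 0 \<le> k then tw_pos (nat k) A else tw_neg (nat (- k)) A)"

lemma tw_pos_type: "src C (tw_pos n A) = Fo (shift_obj C (int n) A)
    \<and> tgt C (tw_pos n A) = shift_obj C (int n) (Fo A) \<and> is_iso C (tw_pos n A)"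
  by (induct n) (use shift_obj_Suc in \<open>simp_all add: add.commute[of 1]\<close>)

lemma tw_neg_type: "src C (tw_neg n A) = Fo (shift_obj C (- int n) A)
    \<and> tgt C (tw_neg n A) = shift_obj C (- int n) (Fo A) \<and> is_iso C (tw_neg n A)"
  by (induct n) (simp_all add: shift_obj_shift flip: sus_shift_pred)

lemma src_tw [simp]: "src C (tw k A) = Fo (shift_obj C k A)"
  and tgt_tw [simp]: "tgt C (tw k A) = shift_obj C k (Fo A)"
  and is_iso_tw [simp]: "is_iso C (tw k A)"
  using tw_pos_type[of "nat k" A] tw_neg_type[of "nat (- k)" A] by (auto simp: tw_def)

lemma tw_0 [simp]: "tw 0 A = ident C (Fo A)"
  by (simp add: tw_def)

lemma tw_Suc: "tw (k + 1) A = \<Sigma>\<^sub>m (tw k A) \<cdot> s (shift_obj C k A)"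
  unfolding tw_def
proof (rule int_rec_step[where R = "\<lambda>k x y. y = \<Sigma>\<^sub>m x \<cdot> s (shift_obj C k A)"])
  fix n
  show "tw_neg n A = \<Sigma>\<^sub>m (tw_neg (Suc n) A) \<cdot> s (shift_obj C (- int (Suc n)) A)"
    using tw_neg_type[of n A] by (simp add: shift_mor_shift flip: shift_mor_1)
qed simp_all

text \<open>A ladder without sign: the rungs are \<open>Fm (shift_mor C k f)\<close>, and each
  square closes by naturality of \<open>s\<close>.\<close>

lemma tw_natural: "shift_mor C k (Fm f) \<cdot> tw k (src C f) = tw k (tgt C f) \<cdot> Fm (shift_mor C k f)"
  using shift_ladder[of "\<lambda>k. tw k (src C f)" "\<lambda>k. s (shift_obj C k (src C f))"
      "\<lambda>k. tw k (tgt C f)" "\<lambda>k. s (shift_obj C k (tgt C f))" "\<lambda>k. Fm (shift_mor C k f)" 0 "Fm f" k]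
    s_natural[of "shift_mor C _ f"]
  by (simp add: tw_Suc shift_mor_Suc shift_obj_Suc)

text \<open>With identity rungs, \<open>shift_ladder\<close> is a uniqueness principle: both sides
  solve the same recursion in \<open>l\<close> and agree at 0.\<close>

lemma tw_add: "shift_mor C l (tw k A) \<cdot> tw l (shift_obj C k A) = tw (l + k) A"
  using shift_ladder[of "\<lambda>l. tw l (shift_obj C k A)" "\<lambda>l. s (shift_obj C (l + k) A)"
      "\<lambda>l. tw (l + k) A" "\<lambda>l. s (shift_obj C (l + k) A)"
      "\<lambda>l. ident C (Fo (shift_obj C (l + k) A))" 0 "tw k A" l]
    tw_Suc[of "_ + k" A] shift_obj_Suc[of "_ + k" A]
  by (simp add: tw_Suc shift_obj_shift ac_simps)

end


section \<open>Monoidal categories\<close>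

lemma (in category) inverse_natural:
  assumes "b \<cdot> f = g \<cdot> a" "is_iso C a" "is_iso C b" "src C b = tgt C f" "src C g = tgt C a"
    "src C f = src C a" "tgt C g = tgt C b"
  shows "inverse_arrow C b \<cdot> g = f \<cdot> inverse_arrow C a"
proof -
  have "inverse_arrow C b \<cdot> (g \<cdot> a) \<cdot> inverse_arrow C a
      = inverse_arrow C b \<cdot> (b \<cdot> f) \<cdot> inverse_arrow C a"
    using assms(1) by simp
  then show ?thesis using assms(2-) by simp
qed

context monoidal_category
begin

abbreviation "\<I> \<equiv> ident C"
abbreviation "ainv f \<equiv> inverse_arrow C f"
abbreviation "\<a> \<equiv> associator C"
abbreviation "\<l> \<equiv> left_unitor C"
abbreviation "\<r> \<equiv> right_unitor C"
abbreviation "\<U> \<equiv> unit_obj C"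

lemma src_tensor [simp]: "src C (f \<otimes>\<^sub>m g) = src C f \<otimes>\<^sub>o src C g"
  and tgt_tensor [simp]: "tgt C (f \<otimes>\<^sub>m g) = tgt C f \<otimes>\<^sub>o tgt C g"
  using tensor_in_Hom[of f "src C f" "tgt C f" g "src C g" "tgt C g"] by (simp_all add: Hom_iff)

declare tensor_ident [simp]

lemma tensor_cmp':
  "\<lbrakk>src C f' = tgt C f; src C g' = tgt C g\<rbrakk> \<Longrightarrow> (f' \<otimes>\<^sub>m g') \<cdot> (f \<otimes>\<^sub>m g) = (f' \<cdot> f) \<otimes>\<^sub>m (g' \<cdot> g)"
  using tensor_cmp[of f "src C f" "tgt C f" f' "tgt C f'" g "src C g" "tgt C g" g' "tgt C g'"]
  by (simp add: Hom_iff)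

lemma interchange:
  "(tgt C f = A' \<Longrightarrow> src C g = B \<Longrightarrow> (\<I> A' \<otimes>\<^sub>m g) \<cdot> (f \<otimes>\<^sub>m \<I> B) = f \<otimes>\<^sub>m g)"
  "(src C f = A \<Longrightarrow> tgt C g = B' \<Longrightarrow> (f \<otimes>\<^sub>m \<I> B') \<cdot> (\<I> A \<otimes>\<^sub>m g) = f \<otimes>\<^sub>m g)"
  by (simp_all add: tensor_cmp')

lemma is_iso_tensor [simp]: "\<lbrakk>is_iso C f; is_iso C g\<rbrakk> \<Longrightarrow> is_iso C (f \<otimes>\<^sub>m g)"
  by (rule is_isoI[of "ainv f \<otimes>\<^sub>m ainv g"]) (simp_all add: tensor_cmp')

lemma tensor_cmp_left [simp]:
    "src C g = tgt C f \<Longrightarrow> \<I> A \<otimes>\<^sub>m (g \<cdot> f) = (\<I> A \<otimes>\<^sub>m g) \<cdot> (\<I> A \<otimes>\<^sub>m f)"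
  and tensor_cmp_right [simp]:
    "src C g = tgt C f \<Longrightarrow> (g \<cdot> f) \<otimes>\<^sub>m \<I> A = (g \<otimes>\<^sub>m \<I> A) \<cdot> (f \<otimes>\<^sub>m \<I> A)"
  by (simp_all add: tensor_cmp')

lemma
  shows src_associator [simp]: "src C (\<a> X Y Z) = (X \<otimes>\<^sub>o Y) \<otimes>\<^sub>o Z"
    and tgt_associator [simp]: "tgt C (\<a> X Y Z) = X \<otimes>\<^sub>o (Y \<otimes>\<^sub>o Z)"
    and src_left_unitor [simp]: "src C (\<l> A) = \<U> \<otimes>\<^sub>o A"
    and tgt_left_unitor [simp]: "tgt C (\<l> A) = A"
    and src_right_unitor [simp]: "src C (\<r> A) = A \<otimes>\<^sub>o \<U>"
    and tgt_right_unitor [simp]: "tgt C (\<r> A) = A"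
  using associator_in_Hom[of X Y Z] left_unitor_in_Hom[of A] right_unitor_in_Hom[of A]
  by (simp_all add: Hom_iff)

declare associator_iso [simp] left_unitor_iso [simp] right_unitor_iso [simp]

lemma associator_natural':
  "\<lbrakk>tgt C f = X'; tgt C g = Y'; tgt C h = Z'\<rbrakk> \<Longrightarrow>
    \<a> X' Y' Z' \<cdot> ((f \<otimes>\<^sub>m g) \<otimes>\<^sub>m h) = (f \<otimes>\<^sub>m (g \<otimes>\<^sub>m h)) \<cdot> \<a> (src C f) (src C g) (src C h)"
  using associator_natural[of f "src C f" X' g "src C g" Y' h "src C h" Z'] by (simp add: Hom_iff)

lemma inverse_associator_natural:
  "\<lbrakk>tgt C f = X'; tgt C g = Y'; tgt C h = Z'\<rbrakk> \<Longrightarrow>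
    ainv (\<a> X' Y' Z') \<cdot> (f \<otimes>\<^sub>m (g \<otimes>\<^sub>m h)) = ((f \<otimes>\<^sub>m g) \<otimes>\<^sub>m h) \<cdot> ainv (\<a> (src C f) (src C g) (src C h))"
  by (rule inverse_natural[OF associator_natural']) simp_all

lemma left_unitor_natural': "tgt C f = B \<Longrightarrow> \<l> B \<cdot> (\<I> \<U> \<otimes>\<^sub>m f) = f \<cdot> \<l> (src C f)"
  using left_unitor_natural[of f "src C f" B] by (simp add: Hom_iff)

lemma right_unitor_natural': "tgt C f = B \<Longrightarrow> \<r> B \<cdot> (f \<otimes>\<^sub>m \<I> \<U>) = f \<cdot> \<r> (src C f)"
  using right_unitor_natural[of f "src C f" B] by (simp add: Hom_iff)

lemma left_unit_faithful:
  assumes "\<I> \<U> \<otimes>\<^sub>m f = \<I> \<U> \<otimes>\<^sub>m g" "src C f = src C g" "tgt C f = tgt C g"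
  shows "f = g"
proof (rule iso_cancel_right)
  show "f \<cdot> \<l> (src C f) = g \<cdot> \<l> (src C f)"
    using left_unitor_natural'[of f] left_unitor_natural'[of g] assms by simp
qed (use assms in simp_all)

lemma right_unit_faithful:
  assumes "f \<otimes>\<^sub>m \<I> \<U> = g \<otimes>\<^sub>m \<I> \<U>" "src C f = src C g" "tgt C f = tgt C g"
  shows "f = g"
proof (rule iso_cancel_right)
  show "f \<cdot> \<r> (src C f) = g \<cdot> \<r> (src C f)"
    using right_unitor_natural'[of f] right_unitor_natural'[of g] assms by simp
qed (use assms in simp_all)

text \<open>Kelly's coherence argument: tensoring with the unit is faithful, and after tensoring the
  pentagon on \<open>\<U>\<close>, \<open>\<U>\<close>, \<open>A\<close>, \<open>B\<close> reduces
  the claim to triangle identities.\<close>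

lemma left_unitor_tensor: "\<l> (A \<otimes>\<^sub>o B) \<cdot> \<a> \<U> A B = \<l> A \<otimes>\<^sub>m \<I> B"
proof (rule left_unit_faithful)
  \<comment> \<open>Two invertible edges of that pentagon, composed on the right now and cancelled
    at the end.\<close>
  let ?c = "\<a> \<U> (\<U> \<otimes>\<^sub>o A) B \<cdot> (\<a> \<U> \<U> A \<otimes>\<^sub>m \<I> B)"
  have "(\<I> \<U> \<otimes>\<^sub>m (\<l> (A \<otimes>\<^sub>o B) \<cdot> \<a> \<U> A B)) \<cdot> ?c
      = (\<I> \<U> \<otimes>\<^sub>m \<l> (A \<otimes>\<^sub>o B)) \<cdot> (\<a> \<U> \<U> (A \<otimes>\<^sub>o B) \<cdot> \<a> (\<U> \<otimes>\<^sub>o \<U>) A B)"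
    by (simp add: pentagon_identity)
  also have "\<dots> = (\<r> \<U> \<otimes>\<^sub>m \<I> (A \<otimes>\<^sub>o B)) \<cdot> \<a> (\<U> \<otimes>\<^sub>o \<U>) A B"
    by (simp add: cmp_reassoc[OF triangle_identity])
  also have "\<dots> = \<a> \<U> A B \<cdot> ((\<r> \<U> \<otimes>\<^sub>m \<I> A) \<otimes>\<^sub>m \<I> B)"
    by (simp add: associator_natural')
  also have "\<dots> = \<a> \<U> A B \<cdot> ((\<I> \<U> \<otimes>\<^sub>m \<l> A) \<otimes>\<^sub>m \<I> B) \<cdot> (\<a> \<U> \<U> A \<otimes>\<^sub>m \<I> B)"
    by (simp flip: triangle_identity)
  also have "\<dots> = (\<I> \<U> \<otimes>\<^sub>m (\<l> A \<otimes>\<^sub>m \<I> B)) \<cdot> ?c"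
    by (simp add: cmp_reassoc[OF associator_natural'])
  finally show "\<I> \<U> \<otimes>\<^sub>m (\<l> (A \<otimes>\<^sub>o B) \<cdot> \<a> \<U> A B) = \<I> \<U> \<otimes>\<^sub>m (\<l> A \<otimes>\<^sub>m \<I> B)"
    by (rule iso_cancel_right[rotated]) simp_all
qed simp_all

text \<open>The mirror image of \<open>left_unitor_tensor\<close>, with the pentagon on
  \<open>A\<close>, \<open>B\<close>, \<open>\<U>\<close>, \<open>\<U>\<close>.\<close>

lemma right_unitor_tensor: "(\<I> A \<otimes>\<^sub>m \<r> B) \<cdot> \<a> A B \<U> = \<r> (A \<otimes>\<^sub>o B)"
proof (rule right_unit_faithful)
  have n: "\<a> A B \<U> \<cdot> (\<I> (A \<otimes>\<^sub>o B) \<otimes>\<^sub>m \<l> \<U>) = (\<I> A \<otimes>\<^sub>m (\<I> B \<otimes>\<^sub>m \<l> \<U>)) \<cdot> \<a> A B (\<U> \<otimes>\<^sub>o \<U>)"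
    using associator_natural'[of "\<I> A" A "\<I> B" B "\<l> \<U>" \<U>] by simp
  have "\<a> A B \<U> \<cdot> (((\<I> A \<otimes>\<^sub>m \<r> B) \<cdot> \<a> A B \<U>) \<otimes>\<^sub>m \<I> \<U>)
      = (\<I> A \<otimes>\<^sub>m (\<r> B \<otimes>\<^sub>m \<I> \<U>)) \<cdot> \<a> A (B \<otimes>\<^sub>o \<U>) \<U> \<cdot> (\<a> A B \<U> \<otimes>\<^sub>m \<I> \<U>)"
    by (simp add: cmp_reassoc[OF associator_natural'])
  also have "\<dots> = (\<I> A \<otimes>\<^sub>m (\<I> B \<otimes>\<^sub>m \<l> \<U>)) \<cdot>
      (\<I> A \<otimes>\<^sub>m \<a> B \<U> \<U>) \<cdot> \<a> A (B \<otimes>\<^sub>o \<U>) \<U> \<cdot> (\<a> A B \<U> \<otimes>\<^sub>m \<I> \<U>)"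
    by (simp flip: triangle_identity)
  also have "\<dots> = (\<I> A \<otimes>\<^sub>m (\<I> B \<otimes>\<^sub>m \<l> \<U>)) \<cdot> \<a> A B (\<U> \<otimes>\<^sub>o \<U>) \<cdot> \<a> (A \<otimes>\<^sub>o B) \<U> \<U>"
    by (simp add: pentagon_identity)
  also have "\<dots> = \<a> A B \<U> \<cdot> (\<I> (A \<otimes>\<^sub>o B) \<otimes>\<^sub>m \<l> \<U>) \<cdot> \<a> (A \<otimes>\<^sub>o B) \<U> \<U>"
    by (simp add: cmp_reassoc[OF n])
  also have "\<dots> = \<a> A B \<U> \<cdot> (\<r> (A \<otimes>\<^sub>o B) \<otimes>\<^sub>m \<I> \<U>)"
    by (simp add: triangle_identity)
  finally show "((\<I> A \<otimes>\<^sub>m \<r> B) \<cdot> \<a> A B \<U>) \<otimes>\<^sub>m \<I> \<U> = \<r> (A \<otimes>\<^sub>o B) \<otimes>\<^sub>m \<I> \<U>"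
    by (rule iso_cancel_left[rotated]) simp_all
qed simp_all

end


section \<open>Tensoring as an exact functor\<close>

context triangulated_monoidal_category
begin

abbreviation "\<S> \<equiv> sus_unit C"
abbreviation "\<alpha> \<equiv> alpha C"
abbreviation "\<beta> \<equiv> beta C"
abbreviation "sR \<equiv> sus_out_right C"
abbreviation "sL \<equiv> sus_out_left C"

lemma
  shows src_alpha [simp]: "src C (\<alpha> A) = A \<otimes>\<^sub>o \<S>"
    and tgt_alpha [simp]: "tgt C (\<alpha> A) = \<Sigma>\<^sub>o A"
    and src_beta [simp]: "src C (\<beta> A) = \<S> \<otimes>\<^sub>o A"
    and tgt_beta [simp]: "tgt C (\<beta> A) = A \<otimes>\<^sub>o \<S>"
  using alpha_in_Hom[of A] beta_in_Hom[of A] by (simp_all add: Hom_iff)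

declare alpha_iso [simp] beta_iso [simp]

lemma alpha_natural': "tgt C f = B \<Longrightarrow> \<alpha> B \<cdot> (f \<otimes>\<^sub>m \<I> \<S>) = \<Sigma>\<^sub>m f \<cdot> \<alpha> (src C f)"
  using alpha_natural[of f "src C f" B] by (simp add: Hom_iff)

lemma beta_natural': "tgt C f = B \<Longrightarrow> \<beta> B \<cdot> (\<I> \<S> \<otimes>\<^sub>m f) = (f \<otimes>\<^sub>m \<I> \<S>) \<cdot> \<beta> (src C f)"
  using beta_natural[of f "src C f" B] by (simp add: Hom_iff)

lemma
  shows src_sR [simp]: "src C (sR D A) = D \<otimes>\<^sub>o \<Sigma>\<^sub>o A"
    and tgt_sR [simp]: "tgt C (sR D A) = \<Sigma>\<^sub>o (D \<otimes>\<^sub>o A)"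
    and is_iso_sR [simp]: "is_iso C (sR D A)"
    and src_sL [simp]: "src C (sL A D) = \<Sigma>\<^sub>o A \<otimes>\<^sub>o D"
    and tgt_sL [simp]: "tgt C (sL A D) = \<Sigma>\<^sub>o (A \<otimes>\<^sub>o D)"
    and is_iso_sL [simp]: "is_iso C (sL A D)"
  by (simp_all add: sus_out_right_def sus_out_left_def)

lemma sR_alpha: "sR D A \<cdot> (\<I> D \<otimes>\<^sub>m \<alpha> A) = \<alpha> (D \<otimes>\<^sub>o A) \<cdot> ainv (\<a> D A \<S>)"
  by (simp add: sus_out_right_def flip: tensor_cmp_left)

lemma sL_alpha:
  "sL A D \<cdot> (\<alpha> A \<otimes>\<^sub>m \<I> D)
    = \<alpha> (A \<otimes>\<^sub>o D) \<cdot> ainv (\<a> A D \<S>) \<cdot> (\<I> A \<otimes>\<^sub>m \<beta> D) \<cdot> \<a> A \<S> D"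
  by (simp add: sus_out_left_def flip: tensor_cmp_right)

text \<open>Precomposing with an isomorphism built from \<alpha> removes the inverse of \<alpha>
  inside \<open>sR\<close>, leaving naturality of \<alpha> and of the associator. Both arguments
  vary because the fixed tensor factor will also have to be moved.\<close>

lemma sR_natural:
  "sR (tgt C d) (tgt C f) \<cdot> (d \<otimes>\<^sub>m \<Sigma>\<^sub>m f) = \<Sigma>\<^sub>m (d \<otimes>\<^sub>m f) \<cdot> sR (src C d) (src C f)"
proof (rule iso_cancel_right)
  let ?e = "\<I> (src C d) \<otimes>\<^sub>m \<alpha> (src C f)"
  have "(d \<otimes>\<^sub>m \<Sigma>\<^sub>m f) \<cdot> ?e = (\<I> (tgt C d) \<otimes>\<^sub>m \<alpha> (tgt C f)) \<cdot> (d \<otimes>\<^sub>m (f \<otimes>\<^sub>m \<I> \<S>))"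
    by (simp add: tensor_cmp' alpha_natural')
  then have "(sR (tgt C d) (tgt C f) \<cdot> (d \<otimes>\<^sub>m \<Sigma>\<^sub>m f)) \<cdot> ?e
      = (sR (tgt C d) (tgt C f) \<cdot> (\<I> (tgt C d) \<otimes>\<^sub>m \<alpha> (tgt C f))) \<cdot> (d \<otimes>\<^sub>m (f \<otimes>\<^sub>m \<I> \<S>))"
    by simp
  also have "\<dots> = \<alpha> (tgt C d \<otimes>\<^sub>o tgt C f) \<cdot> ((d \<otimes>\<^sub>m f) \<otimes>\<^sub>m \<I> \<S>) \<cdot> ainv (\<a> (src C d) (src C f) \<S>)"
    unfolding sR_alpha by (simp add: inverse_associator_natural)
  also have "\<dots> = \<Sigma>\<^sub>m (d \<otimes>\<^sub>m f) \<cdot> \<alpha> (src C d \<otimes>\<^sub>o src C f) \<cdot> ainv (\<a> (src C d) (src C f) \<S>)"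
    by (simp add: cmp_reassoc[OF alpha_natural'])
  also have "\<dots> = (\<Sigma>\<^sub>m (d \<otimes>\<^sub>m f) \<cdot> sR (src C d) (src C f)) \<cdot> ?e"
    by (simp add: sR_alpha)
  finally show "(sR (tgt C d) (tgt C f) \<cdot> (d \<otimes>\<^sub>m \<Sigma>\<^sub>m f)) \<cdot> ?e
      = (\<Sigma>\<^sub>m (d \<otimes>\<^sub>m f) \<cdot> sR (src C d) (src C f)) \<cdot> ?e" .
qed simp_all

lemma sL_natural:
  "sL (tgt C f) (tgt C d) \<cdot> (\<Sigma>\<^sub>m f \<otimes>\<^sub>m d) = \<Sigma>\<^sub>m (f \<otimes>\<^sub>m d) \<cdot> sL (src C f) (src C d)"
proof (rule iso_cancel_right)
  let ?A = "src C f" and ?A' = "tgt C f" and ?D = "src C d" and ?D' = "tgt C d"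
  let ?e = "\<alpha> ?A \<otimes>\<^sub>m \<I> ?D"
  have "(\<Sigma>\<^sub>m f \<otimes>\<^sub>m d) \<cdot> ?e = (\<alpha> ?A' \<otimes>\<^sub>m \<I> ?D') \<cdot> ((f \<otimes>\<^sub>m \<I> \<S>) \<otimes>\<^sub>m d)"
    by (simp add: tensor_cmp' alpha_natural')
  then have "(sL ?A' ?D' \<cdot> (\<Sigma>\<^sub>m f \<otimes>\<^sub>m d)) \<cdot> ?e
      = (sL ?A' ?D' \<cdot> (\<alpha> ?A' \<otimes>\<^sub>m \<I> ?D')) \<cdot> ((f \<otimes>\<^sub>m \<I> \<S>) \<otimes>\<^sub>m d)"
    by simp
  also have "\<dots> = \<alpha> (?A' \<otimes>\<^sub>o ?D') \<cdot> ainv (\<a> ?A' ?D' \<S>) \<cdot>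
      ((\<I> ?A' \<otimes>\<^sub>m \<beta> ?D') \<cdot> (f \<otimes>\<^sub>m (\<I> \<S> \<otimes>\<^sub>m d))) \<cdot> \<a> ?A \<S> ?D"
    unfolding sL_alpha by (simp add: associator_natural')
  also have "(\<I> ?A' \<otimes>\<^sub>m \<beta> ?D') \<cdot> (f \<otimes>\<^sub>m (\<I> \<S> \<otimes>\<^sub>m d)) = (f \<otimes>\<^sub>m (d \<otimes>\<^sub>m \<I> \<S>)) \<cdot> (\<I> ?A \<otimes>\<^sub>m \<beta> ?D)"
    by (simp add: tensor_cmp' beta_natural')
  also have "\<alpha> (?A' \<otimes>\<^sub>o ?D') \<cdot> ainv (\<a> ?A' ?D' \<S>) \<cdot>
      ((f \<otimes>\<^sub>m (d \<otimes>\<^sub>m \<I> \<S>)) \<cdot> (\<I> ?A \<otimes>\<^sub>m \<beta> ?D)) \<cdot> \<a> ?A \<S> ?D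
      = \<alpha> (?A' \<otimes>\<^sub>o ?D') \<cdot> ((f \<otimes>\<^sub>m d) \<otimes>\<^sub>m \<I> \<S>) \<cdot> ainv (\<a> ?A ?D \<S>) \<cdot>
        (\<I> ?A \<otimes>\<^sub>m \<beta> ?D) \<cdot> \<a> ?A \<S> ?D"
    by (simp add: cmp_reassoc[OF inverse_associator_natural])
  also have "\<dots> = \<Sigma>\<^sub>m (f \<otimes>\<^sub>m d) \<cdot> \<alpha> (?A \<otimes>\<^sub>o ?D) \<cdot> ainv (\<a> ?A ?D \<S>) \<cdot>
        (\<I> ?A \<otimes>\<^sub>m \<beta> ?D) \<cdot> \<a> ?A \<S> ?D"
    by (simp add: cmp_reassoc[OF alpha_natural'])
  also have "\<dots> = (\<Sigma>\<^sub>m (f \<otimes>\<^sub>m d) \<cdot> sL ?A ?D) \<cdot> ?e"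
    by (simp add: sL_alpha)
  finally show "(sL ?A' ?D' \<cdot> (\<Sigma>\<^sub>m f \<otimes>\<^sub>m d)) \<cdot> ?e = (\<Sigma>\<^sub>m (f \<otimes>\<^sub>m d) \<cdot> sL ?A ?D) \<cdot> ?e" .
qed simp_all

end

sublocale triangulated_monoidal_category \<subseteq>
  left: exact_functor C "\<lambda>X. A \<otimes>\<^sub>o X" "\<lambda>f. ident C A \<otimes>\<^sub>m f" "sus_out_right C A" for A
proof
  fix f
  show "sR A (tgt C f) \<cdot> (\<I> A \<otimes>\<^sub>m \<Sigma>\<^sub>m f) = \<Sigma>\<^sub>m (\<I> A \<otimes>\<^sub>m f) \<cdot> sR A (src C f)"
    using sR_natural[of "\<I> A" f] by simp
qed (simp_all add: tensor_left_exact)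

sublocale triangulated_monoidal_category \<subseteq>
  right: exact_functor C "\<lambda>X. X \<otimes>\<^sub>o B" "\<lambda>f. f \<otimes>\<^sub>m ident C B" "\<lambda>X. sus_out_left C X B" for B
proof
  fix f
  show "sL (tgt C f) B \<cdot> (\<Sigma>\<^sub>m f \<otimes>\<^sub>m \<I> B) = \<Sigma>\<^sub>m (f \<otimes>\<^sub>m \<I> B) \<cdot> sL (src C f) B"
    using sL_natural[of f "\<I> B"] by simp
qed (simp_all add: tensor_right_exact)

section \<open>The sign of exchanging two suspensions\<close>

context triangulated_monoidal_category
begin

text \<open>The hexagon \<open>beta_tensor\<close> with second factor \<open>\<S>\<close>.
  Additivity of \<open>B \<otimes> -\<close>, just obtained from exactness, is what brings the sign
  of \<open>\<beta> \<S>\<close> outside the tensor product.\<close>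

lemma beta_tensor_sus: "\<beta> (B \<otimes>\<^sub>o \<S>) = mor_neg C ((\<beta> B \<otimes>\<^sub>m \<I> \<S>) \<cdot> ainv (\<a> \<S> B \<S>))"
proof (rule iso_cancel_left)
  have "\<a> B \<S> \<S> \<cdot> \<beta> (B \<otimes>\<^sub>o \<S>) = (\<a> B \<S> \<S> \<cdot> \<beta> (B \<otimes>\<^sub>o \<S>) \<cdot> \<a> \<S> B \<S>) \<cdot> ainv (\<a> \<S> B \<S>)"
    by simp
  also have "\<dots> = \<a> B \<S> \<S> \<cdot> mor_neg C ((\<beta> B \<otimes>\<^sub>m \<I> \<S>) \<cdot> ainv (\<a> \<S> B \<S>))"
    unfolding beta_tensor beta_sus_unit by simp
  finally show "\<a> B \<S> \<S> \<cdot> \<beta> (B \<otimes>\<^sub>o \<S>) = \<a> B \<S> \<S> \<cdot> mor_neg C ((\<beta> B \<otimes>\<^sub>m \<I> \<S>) \<cdot> ainv (\<a> \<S> B \<S>))" .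
qed simp_all

text \<open>The pentagon solved for the combination of associators that separates the two orders of
  extraction in \<open>sus_out_anticommute\<close>.\<close>

lemma pentagon_inverse:
  "(\<a> A X B \<otimes>\<^sub>m \<I> Z) \<cdot> ainv (\<a> (A \<otimes>\<^sub>o X) B Z)
    = ainv (\<a> A (X \<otimes>\<^sub>o B) Z) \<cdot> (\<I> A \<otimes>\<^sub>m ainv (\<a> X B Z)) \<cdot> \<a> A X (B \<otimes>\<^sub>o Z)"
proof -
  have "ainv (\<a> A (X \<otimes>\<^sub>o B) Z) \<cdot> (\<I> A \<otimes>\<^sub>m ainv (\<a> X B Z)) \<cdot> \<a> A X (B \<otimes>\<^sub>o Z)
      = ainv (\<a> A (X \<otimes>\<^sub>o B) Z) \<cdot> (\<I> A \<otimes>\<^sub>m ainv (\<a> X B Z)) \<cdot>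
        (\<a> A X (B \<otimes>\<^sub>o Z) \<cdot> \<a> (A \<otimes>\<^sub>o X) B Z) \<cdot> ainv (\<a> (A \<otimes>\<^sub>o X) B Z)"
    by simp
  also have "\<dots> = ainv (\<a> A (X \<otimes>\<^sub>o B) Z) \<cdot> ((\<I> A \<otimes>\<^sub>m ainv (\<a> X B Z)) \<cdot> (\<I> A \<otimes>\<^sub>m \<a> X B Z)) \<cdot>
        \<a> A (X \<otimes>\<^sub>o B) Z \<cdot> (\<a> A X B \<otimes>\<^sub>m \<I> Z) \<cdot> ainv (\<a> (A \<otimes>\<^sub>o X) B Z)"
    unfolding pentagon_identity by simp
  also have "(\<I> A \<otimes>\<^sub>m ainv (\<a> X B Z)) \<cdot> (\<I> A \<otimes>\<^sub>m \<a> X B Z) = \<I> (A \<otimes>\<^sub>o ((X \<otimes>\<^sub>o B) \<otimes>\<^sub>o Z))"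
    by (simp flip: tensor_cmp_left)
  finally show ?thesis by simp
qed

text \<open>The sign is that of \<open>\<beta>\<close> at \<open>\<one>[1]\<close>: moving both shifts out in one order passes \<open>\<one>[1]\<close> across
  \<open>B\<close>, in the other order across \<open>B \<otimes> \<one>[1]\<close>.\<close>

lemma sus_out_anticommute:
  "\<Sigma>\<^sub>m (sR A B) \<cdot> sL A (\<Sigma>\<^sub>o B) = mor_neg C (\<Sigma>\<^sub>m (sL A B) \<cdot> sR (\<Sigma>\<^sub>o A) B)"
proof (rule iso_cancel_right)
  \<comment> \<open>Precomposition with \<open>?e\<close> replaces both suspended objects by tensor
    products with \<open>\<S>\<close>, where \<open>sR\<close> and \<open>sL\<close> become explicit
    composites of associators, \<alpha> and \<beta>.\<close>
  let ?e = "\<alpha> A \<otimes>\<^sub>m \<alpha> B"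
  let ?g = "\<Sigma>\<^sub>m (\<alpha> (A \<otimes>\<^sub>o B)) \<cdot> \<Sigma>\<^sub>m (ainv (\<a> A B \<S>))"
  let ?h = "((\<I> A \<otimes>\<^sub>m \<beta> B) \<otimes>\<^sub>m \<I> \<S>) \<cdot> (\<a> A \<S> B \<otimes>\<^sub>m \<I> \<S>) \<cdot> ainv (\<a> (A \<otimes>\<^sub>o \<S>) B \<S>)"
  note nat = cmp_reassoc[OF alpha_natural'] cmp_reassoc[OF inverse_associator_natural]
    cmp_reassoc[OF associator_natural'] associator_natural' inverse_associator_natural
    alpha_natural' beta_natural'
  have "(\<Sigma>\<^sub>m (sL A B) \<cdot> sR (\<Sigma>\<^sub>o A) B) \<cdot> ?e
      = \<Sigma>\<^sub>m (sL A B) \<cdot> (sR (\<Sigma>\<^sub>o A) B \<cdot> (\<I> (\<Sigma>\<^sub>o A) \<otimes>\<^sub>m \<alpha> B)) \<cdot> (\<alpha> A \<otimes>\<^sub>m \<I> (B \<otimes>\<^sub>o \<S>))"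
    by (simp add: interchange)
  also have "\<dots> = \<Sigma>\<^sub>m (sL A B) \<cdot> \<alpha> (\<Sigma>\<^sub>o A \<otimes>\<^sub>o B) \<cdot> ainv (\<a> (\<Sigma>\<^sub>o A) B \<S>) \<cdot> (\<alpha> A \<otimes>\<^sub>m (\<I> B \<otimes>\<^sub>m \<I> \<S>))"
    unfolding sR_alpha by simp
  also have "\<dots> = \<Sigma>\<^sub>m (sL A B \<cdot> (\<alpha> A \<otimes>\<^sub>m \<I> B)) \<cdot> \<alpha> ((A \<otimes>\<^sub>o \<S>) \<otimes>\<^sub>o B) \<cdot> ainv (\<a> (A \<otimes>\<^sub>o \<S>) B \<S>)"
    by (simp add: nat del: tensor_ident left.F_ident right.F_ident)
  also have "\<dots> = ?g \<cdot> \<Sigma>\<^sub>m ((\<I> A \<otimes>\<^sub>m \<beta> B) \<cdot> \<a> A \<S> B) \<cdot> \<alpha> ((A \<otimes>\<^sub>o \<S>) \<otimes>\<^sub>o B) \<cdot> ainv (\<a> (A \<otimes>\<^sub>o \<S>) B \<S>)"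
    unfolding sL_alpha by simp
  also have "\<dots> = ?g \<cdot> \<alpha> (A \<otimes>\<^sub>o (B \<otimes>\<^sub>o \<S>)) \<cdot> ?h"
    by (simp add: nat)
  finally have 1: "(\<Sigma>\<^sub>m (sL A B) \<cdot> sR (\<Sigma>\<^sub>o A) B) \<cdot> ?e = ?g \<cdot> \<alpha> (A \<otimes>\<^sub>o (B \<otimes>\<^sub>o \<S>)) \<cdot> ?h" .
  have "(\<Sigma>\<^sub>m (sR A B) \<cdot> sL A (\<Sigma>\<^sub>o B)) \<cdot> ?e
      = \<Sigma>\<^sub>m (sR A B) \<cdot> (sL A (\<Sigma>\<^sub>o B) \<cdot> (\<alpha> A \<otimes>\<^sub>m \<I> (\<Sigma>\<^sub>o B))) \<cdot> ((\<I> A \<otimes>\<^sub>m \<I> \<S>) \<otimes>\<^sub>m \<alpha> B)"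
    by (simp add: interchange)
  also have "\<dots> = \<Sigma>\<^sub>m (sR A B) \<cdot> \<alpha> (A \<otimes>\<^sub>o \<Sigma>\<^sub>o B) \<cdot> ainv (\<a> A (\<Sigma>\<^sub>o B) \<S>) \<cdot>
      ((\<I> A \<otimes>\<^sub>m \<beta> (\<Sigma>\<^sub>o B)) \<cdot> (\<I> A \<otimes>\<^sub>m (\<I> \<S> \<otimes>\<^sub>m \<alpha> B))) \<cdot> \<a> A \<S> (B \<otimes>\<^sub>o \<S>)"
    unfolding sL_alpha by (simp add: nat del: tensor_ident left.F_ident right.F_ident)
  \<comment> \<open>Naturality of \<beta> along \<open>\<alpha> B\<close> exposes \<beta> at
    \<open>B \<otimes> \<S>\<close>, the value to which the sign formula applies.\<close>
  also have "(\<I> A \<otimes>\<^sub>m \<beta> (\<Sigma>\<^sub>o B)) \<cdot> (\<I> A \<otimes>\<^sub>m (\<I> \<S> \<otimes>\<^sub>m \<alpha> B))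
      = (\<I> A \<otimes>\<^sub>m (\<alpha> B \<otimes>\<^sub>m \<I> \<S>)) \<cdot> (\<I> A \<otimes>\<^sub>m \<beta> (B \<otimes>\<^sub>o \<S>))"
    by (simp add: beta_natural' flip: tensor_cmp_left)
  also have "\<Sigma>\<^sub>m (sR A B) \<cdot> \<alpha> (A \<otimes>\<^sub>o \<Sigma>\<^sub>o B) \<cdot> ainv (\<a> A (\<Sigma>\<^sub>o B) \<S>) \<cdot>
      ((\<I> A \<otimes>\<^sub>m (\<alpha> B \<otimes>\<^sub>m \<I> \<S>)) \<cdot> (\<I> A \<otimes>\<^sub>m \<beta> (B \<otimes>\<^sub>o \<S>))) \<cdot> \<a> A \<S> (B \<otimes>\<^sub>o \<S>)
      = \<Sigma>\<^sub>m (sR A B \<cdot> (\<I> A \<otimes>\<^sub>m \<alpha> B)) \<cdot> \<alpha> (A \<otimes>\<^sub>o (B \<otimes>\<^sub>o \<S>)) \<cdot> ainv (\<a> A (B \<otimes>\<^sub>o \<S>) \<S>) \<cdot>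
      (\<I> A \<otimes>\<^sub>m \<beta> (B \<otimes>\<^sub>o \<S>)) \<cdot> \<a> A \<S> (B \<otimes>\<^sub>o \<S>)"
    by (simp add: nat)
  also have "\<dots> = mor_neg C (?g \<cdot> \<alpha> (A \<otimes>\<^sub>o (B \<otimes>\<^sub>o \<S>)) \<cdot> (ainv (\<a> A (B \<otimes>\<^sub>o \<S>) \<S>) \<cdot>
      (\<I> A \<otimes>\<^sub>m (\<beta> B \<otimes>\<^sub>m \<I> \<S>))) \<cdot> (\<I> A \<otimes>\<^sub>m ainv (\<a> \<S> B \<S>)) \<cdot> \<a> A \<S> (B \<otimes>\<^sub>o \<S>))"
    unfolding sR_alpha beta_tensor_sus by simp
  also have "\<dots> = mor_neg C (?g \<cdot> \<alpha> (A \<otimes>\<^sub>o (B \<otimes>\<^sub>o \<S>)) \<cdot> ((\<I> A \<otimes>\<^sub>m \<beta> B) \<otimes>\<^sub>m \<I> \<S>) \<cdot>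
      (ainv (\<a> A (\<S> \<otimes>\<^sub>o B) \<S>) \<cdot> (\<I> A \<otimes>\<^sub>m ainv (\<a> \<S> B \<S>)) \<cdot> \<a> A \<S> (B \<otimes>\<^sub>o \<S>)))"
    by (simp add: cmp_reassoc[OF inverse_associator_natural] inverse_associator_natural)
  also have "\<dots> = mor_neg C ((\<Sigma>\<^sub>m (sL A B) \<cdot> sR (\<Sigma>\<^sub>o A) B) \<cdot> ?e)"
    unfolding 1 pentagon_inverse[symmetric] by simp
  finally show "(\<Sigma>\<^sub>m (sR A B) \<cdot> sL A (\<Sigma>\<^sub>o B)) \<cdot> ?e
      = mor_neg C (\<Sigma>\<^sub>m (sL A B) \<cdot> sR (\<Sigma>\<^sub>o A) B) \<cdot> ?e" by simp
qed simp_all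

text \<open>The crossing with the unit is trivial up to unitors. The hexagon at two units expresses
  the crossing with \<open>\<U> \<otimes> \<U>\<close> by two crossings with \<open>\<U>\<close>;
  one of them cancels because \<open>\<beta> \<U>\<close> is invertible.\<close>

lemma left_unitor_beta: "\<l> \<S> \<cdot> \<beta> \<U> = \<r> \<S>"
proof (rule right_unit_faithful)
  have "\<beta> \<U> \<cdot> ((\<l> \<S> \<cdot> \<beta> \<U>) \<otimes>\<^sub>m \<I> \<U>) = \<beta> \<U> \<cdot> (\<l> \<S> \<otimes>\<^sub>m \<I> \<U>) \<cdot> (\<beta> \<U> \<otimes>\<^sub>m \<I> \<U>)"
    by simp
  also have "\<dots> = (\<beta> \<U> \<cdot> \<l> (\<S> \<otimes>\<^sub>o \<U>)) \<cdot> \<a> \<U> \<S> \<U> \<cdot> (\<beta> \<U> \<otimes>\<^sub>m \<I> \<U>)"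
    by (simp flip: left_unitor_tensor)
  also have "\<dots> = \<l> (\<U> \<otimes>\<^sub>o \<S>) \<cdot> (\<I> \<U> \<otimes>\<^sub>m \<beta> \<U>) \<cdot> \<a> \<U> \<S> \<U> \<cdot> (\<beta> \<U> \<otimes>\<^sub>m \<I> \<U>)"
    using left_unitor_natural'[of "\<beta> \<U>"] by (simp add: cmp_reassoc[OF left_unitor_natural'])
  also have "\<dots> = (\<l> (\<U> \<otimes>\<^sub>o \<S>) \<cdot> \<a> \<U> \<U> \<S>) \<cdot> \<beta> (\<U> \<otimes>\<^sub>o \<U>) \<cdot> \<a> \<S> \<U> \<U>"
    by (simp flip: beta_tensor)
  also have "\<dots> = (\<beta> \<U> \<cdot> (\<I> \<S> \<otimes>\<^sub>m \<l> \<U>)) \<cdot> \<a> \<S> \<U> \<U>"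
    unfolding left_unitor_tensor by (simp add: beta_natural')
  also have "\<dots> = \<beta> \<U> \<cdot> (\<r> \<S> \<otimes>\<^sub>m \<I> \<U>)"
    by (simp add: triangle_identity)
  finally show "(\<l> \<S> \<cdot> \<beta> \<U>) \<otimes>\<^sub>m \<I> \<U> = \<r> \<S> \<otimes>\<^sub>m \<I> \<U>"
    by (rule iso_cancel_left[rotated]) simp_all
qed simp_all

lemma left_unitor_sR: "\<Sigma>\<^sub>m (\<l> A) \<cdot> sR \<U> A = \<l> (\<Sigma>\<^sub>o A)"
proof (rule iso_cancel_right)
  have "(\<Sigma>\<^sub>m (\<l> A) \<cdot> sR \<U> A) \<cdot> (\<I> \<U> \<otimes>\<^sub>m \<alpha> A) = (\<Sigma>\<^sub>m (\<l> A) \<cdot> \<alpha> (\<U> \<otimes>\<^sub>o A)) \<cdot> ainv (\<a> \<U> A \<S>)"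
    by (simp add: sR_alpha)
  also have "\<dots> = \<alpha> A \<cdot> (\<l> A \<otimes>\<^sub>m \<I> \<S>) \<cdot> ainv (\<a> \<U> A \<S>)"
    by (simp add: cmp_reassoc[OF alpha_natural'])
  also have "\<dots> = \<l> (\<Sigma>\<^sub>o A) \<cdot> (\<I> \<U> \<otimes>\<^sub>m \<alpha> A)"
    by (simp add: left_unitor_natural' flip: left_unitor_tensor)
  finally show "(\<Sigma>\<^sub>m (\<l> A) \<cdot> sR \<U> A) \<cdot> (\<I> \<U> \<otimes>\<^sub>m \<alpha> A) = \<l> (\<Sigma>\<^sub>o A) \<cdot> (\<I> \<U> \<otimes>\<^sub>m \<alpha> A)" .
qed simp_all

text \<open>Unlike \<open>left_unitor_sR\<close>, this involves \<beta>, since \<open>sL\<close>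
  moves \<open>\<S>\<close> across the right factor; \<open>left_unitor_beta\<close> absorbs that
  crossing.\<close>

lemma right_unitor_sL: "\<Sigma>\<^sub>m (\<r> A) \<cdot> sL A \<U> = \<r> (\<Sigma>\<^sub>o A)"
proof (rule iso_cancel_right)
  have "(\<Sigma>\<^sub>m (\<r> A) \<cdot> sL A \<U>) \<cdot> (\<alpha> A \<otimes>\<^sub>m \<I> \<U>)
      = (\<Sigma>\<^sub>m (\<r> A) \<cdot> \<alpha> (A \<otimes>\<^sub>o \<U>)) \<cdot> ainv (\<a> A \<U> \<S>) \<cdot> (\<I> A \<otimes>\<^sub>m \<beta> \<U>) \<cdot> \<a> A \<S> \<U>"
    by (simp add: sL_alpha)
  also have "\<dots> = \<alpha> A \<cdot> (\<r> A \<otimes>\<^sub>m \<I> \<S>) \<cdot> ainv (\<a> A \<U> \<S>) \<cdot> (\<I> A \<otimes>\<^sub>m \<beta> \<U>) \<cdot> \<a> A \<S> \<U>"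
    by (simp add: cmp_reassoc[OF alpha_natural'])
  also have "\<dots> = \<alpha> A \<cdot> ((\<I> A \<otimes>\<^sub>m \<l> \<S>) \<cdot> (\<I> A \<otimes>\<^sub>m \<beta> \<U>)) \<cdot> \<a> A \<S> \<U>"
    by (simp flip: triangle_identity)
  also have "\<dots> = \<alpha> A \<cdot> \<r> (A \<otimes>\<^sub>o \<S>)"
    by (simp add: left_unitor_beta right_unitor_tensor flip: tensor_cmp_left)
  also have "\<dots> = \<r> (\<Sigma>\<^sub>o A) \<cdot> (\<alpha> A \<otimes>\<^sub>m \<I> \<U>)"
    by (simp add: right_unitor_natural')
  finally show "(\<Sigma>\<^sub>m (\<r> A) \<cdot> sL A \<U>) \<cdot> (\<alpha> A \<otimes>\<^sub>m \<I> \<U>) = \<r> (\<Sigma>\<^sub>o A) \<cdot> (\<alpha> A \<otimes>\<^sub>m \<I> \<U>)" .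
qed simp_all


end


section \<open>Graded actions\<close>

text \<open>The graded extension of \<open>F\<close>, sending \<open>f\<close> of degree
  \<open>k\<close> to \<open>tw k \<cdot> Fm f\<close>, respects graded composition. This later
  makes \<open>a \<mapsto> L_a\<close> multiplicative.\<close>

lemma (in exact_functor) tw_cmp:
  assumes "tgt C f = shift_obj C k (src C g)" "tgt C g = shift_obj C l Z"
  shows "shift_mor C k (tw l Z \<cdot> Fm g) \<cdot> (tw k (src C g) \<cdot> Fm f)
    = tw (k + l) Z \<cdot> Fm (shift_mor C k g \<cdot> f)"
proof -
  have "shift_mor C k (tw l Z \<cdot> Fm g) \<cdot> (tw k (src C g) \<cdot> Fm f)
      = shift_mor C k (tw l Z) \<cdot> (shift_mor C k (Fm g) \<cdot> tw k (src C g)) \<cdot> Fm f"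
    using assms by simp
  also have "\<dots> = (shift_mor C k (tw l Z) \<cdot> tw k (shift_obj C l Z)) \<cdot> Fm (shift_mor C k g) \<cdot> Fm f"
    unfolding tw_natural using assms by (simp add: shift_obj_shift)
  also have "\<dots> = tw (k + l) Z \<cdot> Fm (shift_mor C k g \<cdot> f)"
    unfolding tw_add using assms by (simp add: shift_obj_shift)
  finally show ?thesis .
qed

section \<open>Supercommutation of the two tensor factors\<close>

context triangulated_monoidal_category
begin

text \<open>Here the fixed tensor factor varies, which \<open>tw_natural\<close> does not cover:
  inside \<open>exact_functor\<close> that factor is part of the functor.\<close>

lemma right_tw_natural_param:
  "shift_mor C k (\<I> A \<otimes>\<^sub>m d) \<cdot> right.tw (src C d) k A
    = right.tw (tgt C d) k A \<cdot> (\<I> (shift_obj C k A) \<otimes>\<^sub>m d)"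
  using shift_ladder[of "\<lambda>k. right.tw (src C d) k A" "\<lambda>k. sL (shift_obj C k A) (src C d)"
      "\<lambda>k. right.tw (tgt C d) k A" "\<lambda>k. sL (shift_obj C k A) (tgt C d)"
      "\<lambda>k. \<I> (shift_obj C k A) \<otimes>\<^sub>m d" 0 "\<I> A \<otimes>\<^sub>m d" k]
    sL_natural[of "\<I> (shift_obj C _ A)" d]
  by (simp add: right.tw_Suc shift_obj_Suc)

lemma left_tw_natural_param:
  "shift_mor C k (d \<otimes>\<^sub>m \<I> A) \<cdot> left.tw (src C d) k A
    = left.tw (tgt C d) k A \<cdot> (d \<otimes>\<^sub>m \<I> (shift_obj C k A))"
  using shift_ladder[of "\<lambda>k. left.tw (src C d) k A" "\<lambda>k. sR (src C d) (shift_obj C k A)"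
      "\<lambda>k. left.tw (tgt C d) k A" "\<lambda>k. sR (tgt C d) (shift_obj C k A)"
      "\<lambda>k. d \<otimes>\<^sub>m \<I> (shift_obj C k A)" 0 "d \<otimes>\<^sub>m \<I> A" k]
    sR_natural[of d "\<I> (shift_obj C _ A)"]
  by (simp add: left.tw_Suc shift_obj_Suc)

text \<open>The first of two nested ladders. Each of the \<open>k\<close> suspensions leaving the
  left factor passes one suspension of the right factor and contributes one sign.\<close>

lemma right_tw_sR:
  "shift_mor C k (sR A B) \<cdot> right.tw (\<Sigma>\<^sub>o B) k A
    = mor_sign k (\<Sigma>\<^sub>m (right.tw B k A) \<cdot> sR (shift_obj C k A) B)"
  using shift_ladder[of "\<lambda>k. right.tw (\<Sigma>\<^sub>o B) k A" "\<lambda>k. sL (shift_obj C k A) (\<Sigma>\<^sub>o B)"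
      "\<lambda>k. \<Sigma>\<^sub>m (right.tw B k A)" "\<lambda>k. \<Sigma>\<^sub>m (sL (shift_obj C k A) B)"
      "\<lambda>k. sR (shift_obj C k A) B" 1 "sR A B" k]
    sus_out_anticommute[of "shift_obj C _ A" B]
  by (simp add: right.tw_Suc shift_obj_Suc mor_sign_def[of 1])

text \<open>The second ladder runs over \<open>l\<close> with \<open>right_tw_sR\<close> as its rung
  relation. A sign exponent \<open>k\<close> at every rung accumulates to
  \<open>k * l\<close>.\<close>

lemma left_tw_right_tw:
  "shift_mor C l (right.tw B k A) \<cdot> left.tw (shift_obj C k A) l B
    = mor_sign (k * l) (shift_mor C k (left.tw A l B) \<cdot> right.tw (shift_obj C l B) k A)"
proof (rule shift_ladder[where p = "\<lambda>l. sR (shift_obj C k A) (shift_obj C l B)"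
      and q = "\<lambda>l. shift_mor C k (sR A (shift_obj C l B))"])
  fix l
  show "\<Sigma>\<^sub>m (right.tw (shift_obj C l B) k A) \<cdot> sR (shift_obj C k A) (shift_obj C l B)
      = mor_sign k (shift_mor C k (sR A (shift_obj C l B)) \<cdot> right.tw (shift_obj C (l + 1) B) k A)"
    by (simp add: shift_obj_Suc right_tw_sR) (simp add: mor_sign_def)
qed (simp_all add: left.tw_Suc sus_shift_mor sus_shift_obj shift_obj_Suc)

text \<open>By naturality in the fixed factor, both orders of composition reduce to the same arrow
  \<open>f \<otimes> g\<close> followed by the two orders of extracting shifts, which differ by the
  sign.\<close>

lemma left_right_supercommute:
  assumes f: "src C f = A" "tgt C f = shift_obj C k A"
    and g: "src C g = B" "tgt C g = shift_obj C l B"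
  shows "shift_mor C l (right.tw B k A \<cdot> (f \<otimes>\<^sub>m \<I> B)) \<cdot> (left.tw A l B \<cdot> (\<I> A \<otimes>\<^sub>m g))
    = mor_sign (k * l)
        (shift_mor C k (left.tw A l B \<cdot> (\<I> A \<otimes>\<^sub>m g)) \<cdot> (right.tw B k A \<cdot> (f \<otimes>\<^sub>m \<I> B)))"
proof -
  have 1: "shift_mor C l (f \<otimes>\<^sub>m \<I> B) \<cdot> left.tw A l B
      = left.tw (shift_obj C k A) l B \<cdot> (f \<otimes>\<^sub>m \<I> (shift_obj C l B))"
    using left_tw_natural_param[of l f B] f by simp
  have 2: "shift_mor C k (\<I> A \<otimes>\<^sub>m g) \<cdot> right.tw B k A
      = right.tw (shift_obj C l B) k A \<cdot> (\<I> (shift_obj C k A) \<otimes>\<^sub>m g)"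
    using right_tw_natural_param[of k A g] g by simp
  have "shift_mor C l (right.tw B k A \<cdot> (f \<otimes>\<^sub>m \<I> B)) \<cdot> (left.tw A l B \<cdot> (\<I> A \<otimes>\<^sub>m g))
      = (shift_mor C l (right.tw B k A) \<cdot> left.tw (shift_obj C k A) l B) \<cdot> (f \<otimes>\<^sub>m g)"
    using f g by (simp add: cmp_reassoc[OF 1] interchange)
  also have "\<dots> = mor_sign (k * l)
        (shift_mor C k (left.tw A l B \<cdot> (\<I> A \<otimes>\<^sub>m g)) \<cdot> (right.tw B k A \<cdot> (f \<otimes>\<^sub>m \<I> B)))"
    unfolding left_tw_right_tw using f g by (simp add: cmp_reassoc[OF 2] interchange)
  finally show ?thesis .
qed

text \<open>Naturality of the left unitor along itself identifies its value at
  \<open>\<U> \<otimes> \<U>\<close> with \<open>\<I> \<U> \<otimes> \<l> \<U>\<close>; the triangle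
  identity then brings in the right unitor.\<close>

lemma left_unitor_eq_right_unitor: "\<l> \<U> = \<r> \<U>"
proof (rule right_unit_faithful)
  have "\<l> \<U> \<cdot> (\<I> \<U> \<otimes>\<^sub>m \<l> \<U>) = \<l> \<U> \<cdot> \<l> (\<U> \<otimes>\<^sub>o \<U>)"
    by (simp add: left_unitor_natural')
  then have "\<I> \<U> \<otimes>\<^sub>m \<l> \<U> = \<l> (\<U> \<otimes>\<^sub>o \<U>)"
    by (rule iso_cancel_left[rotated]) simp_all
  then show "\<l> \<U> \<otimes>\<^sub>m \<I> \<U> = \<r> \<U> \<otimes>\<^sub>m \<I> \<U>"
    using left_unitor_tensor[of \<U> \<U>] triangle_identity[of \<U> \<U>] by simp
qed simp_all

lemma left_tw_unit: "shift_mor C k (\<l> A) \<cdot> left.tw \<U> k A = \<l> (shift_obj C k A)"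
  using shift_ladder[of "\<lambda>k. left.tw \<U> k A" "\<lambda>k. sR \<U> (shift_obj C k A)"
      "\<lambda>k. \<I> (shift_obj C k A)" "\<lambda>k. \<I> (shift_obj C (k + 1) A)"
      "\<lambda>k. \<l> (shift_obj C k A)" 0 "\<l> A" k]
  by (simp add: left.tw_Suc shift_obj_Suc left_unitor_sR)

lemma right_tw_unit: "shift_mor C k (\<r> A) \<cdot> right.tw \<U> k A = \<r> (shift_obj C k A)"
  using shift_ladder[of "\<lambda>k. right.tw \<U> k A" "\<lambda>k. sL (shift_obj C k A) \<U>"
      "\<lambda>k. \<I> (shift_obj C k A)" "\<lambda>k. \<I> (shift_obj C (k + 1) A)"
      "\<lambda>k. \<r> (shift_obj C k A)" 0 "\<r> A" k]
  by (simp add: right.tw_Suc shift_obj_Suc right_unitor_sL)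

section \<open>Shift isomorphisms of degree \<open>k\<close> and the operators
  \<open>left_mult\<close> and \<open>right_mult\<close>\<close>

lemma alpha_pos_type: "src C (alpha_pos C n A) = A \<otimes>\<^sub>o shift_obj C (int n) \<U>
    \<and> tgt C (alpha_pos C n A) = shift_obj C (int n) A"
  by (induct n) (use shift_obj_Suc in \<open>simp_all add: add.commute[of 1]\<close>)

lemma alpha_neg_type: "src C (alpha_neg C n A) = A \<otimes>\<^sub>o shift_obj C (- int n) \<U>
    \<and> tgt C (alpha_neg C n A) = shift_obj C (- int n) A"
  by (induct n) (simp_all add: shift_obj_shift flip: sus_shift_pred)

lemma src_alpha_shift [simp]: "src C (alpha_shift C k A) = A \<otimes>\<^sub>o shift_obj C k \<U>"
  and tgt_alpha_shift [simp]: "tgt C (alpha_shift C k A) = shift_obj C k A"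
  using alpha_pos_type[of "nat k" A] alpha_neg_type[of "nat (- k)" A]
  by (auto simp: alpha_shift_def)

lemma alpha_shift_0 [simp]: "alpha_shift C 0 A = \<r> A"
  by (simp add: alpha_shift_def)

lemma alpha_shift_Suc:
  "alpha_shift C (k + 1) A = \<Sigma>\<^sub>m (alpha_shift C k A) \<cdot> sR A (shift_obj C k \<U>)"
  unfolding alpha_shift_def
proof (rule int_rec_step[where R = "\<lambda>k x y. y = \<Sigma>\<^sub>m x \<cdot> sR A (shift_obj C k \<U>)"])
  fix n
  show "alpha_neg C n A
      = \<Sigma>\<^sub>m (alpha_neg C (Suc n) A) \<cdot> sR A (shift_obj C (- int (Suc n)) \<U>)"
    using alpha_neg_type[of n A] by (simp add: shift_mor_shift flip: shift_mor_1)
qed simp_all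

lemma beta_pos_type: "src C (beta_pos C n A) = shift_obj C (int n) \<U> \<otimes>\<^sub>o A
    \<and> tgt C (beta_pos C n A) = A \<otimes>\<^sub>o shift_obj C (int n) \<U>"
  by (induct n) (use shift_obj_Suc in \<open>simp_all add: add.commute[of 1]\<close>)

lemma beta_neg_type: "src C (beta_neg C n A) = shift_obj C (- int n) \<U> \<otimes>\<^sub>o A
    \<and> tgt C (beta_neg C n A) = A \<otimes>\<^sub>o shift_obj C (- int n) \<U>"
  by (induct n) (simp_all add: shift_obj_shift flip: sus_shift_pred)

lemma src_beta_shift [simp]: "src C (beta_shift C k A) = shift_obj C k \<U> \<otimes>\<^sub>o A"
  and tgt_beta_shift [simp]: "tgt C (beta_shift C k A) = A \<otimes>\<^sub>o shift_obj C k \<U>"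
  using beta_pos_type[of "nat k" A] beta_neg_type[of "nat (- k)" A]
  by (auto simp: beta_shift_def)

lemma beta_shift_0 [simp]: "beta_shift C 0 A = ainv (\<r> A) \<cdot> \<l> A"
  by (simp add: beta_shift_def)

lemma beta_shift_Suc:
  "beta_shift C (k + 1) A = ainv (sR A (shift_obj C k \<U>)) \<cdot>
    \<Sigma>\<^sub>m (beta_shift C k A) \<cdot> sL (shift_obj C k \<U>) A"
  unfolding beta_shift_def
proof (rule int_rec_step[where R = "\<lambda>k x y. y = ainv (sR A (shift_obj C k \<U>)) \<cdot>
    \<Sigma>\<^sub>m x \<cdot> sL (shift_obj C k \<U>) A"])
  fix n
  show "beta_neg C n A = ainv (sR A (shift_obj C (- int (Suc n)) \<U>)) \<cdot>
      \<Sigma>\<^sub>m (beta_neg C (Suc n) A) \<cdot> sL (shift_obj C (- int (Suc n)) \<U>) A"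
    using beta_neg_type[of n A] by (simp add: shift_mor_shift flip: shift_mor_1)
qed simp_all

text \<open>Identity rungs again: both sides satisfy the recursion with step \<open>sR\<close>. This
  presents \<open>right_mult\<close> as the graded extension of
  \<open>A \<otimes> -\<close>.\<close>

lemma alpha_shift_tw: "alpha_shift C k A = shift_mor C k (\<r> A) \<cdot> left.tw A k \<U>"
  using shift_ladder[of "\<lambda>k. left.tw A k \<U>" "\<lambda>k. sR A (shift_obj C k \<U>)"
      "\<lambda>k. alpha_shift C k A" "\<lambda>k. sR A (shift_obj C k \<U>)"
      "\<lambda>k. \<I> (A \<otimes>\<^sub>o shift_obj C k \<U>)" 0 "\<r> A" k]
  by (simp add: left.tw_Suc shift_obj_Suc alpha_shift_Suc)

text \<open>The inverse of \<open>sR\<close> in the recursion for \<open>beta_shift\<close> cancels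
  the \<open>sR\<close> in that for \<open>alpha_shift\<close>, so the composite has step
  \<open>sL\<close>. Hence \<open>left_mult\<close> is the graded extension of
  \<open>- \<otimes> A\<close>.\<close>

lemma alpha_beta_shift_tw:
  "alpha_shift C k A \<cdot> beta_shift C k A = shift_mor C k (\<l> A) \<cdot> right.tw A k \<U>"
  using shift_ladder[of "\<lambda>k. right.tw A k \<U>" "\<lambda>k. sL (shift_obj C k \<U>) A"
      "\<lambda>k. alpha_shift C k A \<cdot> beta_shift C k A" "\<lambda>k. sL (shift_obj C k \<U>) A"
      "\<lambda>k. \<I> (shift_obj C k \<U> \<otimes>\<^sub>o A)" 0 "\<l> A" k]
  by (simp add: right.tw_Suc shift_obj_Suc alpha_shift_Suc beta_shift_Suc)

lemma right_mult_tw: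
  assumes "src C a = \<U>" "tgt C a = shift_obj C k \<U>"
  shows "right_mult C A k a
    = shift_mor C k (\<r> A) \<cdot> (left.tw A k \<U> \<cdot> (\<I> A \<otimes>\<^sub>m a)) \<cdot> ainv (\<r> A)"
  using assms by (simp add: right_mult_def alpha_shift_tw)

lemma left_mult_tw:
  assumes "src C a = \<U>" "tgt C a = shift_obj C k \<U>"
  shows "left_mult C A k a
    = shift_mor C k (\<l> A) \<cdot> (right.tw A k \<U> \<cdot> (a \<otimes>\<^sub>m \<I> A)) \<cdot> ainv (\<l> A)"
  using assms by (simp add: left_mult_def cmp_reassoc[OF alpha_beta_shift_tw])

lemma
  assumes "src C a = \<U>" "tgt C a = shift_obj C k \<U>"
  shows src_left_mult [simp]: "src C (left_mult C A k a) = A"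
    and tgt_left_mult [simp]: "tgt C (left_mult C A k a) = shift_obj C k A"
    and src_right_mult [simp]: "src C (right_mult C A k a) = A"
    and tgt_right_mult [simp]: "tgt C (right_mult C A k a) = shift_obj C k A"
  using assms by (simp_all add: left_mult_tw right_mult_tw)

text \<open>The arrow \<open>f\<close> slides past the unitor, past \<open>a\<close> by interchange,
  and past the shift by naturality in the fixed factor. No sign appears because \<open>f\<close> has
  degree 0.\<close>

lemma left_mult_natural:
  assumes a: "src C a = \<U>" "tgt C a = shift_obj C k \<U>"
  shows "left_mult C (tgt C f) k a \<cdot> f = shift_mor C k f \<cdot> left_mult C (src C f) k a"
proof -
  let ?A = "src C f" and ?B = "tgt C f"
  have 1: "ainv (\<l> ?B) \<cdot> f = (\<I> \<U> \<otimes>\<^sub>m f) \<cdot> ainv (\<l> ?A)"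
    by (rule inverse_natural[OF left_unitor_natural']) simp_all
  have 2: "(a \<otimes>\<^sub>m \<I> ?B) \<cdot> (\<I> \<U> \<otimes>\<^sub>m f) = (\<I> (shift_obj C k \<U>) \<otimes>\<^sub>m f) \<cdot> (a \<otimes>\<^sub>m \<I> ?A)"
    using a by (simp add: interchange)
  have 3: "shift_mor C k (\<l> ?B) \<cdot> shift_mor C k (\<I> \<U> \<otimes>\<^sub>m f) = shift_mor C k f \<cdot> shift_mor C k (\<l> ?A)"
    by (simp add: left_unitor_natural' flip: shift_cmp)
  have "left_mult C ?B k a \<cdot> f
      = shift_mor C k (\<l> ?B) \<cdot> (right.tw ?B k \<U> \<cdot> (\<I> (shift_obj C k \<U>) \<otimes>\<^sub>m f)) \<cdot>
        (a \<otimes>\<^sub>m \<I> ?A) \<cdot> ainv (\<l> ?A)"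
    using a by (simp add: left_mult_tw 1 cmp_reassoc[OF 2])
  also have "\<dots> = shift_mor C k f \<cdot> left_mult C ?A k a"
    using a by (simp add: left_mult_tw cmp_reassoc[OF 3] flip: right_tw_natural_param)
  finally show ?thesis .
qed

lemma right_mult_natural:
  assumes a: "src C a = \<U>" "tgt C a = shift_obj C k \<U>"
  shows "right_mult C (tgt C f) k a \<cdot> f = shift_mor C k f \<cdot> right_mult C (src C f) k a"
proof -
  let ?A = "src C f" and ?B = "tgt C f"
  have 1: "ainv (\<r> ?B) \<cdot> f = (f \<otimes>\<^sub>m \<I> \<U>) \<cdot> ainv (\<r> ?A)"
    by (rule inverse_natural[OF right_unitor_natural']) simp_all
  have 2: "(\<I> ?B \<otimes>\<^sub>m a) \<cdot> (f \<otimes>\<^sub>m \<I> \<U>) = (f \<otimes>\<^sub>m \<I> (shift_obj C k \<U>)) \<cdot> (\<I> ?A \<otimes>\<^sub>m a)"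
    using a by (simp add: interchange)
  have 3: "shift_mor C k (\<r> ?B) \<cdot> shift_mor C k (f \<otimes>\<^sub>m \<I> \<U>) = shift_mor C k f \<cdot> shift_mor C k (\<r> ?A)"
    by (simp add: right_unitor_natural' flip: shift_cmp)
  have "right_mult C ?B k a \<cdot> f
      = shift_mor C k (\<r> ?B) \<cdot> (left.tw ?B k \<U> \<cdot> (f \<otimes>\<^sub>m \<I> (shift_obj C k \<U>))) \<cdot>
        (\<I> ?A \<otimes>\<^sub>m a) \<cdot> ainv (\<r> ?A)"
    using a by (simp add: right_mult_tw 1 cmp_reassoc[OF 2])
  also have "\<dots> = shift_mor C k f \<cdot> right_mult C ?A k a"
    using a by (simp add: right_mult_tw cmp_reassoc[OF 3] flip: left_tw_natural_param)
  finally show ?thesis .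
qed

lemma left_mult_unit_obj:
  assumes a: "src C a = \<U>" "tgt C a = shift_obj C k \<U>"
  shows "left_mult C \<U> k a = a"
  using a by (simp add: left_mult_tw left_unitor_eq_right_unitor cmp_reassoc[OF right_tw_unit]
      cmp_reassoc[OF right_unitor_natural'])

lemma right_mult_unit_obj:
  assumes a: "src C a = \<U>" "tgt C a = shift_obj C k \<U>"
  shows "right_mult C \<U> k a = a"
  using a by (simp add: right_mult_tw cmp_reassoc[OF left_tw_unit]
      cmp_reassoc[OF left_unitor_natural'] flip: left_unitor_eq_right_unitor)

lemma left_mult_ident [simp]: "left_mult C A 0 (\<I> \<U>) = \<I> A"
  by (simp add: left_mult_tw)

lemma left_mult_add:
  assumes "src C a = \<U>" "tgt C a = shift_obj C k \<U>" "src C b = \<U>" "tgt C b = shift_obj C k \<U>"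
  shows "left_mult C A k (a +\<^sub>m b) = left_mult C A k a +\<^sub>m left_mult C A k b"
  using assms by (simp add: left_mult_tw cmp_add_left' cmp_add_right')

lemma left_mult_zero [simp]:
  "left_mult C A k (mor_zero C \<U> (shift_obj C k \<U>)) = mor_zero C A (shift_obj C k A)"
  by (simp add: left_mult_tw)

lemma left_mult_cmp:
  assumes a: "src C a = \<U>" "tgt C a = shift_obj C k \<U>"
    and b: "src C b = \<U>" "tgt C b = shift_obj C l \<U>"
  shows "shift_mor C k (left_mult C A l b) \<cdot> left_mult C A k a
    = left_mult C A (k + l) (shift_mor C k b \<cdot> a)"
proof -
  have iso: "shift_mor C k (ainv (\<l> A)) \<cdot> shift_mor C k (\<l> A) = \<I> (shift_obj C k (\<U> \<otimes>\<^sub>o A))"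
    by (simp flip: shift_cmp)
  have "shift_mor C k (left_mult C A l b) \<cdot> left_mult C A k a
      = shift_mor C k (shift_mor C l (\<l> A)) \<cdot> (shift_mor C k (right.tw A l \<U> \<cdot> (b \<otimes>\<^sub>m \<I> A)) \<cdot>
        (right.tw A k (src C b) \<cdot> (a \<otimes>\<^sub>m \<I> A))) \<cdot> ainv (\<l> A)"
    using a b by (simp add: left_mult_tw cmp_reassoc[OF iso])
  also have "\<dots> = left_mult C A (k + l) (shift_mor C k b \<cdot> a)"
    unfolding right.tw_cmp[OF a(2)[folded b(1)] b(2)]
    using a b by (simp add: left_mult_tw shift_mor_shift shift_obj_shift)
  finally show ?thesis .
qed

end


section \<open>Categorical idempotents\<close>

context category
begin

text \<open>For a functor T, \<phi> is a natural isomorphism from T to the identity on the full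
  subcategory of local objects, those admitting some isomorphism T A \<cong> A. Elsewhere \<phi> is
  unconstrained.\<close>

definition absorbing :: "('o \<Rightarrow> 'o) \<Rightarrow> ('m \<Rightarrow> 'm) \<Rightarrow> bool" where
  "absorbing To Tm \<longleftrightarrow> (\<exists>\<phi>.
    (\<forall>A. isomorphic C (To A) A \<longrightarrow> src C (\<phi> A) = To A \<and> tgt C (\<phi> A) = A \<and> is_iso C (\<phi> A)) \<and>
    (\<forall>f. isomorphic C (To (src C f)) (src C f) \<longrightarrow> isomorphic C (To (tgt C f)) (tgt C f) \<longrightarrow>
      \<phi> (tgt C f) \<cdot> Tm f = f \<cdot> \<phi> (src C f)))"

text \<open>Through \<open>t\<close>, every object local for T' is local for T, so \<phi> can be
  composed with \<open>t\<close> there.\<close>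

lemma absorbing_transfer:
  assumes abs: "absorbing To Tm"
    and T: "\<And>f. src C (Tm f) = To (src C f)" "\<And>f. tgt C (Tm f) = To (tgt C f)"
    and T': "\<And>f. src C (Tm' f) = To' (src C f)" "\<And>f. tgt C (Tm' f) = To' (tgt C f)"
    and t: "\<And>A. isomorphic C (To' A) A \<Longrightarrow>
      src C (t A) = To' A \<and> tgt C (t A) = To A \<and> is_iso C (t A)"
    and nat: "\<And>f. \<lbrakk>isomorphic C (To' (src C f)) (src C f); isomorphic C (To' (tgt C f)) (tgt C f)\<rbrakk>
      \<Longrightarrow> t (tgt C f) \<cdot> Tm' f = Tm f \<cdot> t (src C f)"
  shows "absorbing To' Tm'"
proof -
  obtain \<phi> where \<phi>: "\<And>A. isomorphic C (To A) A \<Longrightarrow>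
      src C (\<phi> A) = To A \<and> tgt C (\<phi> A) = A \<and> is_iso C (\<phi> A)"
    and \<phi>_nat: "\<And>f. \<lbrakk>isomorphic C (To (src C f)) (src C f); isomorphic C (To (tgt C f)) (tgt C f)\<rbrakk>
      \<Longrightarrow> \<phi> (tgt C f) \<cdot> Tm f = f \<cdot> \<phi> (src C f)"
    using abs unfolding absorbing_def by blast
  have loc: "isomorphic C (To A) A" if "isomorphic C (To' A) A" for A
    using that t[OF that] isomorphicI isomorphic_sym isomorphic_trans by metis
  have "\<phi> (tgt C f) \<cdot> t (tgt C f) \<cdot> Tm' f = f \<cdot> \<phi> (src C f) \<cdot> t (src C f)"
    if f: "isomorphic C (To' (src C f)) (src C f)" "isomorphic C (To' (tgt C f)) (tgt C f)" for f
    unfolding nat[OF f] using cmp_reassoc[OF \<phi>_nat[OF loc[OF f(1)] loc[OF f(2)]]]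
      t[OF f(1)] \<phi>[OF loc[OF f(1)]] \<phi>[OF loc[OF f(2)]] T[of f] by simp
  then show ?thesis
    unfolding absorbing_def using loc t \<phi> T'
    by (intro exI[of _ "\<lambda>A. \<phi> A \<cdot> t A"]) simp
qed

lemma absorbing_faithful:
  assumes "absorbing To Tm" "Tm f = Tm g" "src C f = src C g" "tgt C f = tgt C g"
    and "isomorphic C (To (src C f)) (src C f)" "isomorphic C (To (tgt C f)) (tgt C f)"
  shows "f = g"
  using assms unfolding absorbing_def by (metis iso_cancel_right)

text \<open>On local objects T is isomorphic to the identity; conjugating \<open>h\<close> by \<phi>
  gives the preimage.\<close>

lemma absorbing_full:
  assumes abs: "absorbing To Tm"
    and T: "\<And>f. src C (Tm f) = To (src C f)" "\<And>f. tgt C (Tm f) = To (tgt C f)"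
    and A: "isomorphic C (To A) A" and B: "isomorphic C (To B) B"
    and h: "src C h = To A" "tgt C h = To B"
  obtains f where "src C f = A" "tgt C f = B" "Tm f = h"
proof -
  obtain \<phi> where \<phi>: "\<And>A. isomorphic C (To A) A \<Longrightarrow>
      src C (\<phi> A) = To A \<and> tgt C (\<phi> A) = A \<and> is_iso C (\<phi> A)"
    and \<phi>_nat: "\<And>f. \<lbrakk>isomorphic C (To (src C f)) (src C f); isomorphic C (To (tgt C f)) (tgt C f)\<rbrakk>
      \<Longrightarrow> \<phi> (tgt C f) \<cdot> Tm f = f \<cdot> \<phi> (src C f)"
    using abs unfolding absorbing_def by blast
  define f where "f = \<phi> B \<cdot> h \<cdot> inverse_arrow C (\<phi> A)"
  have f: "src C f = A" "tgt C f = B" and "f \<cdot> \<phi> A = \<phi> B \<cdot> h"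
    using \<phi>[OF A] \<phi>[OF B] h by (simp_all add: f_def)
  then have "\<phi> B \<cdot> Tm f = \<phi> B \<cdot> h" using \<phi>_nat[of f] A B by simp
  then have "Tm f = h"
    by (rule iso_cancel_left[rotated]) (use \<phi>[OF B] f h T in simp_all)
  then show ?thesis using that f by blast
qed

end

context monoidal_category
begin

text \<open>An object isomorphic to \<open>E \<otimes> A\<close> inherits invertibility:
  \<open>m \<otimes> A\<close> is conjugate, by the associator and that isomorphism, to
  \<open>(m \<otimes> E) \<otimes> A\<close>.\<close>

lemma is_iso_tensor_local:
  assumes m: "is_iso C (m \<otimes>\<^sub>m \<I> E)" and A: "isomorphic C (E \<otimes>\<^sub>o A) A"
  shows "is_iso C (m \<otimes>\<^sub>m \<I> A)"
proof -
  obtain f where f: "src C f = E \<otimes>\<^sub>o A" "tgt C f = A" "is_iso C f"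
    using A by (auto simp: isomorphic_def Hom_iff)
  have "m \<otimes>\<^sub>m \<I> (E \<otimes>\<^sub>o A)
      = \<a> (tgt C m) E A \<cdot> ((m \<otimes>\<^sub>m \<I> E) \<otimes>\<^sub>m \<I> A) \<cdot> ainv (\<a> (src C m) E A)"
    by (simp add: cmp_reassoc[OF associator_natural'])
  then have iso: "is_iso C (m \<otimes>\<^sub>m \<I> (E \<otimes>\<^sub>o A))" using m by simp
  have "m \<otimes>\<^sub>m \<I> A
      = (\<I> (tgt C m) \<otimes>\<^sub>m f) \<cdot> (m \<otimes>\<^sub>m \<I> (E \<otimes>\<^sub>o A)) \<cdot> (\<I> (src C m) \<otimes>\<^sub>m ainv f)"
    using f by (simp add: tensor_cmp')
  then show ?thesis using f iso by simp
qed

lemma is_iso_local_tensor: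
  assumes m: "is_iso C (\<I> E \<otimes>\<^sub>m m)" and A: "isomorphic C (A \<otimes>\<^sub>o E) A"
  shows "is_iso C (\<I> A \<otimes>\<^sub>m m)"
proof -
  obtain f where f: "src C f = A \<otimes>\<^sub>o E" "tgt C f = A" "is_iso C f"
    using A by (auto simp: isomorphic_def Hom_iff)
  have "\<I> (A \<otimes>\<^sub>o E) \<otimes>\<^sub>m m
      = ainv (\<a> A E (tgt C m)) \<cdot> (\<I> A \<otimes>\<^sub>m (\<I> E \<otimes>\<^sub>m m)) \<cdot> \<a> A E (src C m)"
    by (simp add: cmp_reassoc[OF inverse_associator_natural])
  then have iso: "is_iso C (\<I> (A \<otimes>\<^sub>o E) \<otimes>\<^sub>m m)" using m by simp
  have "\<I> A \<otimes>\<^sub>m m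
      = (f \<otimes>\<^sub>m \<I> (tgt C m)) \<cdot> (\<I> (A \<otimes>\<^sub>o E) \<otimes>\<^sub>m m) \<cdot> (ainv f \<otimes>\<^sub>m \<I> (src C m))"
    using f by (simp add: tensor_cmp')
  then show ?thesis using f iso by simp
qed

definition left_absorbing :: "'o \<Rightarrow> bool" where
  "left_absorbing E \<longleftrightarrow> absorbing (\<lambda>A. E \<otimes>\<^sub>o A) (\<lambda>f. \<I> E \<otimes>\<^sub>m f)"

definition right_absorbing :: "'o \<Rightarrow> bool" where
  "right_absorbing E \<longleftrightarrow> absorbing (\<lambda>A. A \<otimes>\<^sub>o E) (\<lambda>f. f \<otimes>\<^sub>m \<I> E)"

lemma left_absorbing_unit: "left_absorbing \<U>"
  unfolding left_absorbing_def absorbing_def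
  by (rule exI[of _ "\<l>"]) (simp add: left_unitor_natural')

lemma right_absorbing_unit: "right_absorbing \<U>"
  unfolding right_absorbing_def absorbing_def
  by (rule exI[of _ "\<r>"]) (simp add: right_unitor_natural')

text \<open>The transfer map must go from \<open>E' \<otimes> A\<close> to
  \<open>E \<otimes> A\<close>. A unital \<open>m\<close> points the other way, so inverses are
  used; in the counital case \<open>m \<otimes> A\<close> itself serves.\<close>

lemma left_absorbing_unital:
  assumes "left_absorbing E" and m: "src C m = E" "tgt C m = E'" "is_iso C (m \<otimes>\<^sub>m \<I> E')"
  shows "left_absorbing E'"
  unfolding left_absorbing_def
proof (rule absorbing_transfer[OF assms(1)[unfolded left_absorbing_def]])
  fix f
  assume f: "isomorphic C (E' \<otimes>\<^sub>o src C f) (src C f)" "isomorphic C (E' \<otimes>\<^sub>o tgt C f) (tgt C f)"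
  show "ainv (m \<otimes>\<^sub>m \<I> (tgt C f)) \<cdot> (\<I> E' \<otimes>\<^sub>m f) = (\<I> E \<otimes>\<^sub>m f) \<cdot> ainv (m \<otimes>\<^sub>m \<I> (src C f))"
    by (rule inverse_natural) (simp_all add: m interchange is_iso_tensor_local[OF m(3)] f)
qed (simp_all add: m is_iso_tensor_local[OF m(3)])

lemma left_absorbing_counital:
  assumes "left_absorbing E" and m: "src C m = E'" "tgt C m = E" "is_iso C (m \<otimes>\<^sub>m \<I> E')"
  shows "left_absorbing E'"
  unfolding left_absorbing_def
  by (rule absorbing_transfer[OF assms(1)[unfolded left_absorbing_def],
        where t = "\<lambda>A. m \<otimes>\<^sub>m \<I> A"])
    (simp_all add: m is_iso_tensor_local[OF m(3)] interchange)

lemma right_absorbing_unital: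
  assumes "right_absorbing E" and m: "src C m = E" "tgt C m = E'" "is_iso C (\<I> E' \<otimes>\<^sub>m m)"
  shows "right_absorbing E'"
  unfolding right_absorbing_def
proof (rule absorbing_transfer[OF assms(1)[unfolded right_absorbing_def]])
  fix f
  assume f: "isomorphic C (src C f \<otimes>\<^sub>o E') (src C f)" "isomorphic C (tgt C f \<otimes>\<^sub>o E') (tgt C f)"
  show "ainv (\<I> (tgt C f) \<otimes>\<^sub>m m) \<cdot> (f \<otimes>\<^sub>m \<I> E') = (f \<otimes>\<^sub>m \<I> E) \<cdot> ainv (\<I> (src C f) \<otimes>\<^sub>m m)"
    by (rule inverse_natural) (simp_all add: m interchange is_iso_local_tensor[OF m(3)] f)
qed (simp_all add: m is_iso_local_tensor[OF m(3)])

lemma right_absorbing_counital: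
  assumes "right_absorbing E" and m: "src C m = E'" "tgt C m = E" "is_iso C (\<I> E' \<otimes>\<^sub>m m)"
  shows "right_absorbing E'"
  unfolding right_absorbing_def
  by (rule absorbing_transfer[OF assms(1)[unfolded right_absorbing_def],
        where t = "\<lambda>A. \<I> A \<otimes>\<^sub>m m"])
    (simp_all add: m is_iso_local_tensor[OF m(3)] interchange)

end

section \<open>The chain of idempotents\<close>

context triangulated_monoidal_category
begin

lemma isomorphic_shift:
  assumes "isomorphic C A B"
  shows "isomorphic C (shift_obj C k A) (shift_obj C k B)"
proof -
  obtain f where "src C f = A" "tgt C f = B" "is_iso C f"
    using assms by (auto simp: isomorphic_def Hom_iff)
  then show ?thesis by (intro isomorphicI[of "shift_mor C k f"]) simp_all
qed

text \<open>Graded endomorphisms of \<open>E\<close> end at shifts of \<open>E\<close>, so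
  faithfulness and fullness require these shifts to be local too.\<close>

lemma left_local_shift:
  "isomorphic C (E \<otimes>\<^sub>o A) A \<Longrightarrow> isomorphic C (E \<otimes>\<^sub>o shift_obj C k A) (shift_obj C k A)"
  by (rule isomorphic_trans[OF isomorphicI[of "left.tw E k A"] isomorphic_shift]) simp_all

lemma right_local_shift:
  "isomorphic C (A \<otimes>\<^sub>o E) A \<Longrightarrow> isomorphic C (shift_obj C k A \<otimes>\<^sub>o E) (shift_obj C k A)"
  by (rule isomorphic_trans[OF isomorphicI[of "right.tw E k A"] isomorphic_shift]) simp_all

lemma left_absorbing_cancel:
  assumes E: "left_absorbing E" "isomorphic C (E \<otimes>\<^sub>o E) E"
    and g: "src C g = E" "src C g' = E" "tgt C g = shift_obj C k E" "tgt C g' = shift_obj C k E"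
    and eq: "\<I> E \<otimes>\<^sub>m g = \<I> E \<otimes>\<^sub>m g'"
  shows "g = g'"
  by (rule absorbing_faithful[OF E(1)[unfolded left_absorbing_def] eq])
    (simp_all add: g E left_local_shift)

text \<open>By naturality the two operators at \<open>E'\<close> agree after precomposition with
  \<open>m\<close>. Tensoring with \<open>E'\<close> makes \<open>m\<close> cancellable, and
  faithfulness removes the tensor factor again.\<close>

lemma left_mult_right_mult_unital:
  assumes E': "left_absorbing E'" "isomorphic C (E' \<otimes>\<^sub>o E') E'"
    and m: "src C m = E" "tgt C m = E'" "is_iso C (\<I> E' \<otimes>\<^sub>m m)"
    and a: "src C a = \<U>" "tgt C a = shift_obj C k \<U>"
    and eq: "right_mult C E k a = left_mult C E k a"
  shows "right_mult C E' k a = left_mult C E' k a"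
proof (rule left_absorbing_cancel[OF E'])
  have "right_mult C E' k a \<cdot> m = left_mult C E' k a \<cdot> m"
    using left_mult_natural[OF a, of m] right_mult_natural[OF a, of m] m eq by simp
  then have "\<I> E' \<otimes>\<^sub>m (right_mult C E' k a \<cdot> m) = \<I> E' \<otimes>\<^sub>m (left_mult C E' k a \<cdot> m)" by simp
  then show "\<I> E' \<otimes>\<^sub>m right_mult C E' k a = \<I> E' \<otimes>\<^sub>m left_mult C E' k a"
    by - (rule iso_cancel_right[OF m(3)], simp_all add: a m)
qed (simp_all add: a)

text \<open>Now \<open>m\<close> starts at \<open>E'\<close>, so the operators agree after
  postcomposition with the shift of \<open>m\<close>. That shift also becomes invertible under
  \<open>E' \<otimes> -\<close>, by conjugation with \<open>tw\<close>.\<close>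

lemma left_mult_right_mult_counital:
  assumes E': "left_absorbing E'" "isomorphic C (E' \<otimes>\<^sub>o E') E'"
    and m: "src C m = E'" "tgt C m = E" "is_iso C (\<I> E' \<otimes>\<^sub>m m)"
    and a: "src C a = \<U>" "tgt C a = shift_obj C k \<U>"
    and eq: "right_mult C E k a = left_mult C E k a"
  shows "right_mult C E' k a = left_mult C E' k a"
proof (rule left_absorbing_cancel[OF E'])
  have "\<I> E' \<otimes>\<^sub>m shift_mor C k m
      = ainv (left.tw E' k E) \<cdot> shift_mor C k (\<I> E' \<otimes>\<^sub>m m) \<cdot> left.tw E' k E'"
    using left.tw_natural[of k E' m] m by simp
  then have iso: "is_iso C (\<I> E' \<otimes>\<^sub>m shift_mor C k m)" using m by simp
  have "shift_mor C k m \<cdot> right_mult C E' k a = shift_mor C k m \<cdot> left_mult C E' k a"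
    using left_mult_natural[OF a, of m] right_mult_natural[OF a, of m] m eq by simp
  then have "\<I> E' \<otimes>\<^sub>m (shift_mor C k m \<cdot> right_mult C E' k a)
      = \<I> E' \<otimes>\<^sub>m (shift_mor C k m \<cdot> left_mult C E' k a)" by simp
  then show "\<I> E' \<otimes>\<^sub>m right_mult C E' k a = \<I> E' \<otimes>\<^sub>m left_mult C E' k a"
    by - (rule iso_cancel_left[OF iso], simp_all add: a m)
qed (simp_all add: a)

lemma absorbing_supercommute:
  assumes E: "left_absorbing E" "right_absorbing E" "isomorphic C (E \<otimes>\<^sub>o E) E"
    and f: "src C f = E" "tgt C f = shift_obj C k E"
    and g: "src C g = E" "tgt C g = shift_obj C l E"
  shows "shift_mor C l f \<cdot> g = mor_sign (k * l) (shift_mor C k g \<cdot> f)"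
proof -
  \<comment> \<open>A single arbitrary \<open>t\<close> transports both \<open>f\<close> and
    \<open>g\<close> to \<open>E \<otimes> E\<close>. It has degree 0, so conjugation by it creates
    no sign and is undone at the end.\<close>
  obtain t where t: "src C t = E \<otimes>\<^sub>o E" "tgt C t = E" "is_iso C t"
    using E(3) by (auto simp: isomorphic_def Hom_iff)
  have iso: "shift_mor C j t \<cdot> (shift_mor C j (ainv t) \<cdot> x) = x"
    if "tgt C x = shift_obj C j E" for x j
    using cmp_reassoc[OF shift_cmp[symmetric, of t "ainv t" j], of x] t that by simp
  define hf where "hf = shift_mor C k (ainv t) \<cdot> f \<cdot> t"
  define hg where "hg = shift_mor C l (ainv t) \<cdot> g \<cdot> t"
  have hf: "src C hf = E \<otimes>\<^sub>o E" "tgt C hf = shift_obj C k (E \<otimes>\<^sub>o E)"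
    and hg: "src C hg = E \<otimes>\<^sub>o E" "tgt C hg = shift_obj C l (E \<otimes>\<^sub>o E)"
    using t f g by (simp_all add: hf_def hg_def)
  obtain f' where f': "src C f' = E" "tgt C f' = shift_obj C k E"
      "f' \<otimes>\<^sub>m \<I> E = ainv (right.tw E k E) \<cdot> hf"
    by (rule absorbing_full[OF E(2)[unfolded right_absorbing_def], of E "shift_obj C k E"
          "ainv (right.tw E k E) \<cdot> hf"]) (simp_all add: E right_local_shift hf)
  obtain g' where g': "src C g' = E" "tgt C g' = shift_obj C l E"
      "\<I> E \<otimes>\<^sub>m g' = ainv (left.tw E l E) \<cdot> hg"
    by (rule absorbing_full[OF E(1)[unfolded left_absorbing_def], of E "shift_obj C l E"
          "ainv (left.tw E l E) \<cdot> hg"]) (simp_all add: E left_local_shift hg)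
  have "hf = right.tw E k E \<cdot> (f' \<otimes>\<^sub>m \<I> E)" "hg = left.tw E l E \<cdot> (\<I> E \<otimes>\<^sub>m g')"
    using f' g' hf hg by simp_all
  then have "shift_mor C l hf \<cdot> hg = mor_sign (k * l) (shift_mor C k hg \<cdot> hf)"
    using left_right_supercommute[OF f'(1,2) g'(1,2)] by simp
  then have "shift_mor C (k + l) (ainv t) \<cdot> (shift_mor C l f \<cdot> g) \<cdot> t
      = shift_mor C (k + l) (ainv t) \<cdot> mor_sign (k * l) (shift_mor C k g \<cdot> f) \<cdot> t"
    using t f g by (simp add: hf_def hg_def iso shift_mor_shift shift_obj_shift add.commute)
  then have "(shift_mor C l f \<cdot> g) \<cdot> t = mor_sign (k * l) (shift_mor C k g \<cdot> f) \<cdot> t"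
    by (rule iso_cancel_left[rotated])
      (use t f g in \<open>simp_all add: shift_mor_shift shift_obj_shift add.commute\<close>)
  then show ?thesis
    by (rule iso_cancel_right[rotated])
      (use t f g in \<open>simp_all add: shift_mor_shift shift_obj_shift add.commute\<close>)
qed

text \<open>These properties climb the chain together: equality of the operators at
  \<open>E'\<close> rests on faithfulness of \<open>E' \<otimes> -\<close>, which in turn needs
  absorption and locality of \<open>E'\<close> itself.\<close>

lemma unital_or_counital_step:
  assumes E: "left_absorbing E" "right_absorbing E"
      "\<And>k a. src C a = \<U> \<Longrightarrow> tgt C a = shift_obj C k \<U> \<Longrightarrow>
        right_mult C E k a = left_mult C E k a"
    and m: "unital_idempotent C E E' m \<or> counital_idempotent C E E' m"
  shows "left_absorbing E' \<and> right_absorbing E' \<and> isomorphic C (E' \<otimes>\<^sub>o E') E' \<and>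
    (\<forall>k a. src C a = \<U> \<longrightarrow> tgt C a = shift_obj C k \<U> \<longrightarrow>
      right_mult C E' k a = left_mult C E' k a)"
proof -
  have corner: "isomorphic C (E \<otimes>\<^sub>o E') E'"
    using m by (auto simp: unital_idempotent_def counital_idempotent_def corner_def)
  have iso: "is_iso C (m \<otimes>\<^sub>m \<I> E')" "is_iso C (\<I> E' \<otimes>\<^sub>m m)"
    using m by (auto simp: unital_idempotent_def counital_idempotent_def)
  from m consider "src C m = E" "tgt C m = E'" | "src C m = E'" "tgt C m = E"
    by (auto simp: unital_idempotent_def counital_idempotent_def Hom_iff)
  then show ?thesis
  proof cases
    case 1
    \<comment> \<open>Membership in the corner gives \<open>E \<otimes> E' \<cong> E'\<close>, and
      \<open>m \<otimes> E'\<close> replaces the factor \<open>E\<close> by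
      \<open>E'\<close>.\<close>
    have EE: "isomorphic C (E' \<otimes>\<^sub>o E') E'"
      by (rule isomorphic_trans[OF isomorphic_sym corner], rule isomorphicI[OF iso(1)])
        (simp_all add: 1)
    show ?thesis
      using left_absorbing_unital[OF E(1) 1 iso(1)] right_absorbing_unital[OF E(2) 1 iso(2)]
        left_mult_right_mult_unital[OF _ EE 1 iso(2) _ _ E(3)] EE by blast
  next
    case 2
    have EE: "isomorphic C (E' \<otimes>\<^sub>o E') E'"
      by (rule isomorphic_trans[OF _ corner], rule isomorphicI[OF iso(1)]) (simp_all add: 2)
    show ?thesis
      using left_absorbing_counital[OF E(1) 2 iso(1)] right_absorbing_counital[OF E(2) 2 iso(2)]
        left_mult_right_mult_counital[OF _ EE 2 iso(2) _ _ E(3)] EE by blast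
  qed
qed

lemma categorical_idempotent_absorbing:
  assumes "categorical_idempotent C E"
  shows "left_absorbing E \<and> right_absorbing E \<and> isomorphic C (E \<otimes>\<^sub>o E) E \<and>
    (\<forall>k a. src C a = \<U> \<longrightarrow> tgt C a = shift_obj C k \<U> \<longrightarrow>
      right_mult C E k a = left_mult C E k a)" (is "?P E")
proof -
  obtain r :: nat and F where F: "F 0 = \<U>" "F r = E"
    and chain: "\<And>i. i \<in> {1..r} \<Longrightarrow> (\<exists>\<eta>. unital_idempotent C (F (i - 1)) (F i) \<eta>) \<or>
      (\<exists>\<epsilon>. counital_idempotent C (F (i - 1)) (F i) \<epsilon>)"
    using assms unfolding categorical_idempotent_def by blast
  have "i \<le> r \<Longrightarrow> ?P (F i)" for i
  proof (induct i)
    case 0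
    show ?case unfolding F
      by (simp add: left_absorbing_unit right_absorbing_unit left_mult_unit_obj right_mult_unit_obj
          isomorphicI[OF left_unitor_iso])
  next
    case (Suc i)
    then obtain m where "unital_idempotent C (F i) (F (Suc i)) m \<or>
        counital_idempotent C (F i) (F (Suc i)) m"
      using chain[of "Suc i"] by auto
    then show ?case using unital_or_counital_step[of "F i"] Suc by simp
  qed
  then show ?thesis using F by blast
qed

lemma categorical_idempotent_unit: "categorical_idempotent C \<U>"
  unfolding categorical_idempotent_def
  by (intro exI[of _ "0::nat"] exI[of _ "\<lambda>_. \<U>"]) simp

end


section \<open>The graded endomorphism ring\<close>

lemma (in comm_monoid) finprod_swap:
  assumes "finite I" "finite J" "\<And>i j. i \<in> I \<Longrightarrow> j \<in> J \<Longrightarrow> f i j \<in> carrier G"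
  shows "(\<Otimes>i\<in>I. \<Otimes>j\<in>J. f i j) = (\<Otimes>j\<in>J. \<Otimes>i\<in>I. f i j)"
  using assms(1,3)
proof (induct I)
  case empty
  then show ?case by simp
next
  case (insert a I)
  have "(\<Otimes>i\<in>insert a I. \<Otimes>j\<in>J. f i j) = (\<Otimes>j\<in>J. f a j) \<otimes> (\<Otimes>j\<in>J. \<Otimes>i\<in>I. f i j)"
    using insert by (subst finprod_insert) (auto intro!: finprod_closed)
  also have "\<dots> = (\<Otimes>j\<in>J. f a j \<otimes> (\<Otimes>i\<in>I. f i j))"
    using insert by (intro finprod_multf[symmetric]) (auto intro!: finprod_closed)
  also have "\<dots> = (\<Otimes>j\<in>J. \<Otimes>i\<in>insert a I. f i j)"
    using insert by (intro finprod_cong') (auto intro!: finprod_closed finprod_insert[symmetric])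
  finally show ?case .
qed

lemma graded_ring_homogeneous_carrier: "graded_ring R H \<Longrightarrow> H k \<subseteq> carrier R"
  unfolding graded_ring_def by (metis subgroup.subset partial_object.select_convs(1))

text \<open>Graded commutativity makes every homogeneous component graded central, and each element
  is the finite sum of its components.\<close>

lemma graded_commutative_center:
  assumes "graded_ring R H" "graded_commutative R H"
  shows "carrier R \<subseteq> graded_center R H"
proof
  fix x assume "x \<in> carrier R"
  interpret ring R using assms(1) by (simp add: graded_ring_def)
  obtain c where c: "\<And>k. c k \<in> H k" and fin: "finite {k. c k \<noteq> \<zero>\<^bsub>R\<^esub>}"
    and x: "x = (\<Oplus>\<^bsub>R\<^esub>k \<in> {k. c k \<noteq> \<zero>\<^bsub>R\<^esub>}. c k)"
    using assms(1) \<open>x \<in> carrier R\<close> unfolding graded_ring_def by blast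
  have cR: "c k \<in> carrier R" for k
    using c graded_ring_homogeneous_carrier[OF assms(1)] by blast
  let ?Z = "\<Union>k. {z \<in> H k. \<forall>l. \<forall>x \<in> H l. z \<otimes>\<^bsub>R\<^esub> x = koszul_sign R (k * l) (x \<otimes>\<^bsub>R\<^esub> z)}"
  have hom: "c k \<in> ?Z" for k
    using assms(2) c unfolding graded_commutative_def by blast
  have "(\<Oplus>\<^bsub>R\<^esub>k \<in> K. c k) \<in> generate (add_monoid R) ?Z" if "finite K" for K
    using that
  proof (induct K)
    case empty
    show ?case using generate.one[of "add_monoid R"] by simp
  next
    case (insert a K)
    then show ?case
      using generate.eng[OF generate.incl[OF hom] insert(3)] cR by simp
  qed
  then show "x \<in> graded_center R H"
    unfolding x graded_center_def using fin .
qed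

text \<open>The left and right unit maps are compared only on the carrier, so the structure is
  transferred along equality there.\<close>

lemma graded_algebra_cong:
  assumes "graded_algebra K HK R HR \<phi>" and eq: "\<And>x. x \<in> carrier K \<Longrightarrow> \<psi> x = \<phi> x"
  shows "graded_algebra K HK R HR \<psi>"
proof -
  have gr: "graded_ring K HK" using assms(1) by (simp add: graded_algebra_def)
  then interpret ring K by (simp add: graded_ring_def)
  have "\<psi> \<in> ring_hom K R"
    using assms by (auto simp: graded_algebra_def ring_hom_def)
  moreover have "\<psi> ` HK k = \<phi> ` HK k" for k
    using graded_ring_homogeneous_carrier[OF gr] eq by (intro image_cong) auto
  moreover have "\<psi> ` carrier K = \<phi> ` carrier K" using eq by (intro image_cong) auto
  ultimately show ?thesis using assms(1) by (simp add: graded_algebra_def)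
qed

section \<open>Finite sums of arrows\<close>

context additive_category
begin

lemma finprod_Hom_closed:
  assumes "\<And>k. k \<in> K \<Longrightarrow> f k \<in> Hom C X Y"
  shows "finprod (Hom_group C X Y) f K \<in> Hom C X Y"
proof -
  interpret comm_group "Hom_group C X Y" by (rule Hom_group)
  show ?thesis using finprod_closed[of f K] assms by auto
qed

lemma finprod_Hom_hom:
  assumes h: "\<And>f. f \<in> Hom C X Y \<Longrightarrow> h f \<in> Hom C X' Y'"
    and add: "\<And>f g. f \<in> Hom C X Y \<Longrightarrow> g \<in> Hom C X Y \<Longrightarrow> h (f +\<^sub>m g) = h f +\<^sub>m h g"
    and f: "\<And>k. k \<in> K \<Longrightarrow> f k \<in> Hom C X Y"
  shows "h (finprod (Hom_group C X Y) f K) = finprod (Hom_group C X' Y') (\<lambda>k. h (f k)) K"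
proof -
  interpret G: comm_group "Hom_group C X Y" by (rule Hom_group)
  interpret G': comm_group "Hom_group C X' Y'" by (rule Hom_group)
  have zero: "h (mor_zero C X Y) = mor_zero C X' Y'"
    using add[of "mor_zero C X Y" "mor_zero C X Y"] h[of "mor_zero C X Y"]
      add_idem_zero[of "h (mor_zero C X Y)"] by (simp add: Hom_iff)
  show ?thesis using f
  \<comment> \<open>For infinite \<open>K\<close> both \<open>finprod\<close> values default to the
    zero arrow, so preservation of zero settles that case.\<close>
  proof (induct K rule: infinite_finite_induct)
    case (insert a K)
    have "finprod (Hom_group C X Y) f (insert a K) = f a +\<^sub>m finprod (Hom_group C X Y) f K"
      using insert by (subst G.finprod_insert) auto
    moreover have "finprod (Hom_group C X' Y') (\<lambda>k. h (f k)) (insert a K)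
        = h (f a) +\<^sub>m finprod (Hom_group C X' Y') (\<lambda>k. h (f k)) K"
      using insert h by (subst G'.finprod_insert) auto
    moreover have "finprod (Hom_group C X Y) f K \<in> Hom C X Y"
      using insert by (intro finprod_Hom_closed) simp
    ultimately show ?case using insert add by simp
  qed (use zero in simp_all)
qed

end

section \<open>Ring structure and grading on families of arrows\<close>

context triangulated_monoidal_category
begin

lemma end_ring_sel:
  "carrier (end_ring C A) = {x. (\<forall>k. x k \<in> Hom C A (shift_obj C k A)) \<and> finite (end_supp C A x)}"
  "\<zero>\<^bsub>end_ring C A\<^esub> = (\<lambda>k. mor_zero C A (shift_obj C k A))"
  "\<one>\<^bsub>end_ring C A\<^esub> = (\<lambda>k. if k = 0 then ident C A else mor_zero C A (shift_obj C k A))"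
  "x \<oplus>\<^bsub>end_ring C A\<^esub> y = (\<lambda>k. x k +\<^sub>m y k)"
  by (simp_all add: end_ring_def)

lemma end_carrier_type:
  assumes "x \<in> carrier (end_ring C A)"
  shows "src C (x k) = A" "tgt C (x k) = shift_obj C k A"
  using assms by (simp_all add: end_ring_sel Hom_iff)

lemma end_carrier_finite: "x \<in> carrier (end_ring C A) \<Longrightarrow> finite (end_supp C A x)"
  by (simp add: end_ring_sel)

lemma end_carrierI:
  assumes "\<And>k. src C (x k) = A" "\<And>k. tgt C (x k) = shift_obj C k A"
    and "finite K" "\<And>k. k \<notin> K \<Longrightarrow> x k = mor_zero C A (shift_obj C k A)"
  shows "x \<in> carrier (end_ring C A)"
proof -
  have "end_supp C A x \<subseteq> K" using assms(4) by (auto simp: end_supp_def)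
  then show ?thesis using assms by (simp add: end_ring_sel Hom_iff finite_subset)
qed

lemma not_in_end_supp: "k \<notin> end_supp C A x \<Longrightarrow> x k = mor_zero C A (shift_obj C k A)"
  by (simp add: end_supp_def)

lemma end_supp_subsetI:
  "(\<And>k. k \<notin> K \<Longrightarrow> x k = mor_zero C A (shift_obj C k A)) \<Longrightarrow> end_supp C A x \<subseteq> K"
  by (auto simp: end_supp_def)

lemma end_term_type:
  assumes "x \<in> carrier (end_ring C A)" "y \<in> carrier (end_ring C A)"
  shows "shift_mor C k (y (n - k)) \<cdot> x k \<in> Hom C A (shift_obj C n A)"
  using assms by (simp add: Hom_iff end_carrier_type shift_obj_shift)

text \<open>Summing over any finite set containing the support lets products with different supports
  be compared over a common index set.\<close>

lemma end_mult:
  assumes x: "x \<in> carrier (end_ring C A)" and y: "y \<in> carrier (end_ring C A)"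
    and K: "finite K" "end_supp C A x \<subseteq> K"
  shows "(y \<otimes>\<^bsub>end_ring C A\<^esub> x) n
    = finprod (Hom_group C A (shift_obj C n A)) (\<lambda>k. shift_mor C k (y (n - k)) \<cdot> x k) K"
proof -
  interpret comm_group "Hom_group C A (shift_obj C n A)" by (rule Hom_group)
  have "finprod (Hom_group C A (shift_obj C n A)) (\<lambda>k. shift_mor C k (y (n - k)) \<cdot> x k) (end_supp C A x)
      = finprod (Hom_group C A (shift_obj C n A)) (\<lambda>k. shift_mor C k (y (n - k)) \<cdot> x k) K"
    using end_term_type[OF x y] K
    by (intro finprod_mono_neutral_cong_left)
      (auto simp: not_in_end_supp end_carrier_type[OF y] shift_obj_shift)
  then show ?thesis by (simp add: end_ring_def)
qed

lemma end_mult_closed: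
  assumes x: "x \<in> carrier (end_ring C A)" and y: "y \<in> carrier (end_ring C A)"
  shows "y \<otimes>\<^bsub>end_ring C A\<^esub> x \<in> carrier (end_ring C A)"
    and "end_supp C A (y \<otimes>\<^bsub>end_ring C A\<^esub> x)
      \<subseteq> (\<lambda>(j, k). j + k) ` (end_supp C A y \<times> end_supp C A x)"
proof -
  let ?M = "(\<lambda>(j, k). j + k) ` (end_supp C A y \<times> end_supp C A x)"
  have zero: "(y \<otimes>\<^bsub>end_ring C A\<^esub> x) n = mor_zero C A (shift_obj C n A)" if n: "n \<notin> ?M" for n
  proof -
    interpret comm_group "Hom_group C A (shift_obj C n A)" by (rule Hom_group)
    have "shift_mor C k (y (n - k)) \<cdot> x k = mor_zero C A (shift_obj C n A)"
      if k: "k \<in> end_supp C A x" for k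
    proof -
      have "n - k \<notin> end_supp C A y"
      proof
        assume "n - k \<in> end_supp C A y"
        then have "(n - k) + k \<in> ?M" using k by force
        then show False using n by simp
      qed
      then show ?thesis
        using end_carrier_type[OF x] by (simp add: not_in_end_supp shift_obj_shift)
    qed
    then show ?thesis using finprod_one_eqI[of "end_supp C A x"] by (simp add: end_ring_def)
  qed
  then show "end_supp C A (y \<otimes>\<^bsub>end_ring C A\<^esub> x) \<subseteq> ?M" by (auto simp: end_supp_def)
  have "(y \<otimes>\<^bsub>end_ring C A\<^esub> x) n \<in> Hom C A (shift_obj C n A)" for n
    using end_term_type[OF x y] end_mult[OF x y end_carrier_finite[OF x]]
    by (simp add: finprod_Hom_closed)
  then show "y \<otimes>\<^bsub>end_ring C A\<^esub> x \<in> carrier (end_ring C A)"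
    using zero end_carrier_finite[OF x] end_carrier_finite[OF y]
    by (intro end_carrierI[of _ _ ?M]) (auto simp: Hom_iff)
qed

text \<open>Both bracketings are double sums of the triple composites \<open>t j k\<close>, with
  \<open>x\<close> in degree \<open>k\<close> and \<open>y\<close> in degree \<open>j\<close>; one
  sums over \<open>j\<close>, the other over the total degree \<open>j + k\<close>.\<close>

lemma end_mult_assoc:
  assumes x: "x \<in> carrier (end_ring C A)" and y: "y \<in> carrier (end_ring C A)"
    and z: "z \<in> carrier (end_ring C A)"
  shows "(z \<otimes>\<^bsub>end_ring C A\<^esub> y) \<otimes>\<^bsub>end_ring C A\<^esub> x = z \<otimes>\<^bsub>end_ring C A\<^esub> (y \<otimes>\<^bsub>end_ring C A\<^esub> x)"
proof
  fix n
  let ?K = "end_supp C A x" and ?J = "end_supp C A y"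
  let ?M = "(\<lambda>(j, k). j + k) ` (?J \<times> ?K)"
  let ?G = "\<lambda>n. Hom_group C A (shift_obj C n A)"
  define t where "t j k = shift_mor C (j + k) (z (n - (j + k))) \<cdot> (shift_mor C k (y j) \<cdot> x k)" for j k
  note type [simp] = end_carrier_type[OF x] end_carrier_type[OF y] end_carrier_type[OF z]
  note fin [simp] = end_carrier_finite[OF x] end_carrier_finite[OF y]
  interpret comm_group "?G n" by (rule Hom_group)
  have t [simp]: "t j k \<in> Hom C A (shift_obj C n A)" for j k
    by (simp add: t_def Hom_iff shift_obj_shift add.commute)
  have "((z \<otimes>\<^bsub>end_ring C A\<^esub> y) \<otimes>\<^bsub>end_ring C A\<^esub> x) n = finprod (?G n) (\<lambda>k. finprod (?G n) (\<lambda>j. t j k) ?J) ?K"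
    unfolding end_mult[OF x end_mult_closed(1)[OF y z] fin(1) order_refl]
  proof (rule finprod_cong')
    fix k
    let ?h = "\<lambda>f. shift_mor C k f \<cdot> x k"
    have "?h (finprod (?G (n - k)) (\<lambda>j. shift_mor C j (z (n - k - j)) \<cdot> y j) ?J)
        = finprod (?G n) (\<lambda>j. ?h (shift_mor C j (z (n - k - j)) \<cdot> y j)) ?J"
      by (rule finprod_Hom_hom) (auto simp: Hom_iff shift_obj_shift cmp_add_left')
    also have "\<dots> = finprod (?G n) (\<lambda>j. t j k) ?J"
    proof (rule finprod_cong')
      show "?h (shift_mor C j (z (n - k - j)) \<cdot> y j) = t j k" for j
        by (simp add: t_def shift_mor_shift shift_obj_shift algebra_simps)
    qed auto
    finally show "shift_mor C k ((z \<otimes>\<^bsub>end_ring C A\<^esub> y) (n - k)) \<cdot> x k = finprod (?G n) (\<lambda>j. t j k) ?J"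
      unfolding end_mult[OF y z fin(2) order_refl] .
  qed (simp_all add: finprod_Hom_closed)
  \<comment> \<open>Substituting \<open>m = j + k\<close> gives a range depending on
    \<open>k\<close>. Zero terms enlarge it to the whole sumset \<open>?M\<close>, so that the sums
    can be exchanged.\<close>
  also have "\<dots> = finprod (?G n) (\<lambda>k. finprod (?G n) (\<lambda>m. t (m - k) k) ?M) ?K"
  proof (rule finprod_cong')
    fix k assume k: "k \<in> ?K"
    have "finprod (?G n) (\<lambda>j. t j k) ?J = finprod (?G n) (\<lambda>j. t ((j + k) - k) k) ?J" by simp
    also have "\<dots> = finprod (?G n) (\<lambda>m. t (m - k) k) ((\<lambda>j. j + k) ` ?J)"
      by (rule finprod_reindex[symmetric]) (auto simp: inj_on_def)
    also have "\<dots> = finprod (?G n) (\<lambda>m. t (m - k) k) ?M"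
    proof (rule finprod_mono_neutral_cong_left)
      fix m assume "m \<in> ?M - (\<lambda>j. j + k) ` ?J"
      then have "m - k \<notin> ?J" by (metis DiffD2 diff_add_cancel image_eqI)
      then show "t (m - k) k = \<one>\<^bsub>?G n\<^esub>"
        by (simp add: t_def not_in_end_supp shift_obj_shift)
    qed (use k in auto)
    finally show "finprod (?G n) (\<lambda>j. t j k) ?J = finprod (?G n) (\<lambda>m. t (m - k) k) ?M" .
  qed (simp_all add: finprod_Hom_closed)
  also have "\<dots> = finprod (?G n) (\<lambda>m. finprod (?G n) (\<lambda>k. t (m - k) k) ?K) ?M"
    by (rule finprod_swap) simp_all
  also have "\<dots> = (z \<otimes>\<^bsub>end_ring C A\<^esub> (y \<otimes>\<^bsub>end_ring C A\<^esub> x)) n"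
    unfolding end_mult[OF end_mult_closed(1)[OF x y] z _ end_mult_closed(2)[OF x y], simplified]
  proof (rule finprod_cong'[symmetric])
    fix m
    let ?h = "\<lambda>f. shift_mor C m (z (n - m)) \<cdot> f"
    have "?h (finprod (?G m) (\<lambda>k. shift_mor C k (y (m - k)) \<cdot> x k) ?K)
        = finprod (?G n) (\<lambda>k. ?h (shift_mor C k (y (m - k)) \<cdot> x k)) ?K"
      by (rule finprod_Hom_hom) (auto simp: Hom_iff shift_obj_shift cmp_add_right')
    then show "shift_mor C m (z (n - m)) \<cdot> ((y \<otimes>\<^bsub>end_ring C A\<^esub> x) m)
        = finprod (?G n) (\<lambda>k. t (m - k) k) ?K"
      unfolding end_mult[OF x y fin(1) order_refl] t_def by simp
  qed (simp_all add: finprod_Hom_closed)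
  finally show "((z \<otimes>\<^bsub>end_ring C A\<^esub> y) \<otimes>\<^bsub>end_ring C A\<^esub> x) n = (z \<otimes>\<^bsub>end_ring C A\<^esub> (y \<otimes>\<^bsub>end_ring C A\<^esub> x)) n" .
qed

lemma end_abelian_group: "abelian_group (end_ring C A)"
proof (rule abelian_groupI)
  fix x y z
  assume x: "x \<in> carrier (end_ring C A)" and y: "y \<in> carrier (end_ring C A)"
    and z: "z \<in> carrier (end_ring C A)"
  note type [simp] = end_carrier_type[OF x] end_carrier_type[OF y] end_carrier_type[OF z]
  show "x \<oplus>\<^bsub>end_ring C A\<^esub> y \<in> carrier (end_ring C A)"
    using end_carrier_finite[OF x] end_carrier_finite[OF y]
    by (intro end_carrierI[of _ _ "end_supp C A x \<union> end_supp C A y"])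
      (auto simp: end_ring_sel(4) not_in_end_supp)
  show "(x \<oplus>\<^bsub>end_ring C A\<^esub> y) \<oplus>\<^bsub>end_ring C A\<^esub> z = x \<oplus>\<^bsub>end_ring C A\<^esub> (y \<oplus>\<^bsub>end_ring C A\<^esub> z)"
    by (simp add: end_ring_sel(4) add_assoc)
  show "x \<oplus>\<^bsub>end_ring C A\<^esub> y = y \<oplus>\<^bsub>end_ring C A\<^esub> x"
    by (simp add: end_ring_sel(4) add_comm)
next
  show "\<zero>\<^bsub>end_ring C A\<^esub> \<in> carrier (end_ring C A)"
    by (rule end_carrierI[of _ _ "{}"]) (simp_all add: end_ring_sel(2))
next
  fix x
  assume x: "x \<in> carrier (end_ring C A)"
  note type [simp] = end_carrier_type[OF x]
  show "\<zero>\<^bsub>end_ring C A\<^esub> \<oplus>\<^bsub>end_ring C A\<^esub> x = x"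
    by (simp add: end_ring_sel(2,4))
  show "\<exists>y\<in>carrier (end_ring C A). y \<oplus>\<^bsub>end_ring C A\<^esub> x = \<zero>\<^bsub>end_ring C A\<^esub>"
    using end_carrier_finite[OF x]
    by (intro bexI[of _ "\<lambda>k. mor_neg C (x k)"] end_carrierI[of _ _ "end_supp C A x"])
      (simp_all add: end_ring_sel(2,4) not_in_end_supp)
qed

lemma end_one_supp: "end_supp C A \<one>\<^bsub>end_ring C A\<^esub> \<subseteq> {0}"
  by (auto simp: end_supp_def end_ring_sel(3))

lemma end_one_closed: "\<one>\<^bsub>end_ring C A\<^esub> \<in> carrier (end_ring C A)"
  by (rule end_carrierI[of _ _ "{0}"]) (simp_all add: end_ring_sel(3))

lemma end_monoid: "monoid (end_ring C A)"
proof (rule monoidI)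
  fix x
  assume x: "x \<in> carrier (end_ring C A)"
  note type [simp] = end_carrier_type[OF x]
  show "\<one>\<^bsub>end_ring C A\<^esub> \<otimes>\<^bsub>end_ring C A\<^esub> x = x"
  proof
    fix n
    let ?G = "Hom_group C A (shift_obj C n A)"
    \<comment> \<open>Adding \<open>n\<close> keeps the surviving index in range even when the
      component of \<open>x\<close> at \<open>n\<close> vanishes.\<close>
    let ?K = "insert n (end_supp C A x)"
    interpret comm_group ?G by (rule Hom_group)
    have "(\<one>\<^bsub>end_ring C A\<^esub> \<otimes>\<^bsub>end_ring C A\<^esub> x) n
        = finprod ?G (\<lambda>k. shift_mor C k (\<one>\<^bsub>end_ring C A\<^esub> (n - k)) \<cdot> x k) ?K"
      by (rule end_mult[OF x end_one_closed]) (use end_carrier_finite[OF x] in auto)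
    also have "\<dots> = finprod ?G (\<lambda>k. if k = n then x k else \<one>\<^bsub>?G\<^esub>) ?K"
      by (rule finprod_cong') (auto simp: Hom_iff end_ring_sel(3) shift_obj_shift)
    also have "\<dots> = x n"
      using finprod_singleton_swap[of n ?K "\<lambda>k. x n"] end_carrier_finite[OF x]
      by (simp add: Hom_iff if_distrib cong: if_cong)
    finally show "(\<one>\<^bsub>end_ring C A\<^esub> \<otimes>\<^bsub>end_ring C A\<^esub> x) n = x n" .
  qed
  show "x \<otimes>\<^bsub>end_ring C A\<^esub> \<one>\<^bsub>end_ring C A\<^esub> = x"
  proof
    fix n
    interpret comm_group "Hom_group C A (shift_obj C n A)" by (rule Hom_group)
    show "(x \<otimes>\<^bsub>end_ring C A\<^esub> \<one>\<^bsub>end_ring C A\<^esub>) n = x n"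
      unfolding end_mult[OF end_one_closed x finite.insertI[OF finite.emptyI] end_one_supp]
      by (simp add: end_ring_sel(3) Hom_iff)
  qed
qed (simp_all add: end_mult_closed end_one_closed end_mult_assoc)

lemma end_is_ring: "ring (end_ring C A)"
proof (rule ringI[OF end_abelian_group end_monoid])
  interpret abelian_group "end_ring C A" by (rule end_abelian_group)
  fix x y z
  assume x: "x \<in> carrier (end_ring C A)" and y: "y \<in> carrier (end_ring C A)"
    and z: "z \<in> carrier (end_ring C A)"
  note type [simp] = end_carrier_type[OF x] end_carrier_type[OF y] end_carrier_type[OF z]
  show "(x \<oplus>\<^bsub>end_ring C A\<^esub> y) \<otimes>\<^bsub>end_ring C A\<^esub> z
      = x \<otimes>\<^bsub>end_ring C A\<^esub> z \<oplus>\<^bsub>end_ring C A\<^esub> y \<otimes>\<^bsub>end_ring C A\<^esub> z"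
  proof
    fix n
    let ?G = "Hom_group C A (shift_obj C n A)"
    let ?K = "end_supp C A z"
    interpret G: comm_group ?G by (rule Hom_group)
    note m = end_mult[OF z _ end_carrier_finite[OF z] order_refl]
    have "((x \<oplus>\<^bsub>end_ring C A\<^esub> y) \<otimes>\<^bsub>end_ring C A\<^esub> z) n
        = finprod ?G
          (\<lambda>k. (shift_mor C k (x (n - k)) \<cdot> z k) \<otimes>\<^bsub>?G\<^esub> (shift_mor C k (y (n - k)) \<cdot> z k)) ?K"
      unfolding m[OF a_closed[OF x y]]
      by (rule G.finprod_cong') (auto simp: end_ring_sel(4) Hom_iff shift_obj_shift cmp_add_left')
    also have "\<dots> = (x \<otimes>\<^bsub>end_ring C A\<^esub> z \<oplus>\<^bsub>end_ring C A\<^esub> y \<otimes>\<^bsub>end_ring C A\<^esub> z) n"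
      unfolding end_ring_sel(4) m[OF x] m[OF y]
      using end_term_type[OF z x] end_term_type[OF z y] by (subst G.finprod_multf) auto
    finally show "((x \<oplus>\<^bsub>end_ring C A\<^esub> y) \<otimes>\<^bsub>end_ring C A\<^esub> z) n
      = (x \<otimes>\<^bsub>end_ring C A\<^esub> z \<oplus>\<^bsub>end_ring C A\<^esub> y \<otimes>\<^bsub>end_ring C A\<^esub> z) n" .
  qed
  show "z \<otimes>\<^bsub>end_ring C A\<^esub> (x \<oplus>\<^bsub>end_ring C A\<^esub> y)
      = z \<otimes>\<^bsub>end_ring C A\<^esub> x \<oplus>\<^bsub>end_ring C A\<^esub> z \<otimes>\<^bsub>end_ring C A\<^esub> y"
  proof
    fix n
    let ?G = "Hom_group C A (shift_obj C n A)"
    let ?K = "end_supp C A x \<union> end_supp C A y"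
    interpret G: comm_group ?G by (rule Hom_group)
    have K: "finite ?K" "end_supp C A x \<subseteq> ?K" "end_supp C A y \<subseteq> ?K"
        "end_supp C A (x \<oplus>\<^bsub>end_ring C A\<^esub> y) \<subseteq> ?K"
      using end_carrier_finite[OF x] end_carrier_finite[OF y]
      by (auto simp: end_ring_sel(4) end_supp_def)
    have "(z \<otimes>\<^bsub>end_ring C A\<^esub> (x \<oplus>\<^bsub>end_ring C A\<^esub> y)) n
        = finprod ?G
          (\<lambda>k. (shift_mor C k (z (n - k)) \<cdot> x k) \<otimes>\<^bsub>?G\<^esub> (shift_mor C k (z (n - k)) \<cdot> y k)) ?K"
      unfolding end_mult[OF a_closed[OF x y] z K(1,4)]
      by (rule G.finprod_cong') (auto simp: end_ring_sel(4) Hom_iff shift_obj_shift cmp_add_right')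
    also have "\<dots> = (z \<otimes>\<^bsub>end_ring C A\<^esub> x \<oplus>\<^bsub>end_ring C A\<^esub> z \<otimes>\<^bsub>end_ring C A\<^esub> y) n"
      unfolding end_ring_sel(4) end_mult[OF x z K(1,2)] end_mult[OF y z K(1,3)]
      using end_term_type[OF x z] end_term_type[OF y z] by (subst G.finprod_multf) auto
    finally show "(z \<otimes>\<^bsub>end_ring C A\<^esub> (x \<oplus>\<^bsub>end_ring C A\<^esub> y)) n
      = (z \<otimes>\<^bsub>end_ring C A\<^esub> x \<oplus>\<^bsub>end_ring C A\<^esub> z \<otimes>\<^bsub>end_ring C A\<^esub> y) n" .
  qed
qed

lemma end_minus:
  assumes x: "x \<in> carrier (end_ring C A)"
  shows "\<ominus>\<^bsub>end_ring C A\<^esub> x = (\<lambda>k. mor_neg C (x k))"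
proof -
  interpret ring "end_ring C A" by (rule end_is_ring)
  note type [simp] = end_carrier_type[OF x]
  have "(\<lambda>k. mor_neg C (x k)) \<in> carrier (end_ring C A)"
    using end_carrier_finite[OF x]
    by (intro end_carrierI[of _ _ "end_supp C A x"]) (simp_all add: not_in_end_supp)
  then show ?thesis
    by (intro minus_equality x) (simp_all add: end_ring_sel(2,4))
qed

lemma koszul_sign_end:
  "x \<in> carrier (end_ring C A) \<Longrightarrow> koszul_sign (end_ring C A) m x = (\<lambda>k. mor_sign m (x k))"
  by (simp add: koszul_sign_def mor_sign_def end_minus)

lemma end_compD:
  assumes "x \<in> end_comp C A k"
  shows "x \<in> carrier (end_ring C A)" "end_supp C A x \<subseteq> {k}"
    and "n \<noteq> k \<Longrightarrow> x n = mor_zero C A (shift_obj C n A)"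
  using assms by (auto simp: end_comp_def end_supp_def)

lemma end_finsum:
  assumes "\<And>k. k \<in> K \<Longrightarrow> c k \<in> carrier (end_ring C A)"
  shows "(\<Oplus>\<^bsub>end_ring C A\<^esub>k\<in>K. c k) n = finprod (Hom_group C A (shift_obj C n A)) (\<lambda>k. c k n) K"
proof -
  interpret R: ring "end_ring C A" by (rule end_is_ring)
  interpret G: comm_group "Hom_group C A (shift_obj C n A)" by (rule Hom_group)
  show ?thesis using assms
  proof (induct K rule: infinite_finite_induct)
    case (insert a K)
    then have "(\<Oplus>\<^bsub>end_ring C A\<^esub>k\<in>insert a K. c k) n = c a n +\<^sub>m (\<Oplus>\<^bsub>end_ring C A\<^esub>k\<in>K. c k) n"
      by (subst R.finsum_insert) (auto simp: end_ring_sel(4))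
    then show ?case using insert by (subst G.finprod_insert) (auto simp: end_ring_sel(1))
  qed (simp_all add: end_ring_sel(2))
qed

text \<open>Evaluating the sum recovers each component, which gives both existence and uniqueness of
  the decomposition.\<close>

lemma end_finsum_homogeneous:
  assumes c: "\<And>k. c k \<in> end_comp C A k" and fin: "finite {k. c k \<noteq> \<zero>\<^bsub>end_ring C A\<^esub>}"
  shows "(\<Oplus>\<^bsub>end_ring C A\<^esub>k\<in>{k. c k \<noteq> \<zero>\<^bsub>end_ring C A\<^esub>}. c k) n = c n n"
proof -
  let ?G = "Hom_group C A (shift_obj C n A)"
  let ?S = "{k. c k \<noteq> \<zero>\<^bsub>end_ring C A\<^esub>}"
  interpret G: comm_group ?G by (rule Hom_group)
  have ty: "c k n \<in> Hom C A (shift_obj C n A)" for k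
    using end_compD(1)[OF c[of k]] by (simp add: end_ring_sel(1))
  have zero: "c k n = \<one>\<^bsub>?G\<^esub>" if "k \<noteq> n" for k
    using end_compD(3)[OF c[of k]] that by simp
  have "(\<Oplus>\<^bsub>end_ring C A\<^esub>k\<in>?S. c k) n = finprod ?G (\<lambda>k. c k n) ?S"
    using end_compD(1)[OF c] by (intro end_finsum) simp
  also have "\<dots> = finprod ?G (\<lambda>k. c k n) {n}"
    \<comment> \<open>The index \<open>n\<close> may lie outside the original set; then
      \<open>c n\<close> is zero and contributes the same value.\<close>
    using fin zero ty by (intro G.finprod_mono_neutral_cong) (auto simp: end_ring_sel(2))
  also have "\<dots> = c n n" using ty by (simp add: Hom_iff)
  finally show ?thesis .
qed

lemma end_comp_subgroup: "subgroup (end_comp C A k) (add_monoid (end_ring C A))"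
proof -
  interpret ring "end_ring C A" by (rule end_is_ring)
  show ?thesis
  proof (rule add.subgroupI)
    show "end_comp C A k \<subseteq> carrier (end_ring C A)" by (auto simp: end_comp_def)
    have "\<zero>\<^bsub>end_ring C A\<^esub> \<in> end_comp C A k"
      by (simp add: end_comp_def) (simp add: end_supp_def end_ring_sel(2))
    then show "end_comp C A k \<noteq> {}" by blast
  next
    fix x assume x: "x \<in> end_comp C A k"
    have "end_supp C A (\<ominus>\<^bsub>end_ring C A\<^esub> x) \<subseteq> {k}"
      using end_compD[OF x] by (auto simp: end_minus end_supp_def)
    then show "\<ominus>\<^bsub>end_ring C A\<^esub> x \<in> end_comp C A k"
      using end_compD(1)[OF x] by (simp add: end_comp_def)
  next
    fix x y assume x: "x \<in> end_comp C A k" and y: "y \<in> end_comp C A k"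
    have "end_supp C A (x \<oplus>\<^bsub>end_ring C A\<^esub> y) \<subseteq> {k}"
      using end_compD(3)[OF x] end_compD(3)[OF y]
      by (intro end_supp_subsetI) (simp add: end_ring_sel(4))
    then show "x \<oplus>\<^bsub>end_ring C A\<^esub> y \<in> end_comp C A k"
      using end_compD(1)[OF x] end_compD(1)[OF y] by (simp add: end_comp_def)
  qed
qed

lemma end_decomposition:
  assumes x: "x \<in> carrier (end_ring C A)"
  shows "\<exists>!c. (\<forall>k. c k \<in> end_comp C A k) \<and> finite {k. c k \<noteq> \<zero>\<^bsub>end_ring C A\<^esub>} \<and>
    x = (\<Oplus>\<^bsub>end_ring C A\<^esub>k \<in> {k. c k \<noteq> \<zero>\<^bsub>end_ring C A\<^esub>}. c k)"
proof
  note type [simp] = end_carrier_type[OF x]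
  let ?c = "\<lambda>k n. if n = k then x n else mor_zero C A (shift_obj C n A)"
  have c: "?c k \<in> end_comp C A k" for k
    unfolding end_comp_def mem_Collect_eq
    by (intro conjI end_supp_subsetI end_carrierI[of _ _ "{k}"]) simp_all
  moreover have "{k. ?c k \<noteq> \<zero>\<^bsub>end_ring C A\<^esub>} \<subseteq> end_supp C A x"
    by (auto simp: end_supp_def end_ring_sel(2) fun_eq_iff)
  then have fin: "finite {k. ?c k \<noteq> \<zero>\<^bsub>end_ring C A\<^esub>}"
    using end_carrier_finite[OF x] by (rule finite_subset)
  moreover have "x = (\<Oplus>\<^bsub>end_ring C A\<^esub>k \<in> {k. ?c k \<noteq> \<zero>\<^bsub>end_ring C A\<^esub>}. ?c k)"
    using end_finsum_homogeneous[of ?c, OF c fin] by (intro ext) simp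
  ultimately show "(\<forall>k. ?c k \<in> end_comp C A k) \<and> finite {k. ?c k \<noteq> \<zero>\<^bsub>end_ring C A\<^esub>} \<and>
      x = (\<Oplus>\<^bsub>end_ring C A\<^esub>k \<in> {k. ?c k \<noteq> \<zero>\<^bsub>end_ring C A\<^esub>}. ?c k)" by blast
  fix d
  assume d: "(\<forall>k. d k \<in> end_comp C A k) \<and> finite {k. d k \<noteq> \<zero>\<^bsub>end_ring C A\<^esub>} \<and>
    x = (\<Oplus>\<^bsub>end_ring C A\<^esub>k \<in> {k. d k \<noteq> \<zero>\<^bsub>end_ring C A\<^esub>}. d k)"
  show "d = ?c"
  proof (intro ext)
    fix k n
    show "d k n = ?c k n"
      using d end_compD(3)[of "d k" A k n] end_finsum_homogeneous[of d A n] by auto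
  qed
qed

lemma end_graded_ring: "graded_ring (end_ring C A) (end_comp C A)"
  unfolding graded_ring_def
proof (intro conjI allI ballI)
  show "\<one>\<^bsub>end_ring C A\<^esub> \<in> end_comp C A 0"
    using end_one_closed end_one_supp by (simp add: end_comp_def)
  fix k l a b assume a: "a \<in> end_comp C A k" and b: "b \<in> end_comp C A l"
  show "a \<otimes>\<^bsub>end_ring C A\<^esub> b \<in> end_comp C A (k + l)"
    using end_mult_closed[OF end_compD(1)[OF b] end_compD(1)[OF a]]
      image_mono[OF Sigma_mono[OF end_compD(2)[OF a] end_compD(2)[OF b]], of "\<lambda>(j, k). j + k"]
    by (auto simp: end_comp_def)
qed (rule end_is_ring end_comp_subgroup end_decomposition, assumption?)+

section \<open>Graded commutativity and the unit map\<close>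

lemma end_graded_commutative:
  assumes "categorical_idempotent C E"
  shows "graded_commutative (end_ring C E) (end_comp C E)"
  unfolding graded_commutative_def
proof (intro allI ballI)
  fix k l a b assume a: "a \<in> end_comp C E k" and b: "b \<in> end_comp C E l"
  note cl = end_compD(1)[OF a] end_compD(1)[OF b]
  note type [simp] = end_carrier_type[OF cl(1)] end_carrier_type[OF cl(2)]
  \<comment> \<open>A homogeneous right factor leaves one term of the sum, so each product is a
    single composite; off degree \<open>k + l\<close> both composites vanish.\<close>
  have single: "(y \<otimes>\<^bsub>end_ring C E\<^esub> x) n = shift_mor C j (y (n - j)) \<cdot> x j"
    if x: "x \<in> end_comp C E j" and y: "y \<in> carrier (end_ring C E)" for x y j n
  proof -
    interpret comm_group "Hom_group C E (shift_obj C n E)" by (rule Hom_group)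
    show ?thesis
      unfolding end_mult[OF end_compD(1)[OF x] y finite.insertI[OF finite.emptyI] end_compD(2)[OF x]]
      using end_term_type[OF end_compD(1)[OF x] y] by (simp add: Hom_iff)
  qed
  show "a \<otimes>\<^bsub>end_ring C E\<^esub> b = koszul_sign (end_ring C E) (k * l) (b \<otimes>\<^bsub>end_ring C E\<^esub> a)"
    unfolding koszul_sign_end[OF end_mult_closed(1)[OF cl]]
  proof
    fix n
    show "(a \<otimes>\<^bsub>end_ring C E\<^esub> b) n = mor_sign (k * l) ((b \<otimes>\<^bsub>end_ring C E\<^esub> a) n)"
    proof (cases "n = k + l")
      case True
      have "shift_mor C l (a k) \<cdot> b l = mor_sign (k * l) (shift_mor C k (b l) \<cdot> a k)"
        using categorical_idempotent_absorbing[OF assms] absorbing_supercommute[of E "a k" k "b l" l]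
        by simp
      then show ?thesis using True by (simp add: single[OF a cl(2)] single[OF b cl(1)])
    next
      case False
      then have "a (n - l) = mor_zero C E (shift_obj C (n - l) E)"
        "b (n - k) = mor_zero C E (shift_obj C (n - k) E)"
        using end_compD(3)[OF a] end_compD(3)[OF b] by auto
      then show ?thesis
        by (simp add: single[OF a cl(2)] single[OF b cl(1)] shift_obj_shift mor_sign_def)
    qed
  qed
qed

lemma left_unit_map_ring_hom: "left_unit_map C A \<in> ring_hom (end_ring C \<U>) (end_ring C A)"
proof (rule ring_hom_memI)
  fix x assume x: "x \<in> carrier (end_ring C \<U>)"
  note type [simp] = end_carrier_type[OF x]
  show cl: "left_unit_map C A x \<in> carrier (end_ring C A)"
    using end_carrier_finite[OF x]
    by (intro end_carrierI[of _ _ "end_supp C \<U> x"]) (simp_all add: left_unit_map_def not_in_end_supp)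
  fix y assume y: "y \<in> carrier (end_ring C \<U>)"
  note type' [simp] = end_carrier_type[OF y]
  show "left_unit_map C A (x \<oplus>\<^bsub>end_ring C \<U>\<^esub> y)
      = left_unit_map C A x \<oplus>\<^bsub>end_ring C A\<^esub> left_unit_map C A y"
    by (simp add: left_unit_map_def end_ring_sel(4) left_mult_add)
  have cl': "left_unit_map C A y \<in> carrier (end_ring C A)"
    using end_carrier_finite[OF y]
    by (intro end_carrierI[of _ _ "end_supp C \<U> y"]) (simp_all add: left_unit_map_def not_in_end_supp)
  show "left_unit_map C A (x \<otimes>\<^bsub>end_ring C \<U>\<^esub> y)
      = left_unit_map C A x \<otimes>\<^bsub>end_ring C A\<^esub> left_unit_map C A y"
  proof
    fix n
    let ?K = "end_supp C \<U> y"
    let ?G = "Hom_group C A (shift_obj C n A)"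
    interpret comm_group ?G by (rule Hom_group)
    have supp: "end_supp C A (left_unit_map C A y) \<subseteq> ?K"
      by (auto simp: end_supp_def left_unit_map_def)
    have "left_unit_map C A (x \<otimes>\<^bsub>end_ring C \<U>\<^esub> y) n
        = finprod ?G (\<lambda>k. left_mult C A n (shift_mor C k (x (n - k)) \<cdot> y k)) ?K"
      unfolding left_unit_map_def end_mult[OF y x end_carrier_finite[OF y] order_refl]
      by (rule finprod_Hom_hom) (auto simp: Hom_iff left_mult_add shift_obj_shift)
    also have "\<dots> = finprod ?G (\<lambda>k. shift_mor C k (left_unit_map C A x (n - k)) \<cdot> left_unit_map C A y k) ?K"
    proof (rule finprod_cong')
      fix k
      show "left_mult C A n (shift_mor C k (x (n - k)) \<cdot> y k)
          = shift_mor C k (left_unit_map C A x (n - k)) \<cdot> left_unit_map C A y k"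
        \<comment> \<open>The degrees \<open>k\<close> and \<open>n - k\<close> add up to
          \<open>n\<close>, so multiplicativity of \<open>left_mult\<close> applies to each
          summand.\<close>
        using left_mult_cmp[of "y k" k "x (n - k)" "n - k" A] by (simp add: left_unit_map_def)
    qed (use end_term_type[OF cl' cl] in auto)
    also have "\<dots> = (left_unit_map C A x \<otimes>\<^bsub>end_ring C A\<^esub> left_unit_map C A y) n"
      by (rule end_mult[OF cl' cl end_carrier_finite[OF y] supp, symmetric])
    finally show "left_unit_map C A (x \<otimes>\<^bsub>end_ring C \<U>\<^esub> y) n
        = (left_unit_map C A x \<otimes>\<^bsub>end_ring C A\<^esub> left_unit_map C A y) n" .
  qed
qed (auto simp: left_unit_map_def end_ring_sel(3))

lemma left_unit_map_graded_algebra: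
  assumes E: "categorical_idempotent C E"
  shows "graded_algebra (end_ring C \<U>) (end_comp C \<U>) (end_ring C E) (end_comp C E) (left_unit_map C E)"
  unfolding graded_algebra_def
proof (intro conjI allI)
  have closed: "left_unit_map C E ` carrier (end_ring C \<U>) \<subseteq> carrier (end_ring C E)"
    using left_unit_map_ring_hom by (auto simp: ring_hom_def)
  also have "\<dots> \<subseteq> graded_center (end_ring C E) (end_comp C E)"
    by (rule graded_commutative_center[OF end_graded_ring end_graded_commutative[OF E]])
  finally show "left_unit_map C E ` carrier (end_ring C \<U>) \<subseteq> graded_center (end_ring C E) (end_comp C E)" .
  fix k
  show "left_unit_map C E ` end_comp C \<U> k \<subseteq> end_comp C E k"
  proof
    fix z assume "z \<in> left_unit_map C E ` end_comp C \<U> k"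
    then obtain x where x: "x \<in> end_comp C \<U> k" and z: "z = left_unit_map C E x" by blast
    have "end_supp C E z \<subseteq> {k}"
      using end_compD(3)[OF x] by (intro end_supp_subsetI) (simp add: z left_unit_map_def)
    then show "z \<in> end_comp C E k"
      using closed end_compD(1)[OF x] z by (auto simp: end_comp_def)
  qed
qed (simp_all add: end_graded_ring end_graded_commutative categorical_idempotent_unit
    left_unit_map_ring_hom)

end

theorem theorem4p21:
  fixes C :: "('o, 'm, 'z) tm_category_scheme" and E :: 'o
  assumes "triangulated_monoidal_category C"
    and "categorical_idempotent C E"
  shows "graded_commutative (end_ring C E) (end_comp C E)
    \<and> graded_algebra (end_ring C (unit_obj C)) (end_comp C (unit_obj C))
        (end_ring C E) (end_comp C E) (left_unit_map C E)
    \<and> graded_algebra (end_ring C (unit_obj C)) (end_comp C (unit_obj C))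
        (end_ring C E) (end_comp C E) (right_unit_map C E)
    \<and> (\<forall>x \<in> carrier (end_ring C (unit_obj C)). left_unit_map C E x = right_unit_map C E x)
    \<and> (\<forall>k. \<forall>a \<in> Hom C (unit_obj C) (shift_obj C k (unit_obj C)).
          right_mult C E k a = left_mult C E k a)"
proof -
  interpret triangulated_monoidal_category C by fact
  have LR: "right_mult C E k a = left_mult C E k a"
    if "a \<in> Hom C (unit_obj C) (shift_obj C k (unit_obj C))" for k a
    using categorical_idempotent_absorbing[OF assms(2)] that by (simp add: Hom_iff)
  then have maps: "right_unit_map C E x = left_unit_map C E x"
    if "x \<in> carrier (end_ring C (unit_obj C))" for x
    using that by (simp add: right_unit_map_def left_unit_map_def end_ring_sel(1))
  note left = left_unit_map_graded_algebra[OF assms(2)]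
  show ?thesis
    using end_graded_commutative[OF assms(2)] left graded_algebra_cong[OF left maps] maps LR by simp
qed

end
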